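(* Let $A$ be a finite dimensional $E$-tame algebra over an algebraically closed field $k$ and $\eta\in K_0(\operatorname{proj}A)$. (a) For general $f\in\operatorname{Hom}(\eta)$ we have $D_f=D_\eta$; in particular $D_\eta$ is a rational polyhedral cone. (b) $D_\eta$ depends only on the TF equivalence class of $\eta$: if $\theta\in K_0(\operatorname{proj}A)$ is TF equivalent to $\eta$, then $D_\theta=D_\eta$.
   Context: $\theta(X)=\langle\theta,[X]\rangle$ with $\langle[P(i)],[S(j)]\rangle=\delta_{ij}$; $\overline{\mathcal{T}}_\theta=\{X\mid\theta(X')\ge0$ for all factor modules $X'\}$, $\overline{\mathcal{F}}_\theta=\{X\mid\theta(X')\le0$ for all submodules $X'\}$; $\theta,\eta$ TF equivalent if both agree. For $\eta\in K_0(\operatorname{proj}A)$, $\eta=[P_0]-[P_1]$ without common summands, $\operatorname{Hom}(\eta)=\operatorname{Hom}_A(P_1,P_0)$ (irreducible variety; "general" = in a nonempty Zariski open dense subset), $P_f$ the 2-term complex of $f$. $A$ is $E$-tame if for every $\theta$ there are $f,g\in\operatorname{Hom}(\theta)$ with $\operatorname{Hom}_{\mathsf{K}^b(\operatorname{proj}A)}(P_f,P_g[1])=0$. For $f$, $\nu=D\operatorname{Hom}_A(-,A)$, $C_f=\operatorname{Cok}f$, $K_{\nu f}=\operatorname{Ker}\nu f$, $D_f=\{\theta\in K_0(\operatorname{proj}A)_\mathbb{R}\mid C_f\in\overline{\mathcal{T}}_\theta,\ K_{\nu f}\in\overline{\mathcal{F}}_\theta\}$, $D_\eta=\bigcup_{f\in\operatorname{Hom}(\eta)}D_f$.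 *)

theory Defs
  imports Main "HOL-Library.Function_Algebras" "HOL-Computational_Algebra.Polynomial"
begin

definition alg_closed_field :: "'k::field itself \<Rightarrow> bool" where
  "alg_closed_field _ \<longleftrightarrow> (\<forall>p::'k poly. 1 \<le> degree p \<longrightarrow> (\<exists>x. poly p x = 0))"

definition fd_algebra :: "('k::field \<Rightarrow> 'a::ring_1 \<Rightarrow> 'a) \<Rightarrow> bool" where
  "fd_algebra sc \<longleftrightarrow> vector_space sc
     \<and> (\<forall>c x y. sc c (x * y) = sc c x * y \<and> sc c (x * y) = x * sc c y)
     \<and> (\<exists>B. finite B \<and> module.span sc B = UNIV)"

definition prim_idem :: "'a::ring_1 \<Rightarrow> bool" where
  "prim_idem u \<longleftrightarrow> u * u = u \<and> u \<noteq> 0 \<and>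
     (\<forall>v w. v * v = v \<and> w * w = w \<and> v * w = 0 \<and> w * v = 0 \<and> v + w = u \<longrightarrow> v = 0 \<or> w = 0)"

text \<open>A u and A v are isomorphic left modules (u, v idempotents).\<close>
definition iso_idem :: "'a::ring_1 \<Rightarrow> 'a \<Rightarrow> bool" where
  "iso_idem u v \<longleftrightarrow> (\<exists>x y. x = u * x * v \<and> y = v * y * u \<and> x * y = u \<and> y * x = v)"

text \<open>e 0, ..., e (n-1): primitive idempotents with P(i) = A e_i a complete irredundant
  list of the indecomposable projective A-modules up to isomorphism.\<close>
definition complete_prim_idems :: "nat \<Rightarrow> (nat \<Rightarrow> 'a::ring_1) \<Rightarrow> bool" where
  "complete_prim_idems n e \<longleftrightarrow> (\<forall>i<n. prim_idem (e i))
     \<and> (\<forall>i<n. \<forall>j<n. i \<noteq> j \<longrightarrow> \<not> iso_idem (e i) (e j))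
     \<and> (\<forall>u. prim_idem u \<longrightarrow> (\<exists>i<n. iso_idem u (e i)))"

definition Aq :: "nat \<Rightarrow> (nat \<Rightarrow> 'a::zero) set" where
  "Aq q = {x. \<forall>r\<ge>q. x r = 0}"

definition lm :: "'a::times \<Rightarrow> (nat \<Rightarrow> 'a) \<Rightarrow> (nat \<Rightarrow> 'a)" where
  "lm a x = (\<lambda>r. a * x r)"

definition vsc :: "('k \<Rightarrow> 'a \<Rightarrow> 'a) \<Rightarrow> 'k \<Rightarrow> (nat \<Rightarrow> 'a) \<Rightarrow> (nat \<Rightarrow> 'a)" where
  "vsc sc c x = (\<lambda>r. sc c (x r))"

definition submod :: "('a \<Rightarrow> 'm \<Rightarrow> 'm) \<Rightarrow> 'm::ab_group_add set \<Rightarrow> 'm set \<Rightarrow> bool" where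
  "submod act W V \<longleftrightarrow> V \<subseteq> W \<and> 0 \<in> V \<and> (\<forall>x\<in>V. \<forall>y\<in>V. x + y \<in> V)
     \<and> (\<forall>a. \<forall>x\<in>V. act a x \<in> V)"

text \<open>theta(X) = sum_i theta_i dim_k Hom_A(P(i), X) = sum_i theta_i dim_k (e_i X).\<close>
definition tval :: "nat \<Rightarrow> (nat \<Rightarrow> 'a) \<Rightarrow> ('k::field \<Rightarrow> 'm::ab_group_add \<Rightarrow> 'm)
    \<Rightarrow> ('a \<Rightarrow> 'm \<Rightarrow> 'm) \<Rightarrow> (nat \<Rightarrow> real) \<Rightarrow> 'm set \<Rightarrow> real" where
  "tval n e s act \<theta> X = (\<Sum>i<n. \<theta> i * real (vector_space.dim s (act (e i) ` X)))"

text \<open>A module is given as a subquotient W/U (U \<subseteq> W submodules of an ambient module).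
  Factor modules of W/U are W/V, submodules are V/U, for submodules U \<subseteq> V \<subseteq> W.\<close>
definition inT :: "nat \<Rightarrow> (nat \<Rightarrow> 'a) \<Rightarrow> ('k::field \<Rightarrow> 'm::ab_group_add \<Rightarrow> 'm)
    \<Rightarrow> ('a \<Rightarrow> 'm \<Rightarrow> 'm) \<Rightarrow> (nat \<Rightarrow> real) \<Rightarrow> 'm set \<Rightarrow> 'm set \<Rightarrow> bool" where
  "inT n e s act \<theta> W U \<longleftrightarrow> (\<forall>V. submod act W V \<and> U \<subseteq> V \<longrightarrow>
      0 \<le> tval n e s act \<theta> W - tval n e s act \<theta> V)"

definition inF :: "nat \<Rightarrow> (nat \<Rightarrow> 'a) \<Rightarrow> ('k::field \<Rightarrow> 'm::ab_group_add \<Rightarrow> 'm)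
    \<Rightarrow> ('a \<Rightarrow> 'm \<Rightarrow> 'm) \<Rightarrow> (nat \<Rightarrow> real) \<Rightarrow> 'm set \<Rightarrow> 'm set \<Rightarrow> bool" where
  "inF n e s act \<theta> W U \<longleftrightarrow> (\<forall>V. submod act W V \<and> U \<subseteq> V \<longrightarrow>
      tval n e s act \<theta> V - tval n e s act \<theta> U \<le> 0)"

text \<open>TF equivalence: every finite dimensional module is isomorphic to a subquotient of some A^q.\<close>
definition TF_equiv :: "nat \<Rightarrow> (nat \<Rightarrow> 'a::ring_1) \<Rightarrow> ('k::field \<Rightarrow> 'a \<Rightarrow> 'a)
    \<Rightarrow> (nat \<Rightarrow> real) \<Rightarrow> (nat \<Rightarrow> real) \<Rightarrow> bool" where
  "TF_equiv n e sc \<theta> \<eta> \<longleftrightarrow> (\<forall>q W U. submod lm (Aq q) W \<and> submod lm W U \<longrightarrow>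
      (inT n e (vsc sc) lm \<theta> W U \<longleftrightarrow> inT n e (vsc sc) lm \<eta> W U) \<and>
      (inF n e (vsc sc) lm \<theta> W U \<longleftrightarrow> inF n e (vsc sc) lm \<eta> W U))"

definition projmod :: "(nat \<Rightarrow> 'a::ring_1) \<Rightarrow> nat list \<Rightarrow> (nat \<Rightarrow> 'a) set" where
  "projmod e l = {x. (\<forall>r. length l \<le> r \<longrightarrow> x r = 0) \<and> (\<forall>r<length l. x r * e (l ! r) = x r)}"

definition P0 :: "nat \<Rightarrow> (nat \<Rightarrow> 'a::ring_1) \<Rightarrow> (nat \<Rightarrow> int) \<Rightarrow> (nat \<Rightarrow> 'a) set" where
  "P0 n e \<eta> = projmod e (concat (map (\<lambda>i. replicate (nat (\<eta> i)) i) [0..<n]))"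

definition P1 :: "nat \<Rightarrow> (nat \<Rightarrow> 'a::ring_1) \<Rightarrow> (nat \<Rightarrow> int) \<Rightarrow> (nat \<Rightarrow> 'a) set" where
  "P1 n e \<eta> = projmod e (concat (map (\<lambda>i. replicate (nat (- \<eta> i)) i) [0..<n]))"

definition hom_mod :: "('a \<Rightarrow> 'x \<Rightarrow> 'x) \<Rightarrow> 'x::plus set \<Rightarrow> ('a \<Rightarrow> 'y \<Rightarrow> 'y) \<Rightarrow> 'y::monoid_add set
    \<Rightarrow> ('x \<Rightarrow> 'y) set" where
  "hom_mod actX X actY Y = {f. (\<forall>x\<in>X. f x \<in> Y) \<and> (\<forall>x. x \<notin> X \<longrightarrow> f x = 0)
     \<and> (\<forall>x\<in>X. \<forall>y\<in>X. f (x + y) = f x + f y) \<and> (\<forall>a. \<forall>x\<in>X. f (actX a x) = actY a (f x))}"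

definition HomEta :: "nat \<Rightarrow> (nat \<Rightarrow> 'a::ring_1) \<Rightarrow> (nat \<Rightarrow> int)
    \<Rightarrow> ((nat \<Rightarrow> 'a) \<Rightarrow> (nat \<Rightarrow> 'a)) set" where
  "HomEta n e \<eta> = hom_mod lm (P1 n e \<eta>) lm (P0 n e \<eta>)"

definition homA :: "(nat \<Rightarrow> 'a::ring_1) set \<Rightarrow> ((nat \<Rightarrow> 'a) \<Rightarrow> 'a) set" where
  "homA P = hom_mod lm P (\<lambda>a b. a * b) UNIV"

definition dualA :: "('k::field \<Rightarrow> 'a::ring_1 \<Rightarrow> 'a) \<Rightarrow> ((nat \<Rightarrow> 'a) \<Rightarrow> 'a) set
    \<Rightarrow> (((nat \<Rightarrow> 'a) \<Rightarrow> 'a) \<Rightarrow> 'k) set" where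
  "dualA sc M = {\<psi>. (\<forall>m. m \<notin> M \<longrightarrow> \<psi> m = 0) \<and> (\<forall>m\<in>M. \<forall>m'\<in>M. \<psi> (m + m') = \<psi> m + \<psi> m')
     \<and> (\<forall>c. \<forall>m\<in>M. \<psi> (\<lambda>x. sc c (m x)) = c * \<psi> m)}"

definition dual_act :: "((nat \<Rightarrow> 'a::ring_1) \<Rightarrow> 'a) set \<Rightarrow> 'a \<Rightarrow> (((nat \<Rightarrow> 'a) \<Rightarrow> 'a) \<Rightarrow> 'k::field)
    \<Rightarrow> (((nat \<Rightarrow> 'a) \<Rightarrow> 'a) \<Rightarrow> 'k)" where
  "dual_act M a \<psi> = (\<lambda>m. if m \<in> M then \<psi> (\<lambda>x. m x * a) else 0)"

definition dual_scale :: "'k::field \<Rightarrow> ('b \<Rightarrow> 'k) \<Rightarrow> ('b \<Rightarrow> 'k)" where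
  "dual_scale c \<psi> = (\<lambda>m. c * \<psi> m)"

text \<open>nu f = D Hom_A(f, A) : D Hom_A(P1,A) \<rightarrow> D Hom_A(P0,A).\<close>
definition nu_map :: "((nat \<Rightarrow> 'a::ring_1) \<Rightarrow> 'a) set \<Rightarrow> ((nat \<Rightarrow> 'a) \<Rightarrow> (nat \<Rightarrow> 'a))
    \<Rightarrow> (((nat \<Rightarrow> 'a) \<Rightarrow> 'a) \<Rightarrow> 'k::field) \<Rightarrow> (((nat \<Rightarrow> 'a) \<Rightarrow> 'a) \<Rightarrow> 'k)" where
  "nu_map M0 f \<psi> = (\<lambda>m. if m \<in> M0 then \<psi> (m \<circ> f) else 0)"

definition Knuf :: "nat \<Rightarrow> (nat \<Rightarrow> 'a::ring_1) \<Rightarrow> ('k::field \<Rightarrow> 'a \<Rightarrow> 'a) \<Rightarrow> (nat \<Rightarrow> int)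
    \<Rightarrow> ((nat \<Rightarrow> 'a) \<Rightarrow> (nat \<Rightarrow> 'a)) \<Rightarrow> (((nat \<Rightarrow> 'a) \<Rightarrow> 'a) \<Rightarrow> 'k) set" where
  "Knuf n e sc \<eta> f = {\<psi> \<in> dualA sc (homA (P1 n e \<eta>)). nu_map (homA (P0 n e \<eta>)) f \<psi> = 0}"

definition Df :: "nat \<Rightarrow> (nat \<Rightarrow> 'a::ring_1) \<Rightarrow> ('k::field \<Rightarrow> 'a \<Rightarrow> 'a) \<Rightarrow> (nat \<Rightarrow> int)
    \<Rightarrow> ((nat \<Rightarrow> 'a) \<Rightarrow> (nat \<Rightarrow> 'a)) \<Rightarrow> (nat \<Rightarrow> real) set" where
  "Df n e sc \<eta> f = {\<theta>. (\<forall>i\<ge>n. \<theta> i = 0)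
     \<and> inT n e (vsc sc) lm \<theta> (P0 n e \<eta>) (f ` P1 n e \<eta>)
     \<and> inF n e (dual_scale :: 'k \<Rightarrow> _) (dual_act (homA (P1 n e \<eta>))) \<theta> (Knuf n e sc \<eta> f) {0}}"

definition Deta :: "nat \<Rightarrow> (nat \<Rightarrow> 'a::ring_1) \<Rightarrow> ('k::field \<Rightarrow> 'a \<Rightarrow> 'a) \<Rightarrow> (nat \<Rightarrow> int)
    \<Rightarrow> (nat \<Rightarrow> real) set" where
  "Deta n e sc \<eta> = (\<Union>f\<in>HomEta n e \<eta>. Df n e sc \<eta> f)"

text \<open>Hom_{K^b(proj A)}(P_f, P_g[1]) = 0 for f, g in Hom(theta) means: every
  h : P1 \<rightarrow> P0 is null-homotopic, i.e. h = g s + s' f.\<close>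
definition E_tame :: "nat \<Rightarrow> (nat \<Rightarrow> 'a::ring_1) \<Rightarrow> bool" where
  "E_tame n e \<longleftrightarrow> (\<forall>\<theta>::nat \<Rightarrow> int. (\<forall>i\<ge>n. \<theta> i = 0) \<longrightarrow>
     (\<exists>f\<in>HomEta n e \<theta>. \<exists>g\<in>HomEta n e \<theta>. \<forall>h\<in>HomEta n e \<theta>.
        \<exists>s\<in>hom_mod lm (P1 n e \<theta>) lm (P1 n e \<theta>). \<exists>s'\<in>hom_mod lm (P0 n e \<theta>) lm (P0 n e \<theta>).
          h = (g \<circ> s) + (s' \<circ> f)))"

inductive polyfun :: "'h set \<Rightarrow> ('k::field \<Rightarrow> 'h \<Rightarrow> 'h) \<Rightarrow> ('h::plus \<Rightarrow> 'k) \<Rightarrow> bool"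
  for H sm where
  pconst: "polyfun H sm (\<lambda>_. c)"
| plin: "(\<forall>f\<in>H. \<forall>g\<in>H. l (f + g) = l f + l g) \<Longrightarrow> (\<forall>c. \<forall>f\<in>H. l (sm c f) = c * l f)
         \<Longrightarrow> polyfun H sm l"
| padd: "polyfun H sm p \<Longrightarrow> polyfun H sm q \<Longrightarrow> polyfun H sm (\<lambda>f. p f + q f)"
| pmult: "polyfun H sm p \<Longrightarrow> polyfun H sm q \<Longrightarrow> polyfun H sm (\<lambda>f. p f * q f)"

text \<open>P holds on a nonempty Zariski open (hence dense) subset of the affine space H.\<close>
definition general :: "'h::plus set \<Rightarrow> ('k::field \<Rightarrow> 'h \<Rightarrow> 'h) \<Rightarrow> ('h \<Rightarrow> bool) \<Rightarrow> bool" where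
  "general H sm P \<longleftrightarrow> (\<exists>p. polyfun H sm p \<and> (\<exists>f\<in>H. p f \<noteq> 0) \<and> (\<forall>f\<in>H. p f \<noteq> 0 \<longrightarrow> P f))"

definition hom_scale :: "('k \<Rightarrow> 'a \<Rightarrow> 'a) \<Rightarrow> 'k \<Rightarrow> ((nat \<Rightarrow> 'a) \<Rightarrow> (nat \<Rightarrow> 'a))
    \<Rightarrow> ((nat \<Rightarrow> 'a) \<Rightarrow> (nat \<Rightarrow> 'a))" where
  "hom_scale sc c f = (\<lambda>x. vsc sc c (f x))"

definition rat_poly_cone :: "nat \<Rightarrow> (nat \<Rightarrow> real) set \<Rightarrow> bool" where
  "rat_poly_cone n C \<longleftrightarrow> (\<exists>G::(nat \<Rightarrow> int) set. finite G \<and> (\<forall>v\<in>G. \<forall>i\<ge>n. v i = 0) \<and>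
     C = {\<theta>. \<exists>c::(nat \<Rightarrow> int) \<Rightarrow> real. (\<forall>v\<in>G. 0 \<le> c v) \<and>
            \<theta> = (\<lambda>i. \<Sum>v\<in>G. c v * real_of_int (v i))})"

end

(* Hom(f, X) for X = W/U is the map u |-> M u on tuples over X, where M is the matrix of f, so that
   E(f,g) = 0 says both that Hom(f, C_g) is onto and that Hom(g, K_nu f) is injective, and
   theta(X) = dim Hom(P0,X) - dim Hom(P1,X). The heart of the proof is that, for A E-tame and theta
   integral, X lies in T_theta (F_theta) iff Hom(f,X) is onto (injective) for some f in Hom(theta).
   Take a long sequence f_1, f_2, ... in Hom(theta) with E(f_j,f_i) = 0 for i < j and put V_0 = 0,
   U_{i+1} = Hom(f_{i+1},X)^{-1}(V_i), V_{i+1} = U_{i+1} Hom(P1,P0). The E-vanishing keeps V_i in the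
   image of Hom(f_j,X) for j > i; if no f_j is onto (injective), the semistability inequality for the
   submodule generated by U_{i+1} forces dim V_i to grow without bound.
   Consequently an integral theta lies in D_f iff E(f,g) = 0 = E(g,f) for some g in Hom(theta), a
   condition that is open in f. There are finitely many cones D_f and each has finitely many integral
   generators, so a general D_f contains all of them. For (b), if zeta in D_eta is integral, choose h
   in Hom(zeta) with C_h in T_eta and K_nu h in F_eta; TF equivalence replaces eta by theta. *)

theory Submission
  imports Defs
begin

subsection \<open>Finite dimensional subspaces\<close>

text \<open>E-tameness supplies for each \<theta> one pair f, g with E(f,g) = 0 in which f and g may
  differ; E(f,f) = 0 need not hold, so a presentation cannot be compared with itself. This is why
  chains appear. Vanishing of E is surjectivity of a linear map depending affinely on each argument,
  hence an open condition in each, and over an infinite field finitely many nonempty open conditions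
  on Hom(\<theta>) can be met together; a chain grows by taking each new member general with respect
  to the earlier ones. Presentations give access to integral points only. Real points are reached
  because D_f is cut out by finitely many inequalities with integral coefficients, so it is
  generated by finitely many integral vectors. The criterion E(f,g) = 0 = E(g,f) is symmetric:
  \<zeta> lies in D_f for some f in Hom(\<eta>) iff \<eta> lies in D_h for some h in Hom(\<zeta>).
  This reciprocity turns membership in the cone of \<eta> into a statement about the torsion and
  torsion-free classes of \<eta>, which is what TF equivalence controls.\<close>

definition fin_subspace :: "('k::field \<Rightarrow> 'm::ab_group_add \<Rightarrow> 'm) \<Rightarrow> 'm set \<Rightarrow> bool" where
  "fin_subspace s S \<longleftrightarrow> module.subspace s S \<and> (\<exists>B. finite B \<and> S \<subseteq> module.span s B)"

section \<open>Dimension counts for finitely spanned subspaces of a space of arbitrary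
  dimension\<close>

context vector_space
begin


lemma fin_subspaceI: "subspace S \<Longrightarrow> finite B \<Longrightarrow> S \<subseteq> span B \<Longrightarrow> fin_subspace scale S"
  unfolding fin_subspace_def by blast

lemma fin_subspace_subspace: "fin_subspace scale S \<Longrightarrow> subspace S"
  unfolding fin_subspace_def by blast

lemma fin_subspace_mono: "fin_subspace scale S \<Longrightarrow> subspace T \<Longrightarrow> T \<subseteq> S \<Longrightarrow> fin_subspace scale T"
  unfolding fin_subspace_def by blast

lemma fin_subspace_basis:
  assumes "fin_subspace scale S"
  obtains B where "finite B" "independent B" "B \<subseteq> S" "span B = S" "card B = dim S"
proof -
  obtain B where B: "B \<subseteq> S" "independent B" "S \<subseteq> span B" "card B = dim S"
    using basis_exists by blast
  obtain C where C: "finite C" "S \<subseteq> span C" using assms unfolding fin_subspace_def by blast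
  have "finite B" using independent_span_bound[OF C(1) B(2)] B(1) C(2) by blast
  moreover have "span B = S" using B(1,3) assms span_subspace fin_subspace_subspace by blast
  ultimately show thesis using that B by blast
qed

lemma card_le_dim_fin:
  assumes "fin_subspace scale S" "independent B" "B \<subseteq> S"
  shows "finite B \<and> card B \<le> dim S"
proof -
  obtain C where C: "finite C" "independent C" "C \<subseteq> S" "span C = S" "card C = dim S"
    using fin_subspace_basis[OF assms(1)] .
  then show ?thesis using independent_span_bound[OF C(1) assms(2)] assms(3) by auto
qed

lemma dim_mono_fin:
  assumes "fin_subspace scale S" "subspace T" "T \<subseteq> S"
  shows "dim T \<le> dim S"
proof -
  obtain C where "finite C" "independent C" "C \<subseteq> T" "span C = T" "card C = dim T"
    using fin_subspace_basis[OF fin_subspace_mono[OF assms]] .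
  then show ?thesis using card_le_dim_fin[OF assms(1)] assms(3) by (metis subset_trans)
qed

lemma dim_eq_fin:
  assumes "fin_subspace scale S" "subspace T" "T \<subseteq> S" "dim S \<le> dim T"
  shows "T = S"
proof (rule ccontr)
  assume "T \<noteq> S"
  then obtain x where x: "x \<in> S" "x \<notin> T" using assms(3) by blast
  obtain C where C: "finite C" "independent C" "C \<subseteq> T" "span C = T" "card C = dim T"
    using fin_subspace_basis[OF fin_subspace_mono[OF assms(1-3)]] .
  have "independent (insert x C)" using C x independent_insertI by blast
  then have "card (insert x C) \<le> dim S" using card_le_dim_fin[OF assms(1)] C x assms(3) by blast
  moreover have "x \<notin> C" using C x by blast
  ultimately show False using C assms(4) by simp
qed

lemma dim_less_fin:
  assumes "fin_subspace scale S" "subspace T" "T \<subseteq> S" "T \<noteq> S"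
  shows "dim T < dim S"
  using dim_eq_fin[OF assms(1-3)] assms(4) by force

lemma span_image_sum: "finite I \<Longrightarrow> x \<in> span (g ` I) \<Longrightarrow> \<exists>c. x = (\<Sum>i\<in>I. scale (c i) (g i))"
proof -
  assume I: "finite I" and x: "x \<in> span (g ` I)"
  have "subspace (range (\<lambda>c. \<Sum>i\<in>I. scale (c i) (g i)))"
  proof (rule subspaceI)
    show "0 \<in> range (\<lambda>c. \<Sum>i\<in>I. scale (c i) (g i))" by (rule image_eqI[of _ _ "\<lambda>_. 0"]) auto
    fix x y assume "x \<in> range (\<lambda>c. \<Sum>i\<in>I. scale (c i) (g i))" "y \<in> range (\<lambda>c. \<Sum>i\<in>I. scale (c i) (g i))"
    then obtain c d where "x = (\<Sum>i\<in>I. scale (c i) (g i))" "y = (\<Sum>i\<in>I. scale (d i) (g i))" by auto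
    then have "x + y = (\<Sum>i\<in>I. scale (c i + d i) (g i))"
      by (simp add: scale_left_distrib sum.distrib)
    then show "x + y \<in> range (\<lambda>c. \<Sum>i\<in>I. scale (c i) (g i))" by (rule range_eqI[of _ _ "\<lambda>i. c i + d i"])
  next
    fix a x assume "x \<in> range (\<lambda>c. \<Sum>i\<in>I. scale (c i) (g i))"
    then obtain c where "x = (\<Sum>i\<in>I. scale (c i) (g i))" by auto
    then have "scale a x = (\<Sum>i\<in>I. scale (a * c i) (g i))" by (simp add: scale_sum_right)
    then show "scale a x \<in> range (\<lambda>c. \<Sum>i\<in>I. scale (c i) (g i))" by (rule range_eqI[of _ _ "\<lambda>i. a * c i"])
  qed
  moreover have "g ` I \<subseteq> range (\<lambda>c. \<Sum>i\<in>I. scale (c i) (g i))"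
  proof clarify
    fix i assume i: "i \<in> I"
    have "g i = (\<Sum>j\<in>I. scale (if j = i then 1 else 0) (g j))"
      using I i by (subst sum.remove[OF I i]) (auto intro!: sum.neutral)
    then show "g i \<in> range (\<lambda>c. \<Sum>i\<in>I. scale (c i) (g i))" by (rule range_eqI[of _ _ "\<lambda>j. if j = i then 1 else 0"])
  qed
  ultimately have "span (g ` I) \<subseteq> range (\<lambda>c. \<Sum>i\<in>I. scale (c i) (g i))"
    by (rule span_minimal[rotated])
  then show ?thesis using x by blast
qed

text \<open>A substitute for the quotient map by S that stays inside the same type: subtract from
  the identity a linear projection onto S.\<close>

lemma ex_linear_kernel:
  assumes "subspace S"
  shows "\<exists>p. Vector_Spaces.linear scale scale p \<and> (\<forall>x. p x = 0 \<longleftrightarrow> x \<in> S)"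
proof -
  interpret P: vector_space_pair scale scale by unfold_locales
  have l: "Vector_Spaces.linear scale scale (\<lambda>x. x)" by (rule module_hom_ident)
  obtain g where g: "range g \<subseteq> S" "Vector_Spaces.linear scale scale g" "\<forall>v\<in>S. g v = v"
    using P.linear_exists_left_inverse_on[OF l assms] by auto
  have "Vector_Spaces.linear scale scale (\<lambda>x. x - g x)"
    using P.module_hom_sub l g(2) by blast
  moreover have "x - g x = 0 \<longleftrightarrow> x \<in> S" for x using g by (metis eq_iff_diff_eq_0 rangeI subsetD)
  ultimately show ?thesis by blast
qed

text \<open>Divide out S by a map p with kernel S, then take the coordinate at p x in a basis that
  contains p x.\<close>

lemma ex_separating_functional:
  assumes "subspace S" "x \<notin> S"
  shows "\<exists>\<phi>. (\<forall>y z. \<phi> (y + z) = \<phi> y + \<phi> z) \<and> (\<forall>c y. \<phi> (scale c y) = c * \<phi> y)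
    \<and> (\<forall>y\<in>S. \<phi> y = 0) \<and> \<phi> x \<noteq> 0"
proof -
  obtain p where p: "Vector_Spaces.linear scale scale p" "\<And>x. p x = 0 \<longleftrightarrow> x \<in> S"
    using ex_linear_kernel[OF assms(1)] by blast
  interpret p: Vector_Spaces.linear scale scale p by fact
  have "independent {p x}" using p(2) assms(2) by simp
  then obtain B where B: "independent B" "p x \<in> B" "span B = UNIV"
    using span_extend_basis independent_extend_basis extend_basis_superset by (metis insert_subset)
  define \<phi> where "\<phi> y = representation B (p y) (p x)" for y
  have "\<phi> (y + z) = \<phi> y + \<phi> z" for y z
    unfolding \<phi>_def p.add using representation_add[OF B(1)] B(3) by simp
  moreover have "\<phi> (scale c y) = c * \<phi> y" for c y
    unfolding \<phi>_def p.scale using representation_scale[OF B(1)] B(3) by simp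
  moreover have "\<phi> y = 0" if "y \<in> S" for y
    using that p(2)[of y] by (simp add: \<phi>_def representation_zero)
  moreover have "\<phi> x = 1" unfolding \<phi>_def using representation_basis[OF B(1,2)] by simp
  ultimately show ?thesis by (metis zero_neq_one)
qed

end

section \<open>Rank and nullity for maps that are linear on a subspace\<close>

context vector_space_pair
begin

text \<open>A basis of the kernel together with the lift of a basis of the image along a linear
  section \<open>h\<close> is a basis of S.\<close>

lemma rank_nullity_linear:
  assumes S: "fin_subspace s1 S" and f: "Vector_Spaces.linear s1 s2 f"
  shows "vs1.dim S = vs1.dim {x\<in>S. f x = 0} + vs2.dim (f ` S)"
proof -
  interpret f: Vector_Spaces.linear s1 s2 f by fact
  have sS: "vs1.subspace S" using S vs1.fin_subspace_subspace by blast
  have sfS: "vs2.subspace (f ` S)" using f.subspace_image[OF sS] .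
  have sK: "vs1.subspace {x\<in>S. f x = 0}"
    using vs1.subspace_inter[OF sS f.subspace_kernel] by (simp add: Int_def)
  have K: "fin_subspace s1 {x\<in>S. f x = 0}" using vs1.fin_subspace_mono[OF S sK] by blast
  obtain B where B: "finite B" "S \<subseteq> vs1.span B" using S unfolding fin_subspace_def by blast
  have F: "fin_subspace s2 (f ` S)"
    using vs2.fin_subspaceI[OF sfS, of "f ` B"] B f.spans_image by blast
  obtain C where C: "finite C" "vs2.independent C" "C \<subseteq> f ` S" "vs2.span C = f ` S" "card C = vs2.dim (f ` S)"
    using vs2.fin_subspace_basis[OF F] .
  obtain B0 where B0: "finite B0" "vs1.independent B0" "B0 \<subseteq> {x\<in>S. f x = 0}"
      "vs1.span B0 = {x\<in>S. f x = 0}" "card B0 = vs1.dim {x\<in>S. f x = 0}"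
    using vs1.fin_subspace_basis[OF K] .
  obtain h where h: "range h \<subseteq> S" "Vector_Spaces.linear s2 s1 h" "\<forall>v\<in>f ` S. f (h v) = v"
    using linear_exists_right_inverse_on[OF f sS] by blast
  interpret h: Vector_Spaces.linear s2 s1 h by fact
  have inj: "inj_on h (vs2.span C)" using h(3) C(4) by (metis inj_onI)
  have hC: "vs1.independent (h ` C)" using h.independent_injective_image[OF C(2) inj] .
  have disj: "B0 \<inter> h ` C = {}"
  proof (rule ccontr)
    assume "B0 \<inter> h ` C \<noteq> {}"
    then obtain w where w: "w \<in> C" "h w \<in> B0" by blast
    then have "w = 0" using B0(3) h(3) C(3) by fastforce
    then show False using C(2) w(1) vs2.dependent_zero by blast
  qed
  have ind: "vs1.independent (B0 \<union> h ` C)"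
  proof (rule vs1.independent_if_scalars_zero)
    show "finite (B0 \<union> h ` C)" using B0(1) C(1) by simp
    fix u x assume z: "(\<Sum>x\<in>B0 \<union> h ` C. s1 (u x) x) = 0" and x: "x \<in> B0 \<union> h ` C"
    define y where "y = (\<Sum>x\<in>h ` C. s1 (u x) x)"
    define z0 where "z0 = (\<Sum>x\<in>B0. s1 (u x) x)"
    have yz: "z0 + y = 0" using z sum.union_disjoint[OF B0(1) _ disj, of "\<lambda>x. s1 (u x) x"] C(1)
      by (simp add: y_def z0_def)
    have "z0 \<in> vs1.span B0" unfolding z0_def
      by (intro vs1.span_sum vs1.span_scale vs1.span_base)
    then have "f z0 = 0" using B0(4) by blast
    then have fy: "f y = 0" using yz f.add[of z0 y] by simp
    have "y \<in> vs1.span (h ` C)" unfolding y_def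
      by (intro vs1.span_sum vs1.span_scale vs1.span_base)
    then obtain w where w: "w \<in> f ` S" "y = h w" using h.span_image[of C] C(4) by auto
    have "y = 0" using fy w h(3) by (metis h.zero)
    have u1: "\<forall>x\<in>h ` C. u x = 0"
      using vs1.independentD[OF hC finite_imageI[OF C(1)] order_refl, of u] \<open>y = 0\<close> y_def by simp
    have "\<forall>x\<in>B0. u x = 0"
      using vs1.independentD[OF B0(2) B0(1) order_refl, of u] \<open>y = 0\<close> yz z0_def by simp
    then show "u x = 0" using u1 x by blast
  qed
  have "S \<subseteq> vs1.span (B0 \<union> h ` C)"
  proof
    fix x assume x: "x \<in> S"
    have "f (x - h (f x)) = 0" using h(3) x by (simp add: f.diff)
    moreover have "x - h (f x) \<in> S" using h(1) x vs1.subspace_diff[OF sS] by blast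
    ultimately have "x - h (f x) \<in> vs1.span (B0 \<union> h ` C)"
      using B0(4) vs1.span_mono[of B0 "B0 \<union> h ` C"] by auto
    moreover have "h (f x) \<in> vs1.span (B0 \<union> h ` C)"
      using h.span_image[of C] C(4) x vs1.span_mono[of "h ` C" "B0 \<union> h ` C"] by auto
    ultimately show "x \<in> vs1.span (B0 \<union> h ` C)" using vs1.span_add by fastforce
  qed
  moreover have "B0 \<union> h ` C \<subseteq> S" using B0(3) h(1) by blast
  ultimately have "vs1.dim S = card (B0 \<union> h ` C)" using vs1.basis_card_eq_dim[OF _ _ ind] by metis
  also have "\<dots> = card B0 + card (h ` C)" using card_Un_disjoint[OF B0(1) _ disj] C(1) by simp
  also have "card (h ` C) = card C"
    by (rule card_image, rule inj_on_subset[OF inj vs2.span_superset])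
  finally show ?thesis using B0(5) C(5) by simp
qed

text \<open>Module actions and the maps built from them are additive and homogeneous on carriers
  only, while linearity is a property of total functions. Extending from a basis of S gives a total
  linear map to which the theory applies.\<close>

lemma linear_extension:
  assumes S: "vs1.subspace S"
    and add: "\<And>x y. x \<in> S \<Longrightarrow> y \<in> S \<Longrightarrow> f (x + y) = f x + f y"
    and scale: "\<And>c x. x \<in> S \<Longrightarrow> f (s1 c x) = s2 c (f x)"
  shows "\<exists>g. Vector_Spaces.linear s1 s2 g \<and> (\<forall>x\<in>S. g x = f x)"
proof -
  obtain B where B: "B \<subseteq> S" "vs1.independent B" "S \<subseteq> vs1.span B"
    by (rule vs1.basis_exists[of S])
  obtain g where g: "Vector_Spaces.linear s1 s2 g" "\<forall>b\<in>B. g b = f b" using linear_independent_extend[OF B(2), of f] by auto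
  interpret g: Vector_Spaces.linear s1 s2 g by fact
  have "f 0 = 0" using scale[OF vs1.subspace_0[OF S], of 0] by simp
  have "vs1.subspace {x\<in>S. g x = f x}"
  proof (rule vs1.subspaceI)
    show "0 \<in> {x\<in>S. g x = f x}" using \<open>f 0 = 0\<close> g.zero vs1.subspace_0[OF S] by simp
    show "x + y \<in> {x\<in>S. g x = f x}" if "x \<in> {x\<in>S. g x = f x}" "y \<in> {x\<in>S. g x = f x}" for x y
      using that vs1.subspace_add[OF S] by (simp add: g.add add)
    show "s1 c x \<in> {x\<in>S. g x = f x}" if "x \<in> {x\<in>S. g x = f x}" for c x
      using that vs1.subspace_scale[OF S] by (simp add: g.scale scale)
  qed
  moreover have "B \<subseteq> {x\<in>S. g x = f x}" using B(1) g(2) by auto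
  ultimately have "vs1.span B \<subseteq> {x\<in>S. g x = f x}" using vs1.span_minimal by blast
  then show ?thesis using g(1) B(3) by blast
qed

lemma rank_nullity:
  assumes S: "fin_subspace s1 S"
    and add: "\<And>x y. x \<in> S \<Longrightarrow> y \<in> S \<Longrightarrow> f (x + y) = f x + f y"
    and scale: "\<And>c x. x \<in> S \<Longrightarrow> f (s1 c x) = s2 c (f x)"
  shows "vs1.dim S = vs1.dim {x\<in>S. f x = 0} + vs2.dim (f ` S)"
proof -
  obtain g where g: "Vector_Spaces.linear s1 s2 g" "\<forall>x\<in>S. g x = f x"
    using linear_extension[of S f] assms vs1.fin_subspace_subspace by blast
  have "{x\<in>S. f x = 0} = {x\<in>S. g x = 0}" "f ` S = g ` S" using g(2) by auto
  then show ?thesis using rank_nullity_linear[OF S g(1)] by simp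
qed

lemma subspace_image_on:
  assumes S: "vs1.subspace S"
    and add: "\<And>x y. x \<in> S \<Longrightarrow> y \<in> S \<Longrightarrow> f (x + y) = f x + f y"
    and scale: "\<And>c x. x \<in> S \<Longrightarrow> f (s1 c x) = s2 c (f x)"
  shows "vs2.subspace (f ` S)"
proof -
  obtain g where g: "Vector_Spaces.linear s1 s2 g" "\<forall>x\<in>S. g x = f x"
    using linear_extension[of S f] assms by blast
  have "f ` S = g ` S" using g(2) by auto
  then show ?thesis using module_hom.subspace_image[OF g(1)[unfolded linear_iff_module_hom] S] by simp
qed

text \<open>Rank-nullity for the composite \<open>S \<rightarrow> V \<rightarrow> V / V0\<close>.\<close>

lemma relative_rank_nullity:
  assumes S: "fin_subspace s1 S" and V: "fin_subspace s2 V" and V0: "vs2.subspace V0" "V0 \<subseteq> V"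
    and add: "\<And>x y. x \<in> S \<Longrightarrow> y \<in> S \<Longrightarrow> f (x + y) = f x + f y"
    and scale: "\<And>c x. x \<in> S \<Longrightarrow> f (s1 c x) = s2 c (f x)"
    and f: "f ` S \<subseteq> V"
  shows "vs1.dim S + vs2.dim V0 \<le> vs1.dim {x\<in>S. f x \<in> V0} + vs2.dim V"
    and "vs1.dim S + vs2.dim V0 = vs1.dim {x\<in>S. f x \<in> V0} + vs2.dim V
       \<longleftrightarrow> (\<forall>y\<in>V. \<exists>x\<in>S. y - f x \<in> V0)"
proof -
  interpret P: vector_space_pair s2 s2 by unfold_locales
  obtain p where p: "Vector_Spaces.linear s2 s2 p" "\<And>x. p x = 0 \<longleftrightarrow> x \<in> V0"
    using vs2.ex_linear_kernel[OF V0(1)] by blast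
  interpret p: Vector_Spaces.linear s2 s2 p by fact
  have 1: "vs1.dim S = vs1.dim {x\<in>S. f x \<in> V0} + vs2.dim ((\<lambda>x. p (f x)) ` S)"
    using rank_nullity[OF S, of "\<lambda>x. p (f x)"] add scale by (simp add: p.add p.scale p(2))
  have 2: "vs2.dim V = vs2.dim V0 + vs2.dim (p ` V)"
    using P.rank_nullity_linear[OF V p(1)] p(2) V0(2) by (simp add: Collect_conj_eq Int_absorb1)
  have sub: "vs2.subspace ((\<lambda>x. p (f x)) ` S)"
    using subspace_image_on[of S "\<lambda>x. p (f x)"] S add scale vs1.fin_subspace_subspace
    by (simp add: p.add p.scale)
  have le: "(\<lambda>x. p (f x)) ` S \<subseteq> p ` V" using f by blast
  have fin: "fin_subspace s2 (p ` V)"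
  proof -
    obtain B where B: "finite B" "V \<subseteq> vs2.span B" using V unfolding fin_subspace_def by blast
    then show ?thesis using vs2.fin_subspaceI[of "p ` V" "p ` B"] p.spans_image
        p.subspace_image V vs2.fin_subspace_subspace by blast
  qed
  show "vs1.dim S + vs2.dim V0 \<le> vs1.dim {x\<in>S. f x \<in> V0} + vs2.dim V"
    using 1 2 vs2.dim_mono_fin[OF fin sub le] by linarith
  have "vs2.dim ((\<lambda>x. p (f x)) ` S) = vs2.dim (p ` V) \<longleftrightarrow> (\<lambda>x. p (f x)) ` S = p ` V"
    using vs2.dim_eq_fin[OF fin sub le] eq_imp_le by metis
  also have "\<dots> \<longleftrightarrow> p ` V \<subseteq> (\<lambda>x. p (f x)) ` S" using le by blast
  also have "\<dots> \<longleftrightarrow> (\<forall>y\<in>V. \<exists>x\<in>S. p y = p (f x))" by (auto simp: image_iff subset_iff)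
  also have "\<dots> \<longleftrightarrow> (\<forall>y\<in>V. \<exists>x\<in>S. y - f x \<in> V0)"
    by (simp add: p(2)[symmetric] p.diff)
  finally show "vs1.dim S + vs2.dim V0 = vs1.dim {x\<in>S. f x \<in> V0} + vs2.dim V
       \<longleftrightarrow> (\<forall>y\<in>V. \<exists>x\<in>S. y - f x \<in> V0)" using 1 2 by linarith
qed

end

lemma vector_space_vsc: "vector_space s \<Longrightarrow> vector_space (vsc s)"
  unfolding vector_space_def vsc_def by (auto simp: fun_eq_iff)

subsection \<open>Tuples and matrices over an algebra with idempotents\<close>

text \<open>\<open>tup act e l Z\<close> is \<open>Hom(P, Z)\<close> for \<open>P\<close> the direct sum of the \<open>A e_i\<close>, \<open>i\<close> in \<open>l\<close>;
  \<open>Mat e k l\<close> is \<open>Hom(P, Q)\<close> for the projectives \<open>P\<close>, \<open>Q\<close> given by \<open>k\<close>, \<open>l\<close>. Homomorphisms act on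
  row vectors from the right, so \<open>mmul\<close> composes them in diagrammatic order.\<close>

definition tup :: "('a \<Rightarrow> 'm \<Rightarrow> 'm) \<Rightarrow> (nat \<Rightarrow> 'a) \<Rightarrow> nat list \<Rightarrow> 'm::zero set \<Rightarrow> (nat \<Rightarrow> 'm) set" where
  "tup act e l Z = {x. (\<forall>c<length l. x c \<in> Z \<and> act (e (l ! c)) (x c) = x c) \<and> (\<forall>c\<ge>length l. x c = 0)}"

definition Mat :: "(nat \<Rightarrow> 'a::ring_1) \<Rightarrow> nat list \<Rightarrow> nat list \<Rightarrow> (nat \<Rightarrow> nat \<Rightarrow> 'a) set" where
  "Mat e k l = tup lm e k (projmod e l)"

definition mv :: "('a \<Rightarrow> 'm \<Rightarrow> 'm) \<Rightarrow> nat \<Rightarrow> (nat \<Rightarrow> nat \<Rightarrow> 'a) \<Rightarrow> (nat \<Rightarrow> 'm) \<Rightarrow> (nat \<Rightarrow> 'm::comm_monoid_add)" where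
  "mv act q M u = (\<lambda>r. \<Sum>c<q. act (M r c) (u c))"

abbreviation mmul :: "nat \<Rightarrow> (nat \<Rightarrow> nat \<Rightarrow> 'a::ring_1) \<Rightarrow> (nat \<Rightarrow> nat \<Rightarrow> 'a) \<Rightarrow> nat \<Rightarrow> nat \<Rightarrow> 'a" where
  "mmul \<equiv> mv lm"

lemma mmul_entry: "mmul q M N r c = (\<Sum>j<q. M r j * N j c)"
  unfolding mv_def lm_def by (induction q) (auto simp: fun_eq_iff plus_fun_def)

lemma tupI:
  "(\<And>c. c < length l \<Longrightarrow> x c \<in> Z) \<Longrightarrow> (\<And>c. c < length l \<Longrightarrow> act (e (l ! c)) (x c) = x c)
    \<Longrightarrow> (\<And>c. length l \<le> c \<Longrightarrow> x c = 0) \<Longrightarrow> x \<in> tup act e l Z"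
  unfolding tup_def by auto

lemma tup_mem: "x \<in> tup act e l Z \<Longrightarrow> c < length l \<Longrightarrow> x c \<in> Z"
  unfolding tup_def by auto

lemma tup_idem: "x \<in> tup act e l Z \<Longrightarrow> c < length l \<Longrightarrow> act (e (l ! c)) (x c) = x c"
  unfolding tup_def by auto

lemma tup_out: "x \<in> tup act e l Z \<Longrightarrow> length l \<le> c \<Longrightarrow> x c = 0"
  unfolding tup_def by auto

lemma tup_mono: "Z \<subseteq> Z' \<Longrightarrow> tup act e l Z \<subseteq> tup act e l Z'"
  unfolding tup_def by auto

text \<open>Entry (r,c) ranges over e_i A e_j with i = k!r and j = l!c, which is Hom(A e_i, A e_j).
  Zeros outside the frame make equality of matrices equality of functions.\<close>

lemma Mat_iff:
  "M \<in> Mat e k l \<longleftrightarrow> (\<forall>r<length k. \<forall>c<length l. e (k ! r) * M r c = M r c \<and> M r c * e (l ! c) = M r c)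
    \<and> (\<forall>r c. \<not> (r < length k \<and> c < length l) \<longrightarrow> M r c = 0)"
proof
  assume M: "M \<in> Mat e k l"
  show "(\<forall>r<length k. \<forall>c<length l. e (k ! r) * M r c = M r c \<and> M r c * e (l ! c) = M r c)
    \<and> (\<forall>r c. \<not> (r < length k \<and> c < length l) \<longrightarrow> M r c = 0)"
  proof (intro conjI allI impI)
    fix r c assume rc: "r < length k" "c < length l"
    have "lm (e (k ! r)) (M r) = M r" using tup_idem[OF M[unfolded Mat_def] rc(1)] .
    from fun_cong[OF this, of c] show "e (k ! r) * M r c = M r c" unfolding lm_def .
    have "M r \<in> projmod e l" using tup_mem[OF M[unfolded Mat_def] rc(1)] .
    then show "M r c * e (l ! c) = M r c" using rc unfolding projmod_def by simp
  next
    fix r c assume rc: "\<not> (r < length k \<and> c < length l)"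
    show "M r c = 0"
    proof (cases "r < length k")
      case True
      then have "M r \<in> projmod e l" using tup_mem[OF M[unfolded Mat_def]] by blast
      then show ?thesis using rc True unfolding projmod_def by auto
    next
      case False
      then have "M r = 0" using tup_out[OF M[unfolded Mat_def]] by simp
      then show ?thesis by simp
    qed
  qed
next
  assume M: "(\<forall>r<length k. \<forall>c<length l. e (k ! r) * M r c = M r c \<and> M r c * e (l ! c) = M r c)
    \<and> (\<forall>r c. \<not> (r < length k \<and> c < length l) \<longrightarrow> M r c = 0)"
  show "M \<in> Mat e k l" unfolding Mat_def
  proof (rule tupI)
    fix r assume r: "r < length k"
    show "M r \<in> projmod e l" unfolding projmod_def using M r by auto
    show "lm (e (k ! r)) (M r) = M r" unfolding lm_def
    proof
      fix c show "e (k ! r) * M r c = M r c" using M r by (cases "c < length l") auto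
    qed
  next
    fix r assume "length k \<le> r" then show "M r = 0" using M by (auto simp: fun_eq_iff)
  qed
qed

lemma MatD:
  assumes "M \<in> Mat e k l"
  shows "r < length k \<Longrightarrow> e (k ! r) * M r c = M r c" "c < length l \<Longrightarrow> M r c * e (l ! c) = M r c"
    "length k \<le> r \<Longrightarrow> M r c = 0" "length l \<le> c \<Longrightarrow> M r c = 0"
proof -
  show "r < length k \<Longrightarrow> e (k ! r) * M r c = M r c"
    using assms unfolding Mat_iff by (cases "c < length l") auto
  show "c < length l \<Longrightarrow> M r c * e (l ! c) = M r c"
    using assms unfolding Mat_iff by (cases "r < length k") auto
  show "length k \<le> r \<Longrightarrow> M r c = 0" "length l \<le> c \<Longrightarrow> M r c = 0" using assms unfolding Mat_iff by auto
qed

lemma mmul_in_Mat: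
  assumes "M \<in> Mat e k l" "N \<in> Mat e l m"
  shows "mmul (length l) M N \<in> Mat e k m"
  unfolding Mat_iff mmul_entry
  using MatD[OF assms(1)] MatD[OF assms(2)]
  by (auto simp: sum_distrib_left sum_distrib_right mult.assoc intro!: sum.cong sum.neutral)
     (simp add: mult.assoc[symmetric])

text \<open>The infinite field is what makes two nonempty open subsets of a space of presentations
  meet.\<close>

locale idem_algebra =
  fixes sc :: "'k::field \<Rightarrow> 'a::ring_1 \<Rightarrow> 'a" and n :: nat and e :: "nat \<Rightarrow> 'a"
  assumes inf: "infinite (UNIV :: 'k set)"
    and alg: "fd_algebra sc"
    and idem: "i < n \<Longrightarrow> e i * e i = e i"
begin

lemma sc_vector_space: "vector_space sc" using alg unfolding fd_algebra_def by blast

lemma sc_mult: "sc c (x * y) = sc c x * y" "sc c (x * y) = x * sc c y"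
  using alg unfolding fd_algebra_def by blast+

lemma sc_one: "sc c x = sc c 1 * x" "sc c x = x * sc c 1"
  using sc_mult[of c 1 x] sc_mult[of c x 1] by simp_all

end

text \<open>The module laws are required on the carrier W only: \<open>dual_act\<close> sets
  functionals to 0 outside Hom(P,A), so even 1 acts as the identity only on functionals that vanish
  there.\<close>

locale fmod = idem_algebra sc n e + vector_space s
  for sc :: "'k::field \<Rightarrow> 'a::ring_1 \<Rightarrow> 'a" and n :: nat and e :: "nat \<Rightarrow> 'a"
    and s :: "'k \<Rightarrow> 'm::ab_group_add \<Rightarrow> 'm" +
  fixes act :: "'a \<Rightarrow> 'm \<Rightarrow> 'm" and W :: "'m set"
  assumes W: "fin_subspace s W"
    and act_in: "x \<in> W \<Longrightarrow> act a x \<in> W"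
    and act_add: "x \<in> W \<Longrightarrow> y \<in> W \<Longrightarrow> act a (x + y) = act a x + act a y"
    and act_plus: "x \<in> W \<Longrightarrow> act (a + b) x = act a x + act b x"
    and act_mult: "x \<in> W \<Longrightarrow> act (a * b) x = act a (act b x)"
    and act_one: "x \<in> W \<Longrightarrow> act 1 x = x"
    and act_sc: "x \<in> W \<Longrightarrow> act (sc c a) x = s c (act a x)"
begin

sublocale T: vector_space "vsc s" using vector_space_vsc vector_space_axioms .

sublocale TS: vector_space_pair "vsc s" s by unfold_locales

sublocale TT: vector_space_pair "vsc s" "vsc s" by unfold_locales

lemma subspace_W: "subspace W" using W fin_subspace_subspace by blast

lemma zero_W: "0 \<in> W" using subspace_W subspace_0 by blast

lemma act_zero_left: "x \<in> W \<Longrightarrow> act 0 x = 0"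
  using act_plus[of x 0 0] by simp

lemma act_zero: "act a 0 = 0"
  using act_add[OF zero_W zero_W, of a] by simp

lemma act_scale: "x \<in> W \<Longrightarrow> s c x = act (sc c 1) x"
  using act_sc[of x c 1] act_one by simp

lemma act_s: "x \<in> W \<Longrightarrow> act a (s c x) = s c (act a x)"
  by (metis act_scale act_mult act_in sc_one)

lemma act_sum: "(\<And>i. i \<in> I \<Longrightarrow> x i \<in> W) \<Longrightarrow> act a (\<Sum>i\<in>I. x i) = (\<Sum>i\<in>I. act a (x i))"
proof (induction I rule: infinite_finite_induct)
  case (insert i I)
  have "sum x I \<in> W" using insert.prems by (intro subspace_sum[OF subspace_W]) auto
  then show ?case using insert by (simp add: act_add)
qed (auto simp: act_zero)

lemma act_sum_left: "x \<in> W \<Longrightarrow> act (\<Sum>i\<in>I. a i) x = (\<Sum>i\<in>I. act (a i) x)"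
  by (induction I rule: infinite_finite_induct) (auto simp: act_zero_left act_plus)

lemma submod_subspace: "submod act W V \<Longrightarrow> subspace V"
  unfolding submod_def by (intro subspaceI) (auto simp: act_scale subset_iff)

lemma submod_W: "submod act W W"
  unfolding submod_def using act_in zero_W subspace_add[OF subspace_W] by auto

lemma submod_fin: "submod act W V \<Longrightarrow> fin_subspace s V"
  using submod_subspace fin_subspace_mono[OF W] unfolding submod_def by blast

lemma submod_sub: "submod act W V \<Longrightarrow> V \<subseteq> W"
  unfolding submod_def by blast

lemma submod_act: "submod act W V \<Longrightarrow> x \<in> V \<Longrightarrow> act a x \<in> V"
  unfolding submod_def by blast

lemma submod_add: "submod act W V \<Longrightarrow> x \<in> V \<Longrightarrow> y \<in> V \<Longrightarrow> x + y \<in> V"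
  unfolding submod_def by blast

lemma submod_0: "submod act W V \<Longrightarrow> 0 \<in> V"
  unfolding submod_def by blast

lemma tup_subspace:
  assumes V: "submod act W V"
  shows "T.subspace (tup act e l V)"
proof (rule T.subspaceI)
  show "0 \<in> tup act e l V" by (rule tupI) (auto simp: act_zero submod_0[OF V])
  show "x + y \<in> tup act e l V" if "x \<in> tup act e l V" "y \<in> tup act e l V" for x y
    using that submod_add[OF V] act_add submod_sub[OF V]
    by (intro tupI) (auto simp: tup_def subset_iff)
  show "vsc s c x \<in> tup act e l V" if "x \<in> tup act e l V" for c x
    using that subspace_scale[OF submod_subspace[OF V]] act_s submod_sub[OF V]
    by (intro tupI) (auto simp: tup_def vsc_def subset_iff)
qed

lemma act_image: "submod act W V \<Longrightarrow> i < n \<Longrightarrow> act (e i) ` V = {x\<in>V. act (e i) x = x}"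
proof -
  assume V: "submod act W V" and i: "i < n"
  have "act (e i) (act (e i) x) = act (e i) x" if "x \<in> V" for x
    using act_mult[of x "e i" "e i"] idem[OF i] that submod_sub[OF V] by auto
  then show ?thesis using submod_act[OF V] by (auto simp: image_iff) metis
qed

text \<open>This is dim Hom(A e_i, V) = dim e_i V, one summand at a time: the last coordinate maps
  onto e_i V, and its kernel is the tuple space of the shorter list.\<close>

lemma tup_fin_dim:
  assumes V: "submod act W V" and l: "set l \<subseteq> {..<n}"
  shows "fin_subspace (vsc s) (tup act e l V) \<and> T.dim (tup act e l V) = (\<Sum>i\<leftarrow>l. dim (act (e i) ` V))"
  using l
proof (induction l rule: rev_induct)
  case Nil
  have "tup act e [] V = {0}" unfolding tup_def by (auto simp: fun_eq_iff)
  moreover have "fin_subspace (vsc s) {0}"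
    unfolding fin_subspace_def by (auto intro!: exI[of _ "{}"])
  moreover have "T.dim {0} = 0"
    by (rule trans[OF T.dim_span[of "{}", unfolded T.span_empty] T.dim_eq_card_independent[OF T.independent_empty, unfolded card.empty]])
  ultimately show ?case by simp
next
  case (snoc i l)
  let ?S = "tup act e (l @ [i]) V"
  let ?q = "length l"
  obtain B where B: "finite B" "tup act e l V \<subseteq> T.span B"
    using snoc.IH snoc.prems unfolding fin_subspace_def by auto
  obtain C where C: "finite C" "V \<subseteq> span C"
    using submod_fin[OF V] unfolding fin_subspace_def by auto
  have ker: "{x\<in>?S. x ?q = 0} = tup act e l V"
  proof (intro equalityI subsetI)
    fix x assume "x \<in> {x\<in>?S. x ?q = 0}"
    then have x: "x \<in> ?S" "x ?q = 0" by auto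
    show "x \<in> tup act e l V"
    proof (rule tupI)
      fix c assume c: "c < length l"
      show "x c \<in> V" "act (e (l ! c)) (x c) = x c"
        using tup_mem[OF x(1), of c] tup_idem[OF x(1), of c] c by (auto simp: nth_append)
    next
      fix c assume c: "length l \<le> c"
      then show "x c = 0" using x(2) tup_out[OF x(1), of c] by (cases "c = length l") auto
    qed
  next
    fix x assume x: "x \<in> tup act e l V"
    have "x \<in> ?S"
    proof (rule tupI)
      fix c assume c: "c < length (l @ [i])"
      show "x c \<in> V" using tup_mem[OF x, of c] tup_out[OF x, of c] submod_0[OF V] by (cases "c < ?q") auto
      show "act (e ((l @ [i]) ! c)) (x c) = x c"
        using tup_idem[OF x, of c] tup_out[OF x, of c] c by (cases "c < ?q") (auto simp: nth_append act_zero)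
    next
      fix c assume "length (l @ [i]) \<le> c"
      then show "x c = 0" using tup_out[OF x] by simp
    qed
    then show "x \<in> {x\<in>?S. x ?q = 0}" using tup_out[OF x] by simp
  qed
  have im: "(\<lambda>x. x ?q) ` ?S = act (e i) ` V"
  proof -
    have "act (e i) ` V = {x\<in>V. act (e i) x = x}" using act_image[OF V] snoc.prems by simp
    moreover have "(\<lambda>r. if r = ?q then v else 0) \<in> ?S" if "v \<in> {x\<in>V. act (e i) x = x}" for v
      using that submod_0[OF V] by (intro tupI) (auto simp: nth_append act_zero)
    moreover have "x ?q \<in> {x\<in>V. act (e i) x = x}" if "x \<in> ?S" for x
      using tup_mem[OF that, of ?q] tup_idem[OF that, of ?q] by auto
    ultimately show ?thesis
      by (intro equalityI subsetI) (auto intro!: image_eqI[where x = "\<lambda>r. if r = ?q then _ else 0"])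
  qed
  have fin: "fin_subspace (vsc s) ?S"
  proof (rule T.fin_subspaceI[OF tup_subspace[OF V]])
    let ?D = "B \<union> (\<lambda>v r. if r = ?q then v else 0) ` C"
    show "finite ?D" using B(1) C(1) by simp
    show "?S \<subseteq> T.span ?D"
    proof
      fix x assume x: "x \<in> ?S"
      interpret L: Vector_Spaces.linear s "vsc s" "\<lambda>v r. if r = ?q then v else 0"
        by unfold_locales (auto simp: vsc_def fun_eq_iff)
      have "x ?q \<in> span C" using tup_mem[OF x, of ?q] C(2) by auto
      then have 1: "(\<lambda>r. if r = ?q then x ?q else 0) \<in> T.span ?D"
        using L.span_image[of C] T.span_mono[of "(\<lambda>v r. if r = ?q then v else 0) ` C" ?D] by blast
      have "x - (\<lambda>r. if r = ?q then x ?q else 0) \<in> {x\<in>?S. x ?q = 0}"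
      proof -
        have "(\<lambda>r. if r = ?q then x ?q else 0) \<in> ?S"
          using tup_mem[OF x, of ?q] tup_idem[OF x, of ?q] submod_0[OF V]
          by (intro tupI) (auto simp: act_zero nth_append)
        then show ?thesis using T.subspace_diff[OF tup_subspace[OF V] x] by auto
      qed
      then have "x - (\<lambda>r. if r = ?q then x ?q else 0) \<in> T.span ?D"
        using ker B(2) T.span_mono[of B ?D] by auto
      then show "x \<in> T.span ?D" using T.span_add[OF _ 1] by fastforce
    qed
  qed
  have "T.dim ?S = T.dim {x\<in>?S. x ?q = 0} + dim ((\<lambda>x. x ?q) ` ?S)"
    by (rule TS.rank_nullity[OF fin]) (auto simp: vsc_def)
  then show ?case using fin snoc ker im by simp
qed

lemmas tup_fin = tup_fin_dim[THEN conjunct1]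
  and tup_dim = tup_fin_dim[THEN conjunct2]

lemma mv_in:
  assumes M: "M \<in> Mat e k l" and u: "u \<in> tup act e l V" and V: "submod act W V"
  shows "mv act (length l) M u \<in> tup act e k V"
proof (rule tupI)
  have uW: "u c \<in> W" "u c \<in> V" if "c < length l" for c using tup_mem[OF u that] submod_sub[OF V] by auto
  fix r assume r: "r < length k"
  show "mv act (length l) M u r \<in> V" unfolding mv_def
    using uW submod_act[OF V] by (intro subspace_sum[OF submod_subspace[OF V]]) auto
  show "act (e (k ! r)) (mv act (length l) M u r) = mv act (length l) M u r" unfolding mv_def
    using uW act_in MatD(1)[OF M r] by (subst act_sum) (auto simp: act_mult[symmetric] intro!: sum.cong)
next
  fix r assume r: "length k \<le> r"
  have uW: "u c \<in> W" if "c < length l" for c using tup_mem[OF u that] submod_sub[OF V] by auto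
  show "mv act (length l) M u r = 0" unfolding mv_def
    using MatD(3)[OF M r] uW by (auto simp: act_zero_left intro!: sum.neutral)
qed

lemma mv_add:
  assumes "x \<in> tup act e l W" "y \<in> tup act e l W"
  shows "mv act (length l) M (x + y) = mv act (length l) M x + mv act (length l) M y"
  unfolding mv_def using tup_mem[OF assms(1)] tup_mem[OF assms(2)]
  by (auto simp: fun_eq_iff act_add sum.distrib[symmetric] intro!: sum.cong)

lemma mv_scale:
  assumes "x \<in> tup act e l W"
  shows "mv act (length l) M (vsc s c x) = vsc s c (mv act (length l) M x)"
  unfolding mv_def vsc_def using tup_mem[OF assms]
  by (auto simp: fun_eq_iff act_s scale_sum_right intro!: sum.cong)

lemma mv_mmul:
  assumes "x \<in> tup act e l W"
  shows "mv act (length l) (mmul q M N) x = mv act q M (mv act (length l) N x)"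
proof
  fix r
  have xW: "x c \<in> W" if "c < length l" for c using tup_mem[OF assms that] .
  have "mv act (length l) (mmul q M N) x r = (\<Sum>c<length l. \<Sum>j<q. act (M r j) (act (N j c) (x c)))"
    unfolding mmul_entry mv_def[of act] using xW by (auto simp: act_sum_left act_mult intro!: sum.cong)
  also have "\<dots> = (\<Sum>j<q. act (M r j) (\<Sum>c<length l. act (N j c) (x c)))"
    by (subst sum.swap, intro sum.cong refl act_sum[symmetric] act_in xW) auto
  finally show "mv act (length l) (mmul q M N) x r = mv act q M (mv act (length l) N x) r"
    unfolding mv_def .
qed

lemma mv_plus:
  assumes "x \<in> tup act e l W"
  shows "mv act (length l) (M + N) x = mv act (length l) M x + mv act (length l) N x"
  unfolding mv_def using tup_mem[OF assms]
  by (auto simp: fun_eq_iff act_plus sum.distrib[symmetric] intro!: sum.cong)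

end

subsection \<open>Semistability and presentations\<close>

text \<open>\<open>nat\<close> cuts negative coefficients to 0, so \<open>L0\<close> and
  \<open>L1\<close> list the positive and the negative part of \<eta> and share no index: P_0 and
  P_1 have no common summand.\<close>

definition L0 :: "nat \<Rightarrow> (nat \<Rightarrow> int) \<Rightarrow> nat list" where
  "L0 n \<eta> = concat (map (\<lambda>i. replicate (nat (\<eta> i)) i) [0..<n])"

definition L1 :: "nat \<Rightarrow> (nat \<Rightarrow> int) \<Rightarrow> nat list" where
  "L1 n \<eta> = concat (map (\<lambda>i. replicate (nat (- \<eta> i)) i) [0..<n])"

lemma P0_eq: "P0 n e \<eta> = projmod e (L0 n \<eta>)" unfolding P0_def L0_def ..

lemma P1_eq: "P1 n e \<eta> = projmod e (L1 n \<eta>)" unfolding P1_def L1_def ..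

lemma set_L: "set (L0 n \<eta>) \<subseteq> {..<n}" "set (L1 n \<eta>) \<subseteq> {..<n}"
  unfolding L0_def L1_def by auto

lemma sum_list_concat_replicate:
  "(\<Sum>i\<leftarrow>concat (map (\<lambda>i. replicate (m i) i) [0..<n]). d i) = (\<Sum>i<n. m i * (d i :: nat))"
  by (induction n) (auto simp: sum_list_replicate)

text \<open>\<open>F : k1 \<rightarrow> k0\<close> and \<open>G : l1 \<rightarrow> l0\<close>; this is \<open>Hom(P\<^sub>G, P\<^sub>F[1]) = 0\<close> in the homotopy category.\<close>

definition E_van :: "(nat \<Rightarrow> 'a::ring_1) \<Rightarrow> nat list \<Rightarrow> nat list \<Rightarrow> nat list \<Rightarrow> nat list
    \<Rightarrow> (nat \<Rightarrow> nat \<Rightarrow> 'a) \<Rightarrow> (nat \<Rightarrow> nat \<Rightarrow> 'a) \<Rightarrow> bool" where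
  "E_van e k0 k1 l0 l1 F G \<longleftrightarrow> (\<forall>h\<in>Mat e l1 k0. \<exists>S\<in>Mat e l1 k1. \<exists>S'\<in>Mat e l0 k0.
     h = mmul (length k1) S F + mmul (length l0) G S')"

context fmod
begin

text \<open>Surjectivity of Hom(G, W/U), stated on representatives in W. As P is projective, Hom(P,
  W/U) is Hom(P, W) modulo Hom(P, U), so no quotient has to be formed; \<open>inj_mod\<close> is the
  analogue for injectivity.\<close>

definition surj_mod :: "nat list \<Rightarrow> nat list \<Rightarrow> (nat \<Rightarrow> nat \<Rightarrow> 'a) \<Rightarrow> 'm set \<Rightarrow> bool" where
  "surj_mod k l G U \<longleftrightarrow>
    (\<forall>y\<in>tup act e k W. \<exists>x\<in>tup act e l W. y - mv act (length l) G x \<in> tup act e k U)"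

definition inj_mod :: "nat list \<Rightarrow> nat list \<Rightarrow> (nat \<Rightarrow> nat \<Rightarrow> 'a) \<Rightarrow> 'm set \<Rightarrow> bool" where
  "inj_mod k l G U \<longleftrightarrow>
    (\<forall>x\<in>tup act e l W. mv act (length l) G x \<in> tup act e k U \<longrightarrow> x \<in> tup act e l U)"

lemma tval_tup:
  assumes V: "submod act W V"
  shows "tval n e s act (\<lambda>i. real_of_int (\<eta> i)) V
    = real (T.dim (tup act e (L0 n \<eta>) V)) - real (T.dim (tup act e (L1 n \<eta>) V))"
proof -
  let ?d = "\<lambda>i. dim (act (e i) ` V)"
  have "T.dim (tup act e (L0 n \<eta>) V) = (\<Sum>i<n. nat (\<eta> i) * ?d i)"
       "T.dim (tup act e (L1 n \<eta>) V) = (\<Sum>i<n. nat (- \<eta> i) * ?d i)"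
    unfolding tup_dim[OF V set_L(1)] tup_dim[OF V set_L(2)]
    unfolding L0_def L1_def by (rule sum_list_concat_replicate)+
  moreover have "real_of_int z * x = real (nat z) * x - real (nat (- z)) * x" for z x
    by (cases "z \<ge> 0") auto
  ultimately show ?thesis unfolding tval_def by (simp add: sum_subtractf)
qed

lemma mv_zero: "mv act q G 0 = 0"
  unfolding mv_def by (auto simp: act_zero fun_eq_iff)

lemma subspace_mv_preimage:
  assumes V: "T.subspace V"
  shows "T.subspace {x\<in>tup act e l W. mv act (length l) G x \<in> V}"
proof (rule T.subspaceI)
  note sW = tup_subspace[OF submod_W, of l]
  show "0 \<in> {x\<in>tup act e l W. mv act (length l) G x \<in> V}"
    using T.subspace_0[OF sW] T.subspace_0[OF V] mv_zero by simp
  show "x + y \<in> {x\<in>tup act e l W. mv act (length l) G x \<in> V}"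
    if "x \<in> {x\<in>tup act e l W. mv act (length l) G x \<in> V}" "y \<in> {x\<in>tup act e l W. mv act (length l) G x \<in> V}" for x y
    using that T.subspace_add[OF sW] T.subspace_add[OF V] mv_add by simp
  show "vsc s c x \<in> {x\<in>tup act e l W. mv act (length l) G x \<in> V}"
    if "x \<in> {x\<in>tup act e l W. mv act (length l) G x \<in> V}" for c x
    using that T.subspace_scale[OF sW] T.subspace_scale[OF V] mv_scale by simp
qed

text \<open>Surjectivity passes from W/U to its factor W/V, and a surjection Hom(P0, W/V)
  \<rightarrow> Hom(P1, W/V) makes the difference of dimensions, which is \<eta>(W/V),
  nonnegative.\<close>

lemma surj_mod_inT:
  assumes G: "G \<in> Mat e (L1 n \<eta>) (L0 n \<eta>)"
    and sur: "surj_mod (L1 n \<eta>) (L0 n \<eta>) G U"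
  shows "inT n e s act (\<lambda>i. real_of_int (\<eta> i)) W U"
  unfolding inT_def
proof (intro allI impI)
  fix V assume "submod act W V \<and> U \<subseteq> V"
  then have V: "submod act W V" "U \<subseteq> V" by auto
  let ?l = "L0 n \<eta>" and ?k = "L1 n \<eta>"
  let ?S = "tup act e ?l W" and ?f = "mv act (length ?l) G"
  have fS: "fin_subspace (vsc s) ?S" using tup_fin[OF submod_W set_L(1)] .
  have "T.dim ?S + T.dim (tup act e ?k V) = T.dim {x\<in>?S. ?f x \<in> tup act e ?k V} + T.dim (tup act e ?k W)"
  proof (subst TT.relative_rank_nullity(2)[OF fS tup_fin[OF submod_W set_L(2)] tup_subspace[OF V(1)]
        tup_mono[OF submod_sub[OF V(1)]] mv_add mv_scale])
    show "?f ` ?S \<subseteq> tup act e ?k W" using mv_in[OF G _ submod_W] by blast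
    show "\<forall>y\<in>tup act e ?k W. \<exists>x\<in>?S. y - ?f x \<in> tup act e ?k V"
      using sur tup_mono[OF V(2), of act e ?k] unfolding surj_mod_def by blast
  qed
  moreover have "T.dim (tup act e ?l V) \<le> T.dim {x\<in>?S. ?f x \<in> tup act e ?k V}"
  proof (rule T.dim_mono_fin[OF _ tup_subspace[OF V(1)]])
    have "T.subspace {x\<in>?S. ?f x \<in> tup act e ?k V}"
      using subspace_mv_preimage[OF tup_subspace[OF V(1)]] .
    then show "fin_subspace (vsc s) {x\<in>?S. ?f x \<in> tup act e ?k V}"
      using T.fin_subspace_mono[OF fS] by blast
    show "tup act e ?l V \<subseteq> {x\<in>?S. ?f x \<in> tup act e ?k V}"
      using mv_in[OF G _ V(1)] tup_mono[OF submod_sub[OF V(1)], of act e ?l] by blast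
  qed
  ultimately show "0 \<le> tval n e s act (\<lambda>i. real_of_int (\<eta> i)) W - tval n e s act (\<lambda>i. real_of_int (\<eta> i)) V"
    unfolding tval_tup[OF V(1)] tval_tup[OF submod_W] by linarith
qed

text \<open>Injectivity restricts from W/U to its submodule V/U, and an injection Hom(P0, V/U)
  \<rightarrow> Hom(P1, V/U) forces \<eta>(V/U) \<le> 0.\<close>

lemma inj_mod_inF:
  assumes U: "submod act W U" and G: "G \<in> Mat e (L1 n \<eta>) (L0 n \<eta>)"
    and inj: "inj_mod (L1 n \<eta>) (L0 n \<eta>) G U"
  shows "inF n e s act (\<lambda>i. real_of_int (\<eta> i)) W U"
  unfolding inF_def
proof (intro allI impI)
  fix V assume "submod act W V \<and> U \<subseteq> V"
  then have V: "submod act W V" "U \<subseteq> V" by auto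
  let ?l = "L0 n \<eta>" and ?k = "L1 n \<eta>"
  let ?S = "tup act e ?l V" and ?f = "mv act (length ?l) G"
  have SW: "?S \<subseteq> tup act e ?l W" by (rule tup_mono[OF submod_sub[OF V(1)]])
  have "T.dim ?S + T.dim (tup act e ?k U) \<le> T.dim {x\<in>?S. ?f x \<in> tup act e ?k U} + T.dim (tup act e ?k V)"
  proof (rule TT.relative_rank_nullity(1)[OF tup_fin[OF V(1) set_L(1)] tup_fin[OF V(1) set_L(2)] tup_subspace[OF U]
        tup_mono[OF V(2)]])
    show "?f ` ?S \<subseteq> tup act e ?k V" using mv_in[OF G _ V(1)] by blast
  qed (use SW mv_add mv_scale in blast)+
  moreover have "{x\<in>?S. ?f x \<in> tup act e ?k U} = tup act e ?l U"
    using inj SW mv_in[OF G _ U] tup_mono[OF V(2), of act e ?l] unfolding inj_mod_def by blast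
  ultimately show "tval n e s act (\<lambda>i. real_of_int (\<eta> i)) V - tval n e s act (\<lambda>i. real_of_int (\<eta> i)) U \<le> 0"
    unfolding tval_tup[OF V(1)] tval_tup[OF U] by force
qed

text \<open>The largest submodule \<open>X\<close> with \<open>Hom(P1, X) \<subseteq> V'\<close> satisfies \<open>U' \<subseteq> Hom(P0, X)\<close>.\<close>

lemma ex_saturated_submod:
  assumes U: "submod act W U" and l0: "set l0 \<subseteq> {..<n}" and l1: "set l1 \<subseteq> {..<n}"
    and U': "U' \<subseteq> tup act e l0 W"
    and V': "T.subspace V'" "tup act e l1 U \<subseteq> V'"
    and M: "\<And>M u. M \<in> Mat e l1 l0 \<Longrightarrow> u \<in> U' \<Longrightarrow> mv act (length l0) M u \<in> V'"
  shows "\<exists>X. submod act W X \<and> U \<subseteq> X \<and> U' \<subseteq> tup act e l0 X \<and> tup act e l1 X \<subseteq> V'"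
proof -
  define sg where "sg r v = (\<lambda>j. if j = r then v else (0::'m))" for r :: nat and v
  have sg_add: "sg r (v + w) = sg r v + sg r w" for r v w unfolding sg_def by (auto simp: fun_eq_iff)
  have idl: "e (l ! r) * e (l ! r) = e (l ! r)" if "set l \<subseteq> {..<n}" "r < length l" for l r
    using idem that nth_mem by blast
  \<comment> \<open>The elements e_i a x with i = l1!r make up Hom(A e_i, A x), so X collects the x
    with Hom(P1, A x) \<subseteq> V'.\<close>
  define X where "X = {x\<in>W. \<forall>r<length l1. \<forall>a. sg r (act (e (l1 ! r) * a) x) \<in> V'}"
  have "submod act W X" unfolding submod_def
  proof (intro conjI ballI allI)
    show "X \<subseteq> W" unfolding X_def by blast
    have "sg r 0 = 0" for r unfolding sg_def by (auto simp: fun_eq_iff)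
    then show "0 \<in> X" unfolding X_def using zero_W T.subspace_0[OF V'(1)] by (simp add: act_zero)
    show "x + y \<in> X" if "x \<in> X" "y \<in> X" for x y
      using that subspace_add[OF subspace_W] T.subspace_add[OF V'(1)] unfolding X_def by (simp add: act_add sg_add)
    show "act b x \<in> X" if "x \<in> X" for b x
      using that act_in unfolding X_def by (simp add: act_mult[symmetric] mult.assoc)
  qed
  moreover have "U \<subseteq> X"
  proof
    fix x assume x: "x \<in> U"
    have xW: "x \<in> W" using x submod_sub[OF U] by blast
    have "sg r (act (e (l1 ! r) * a) x) \<in> tup act e l1 U" if r: "r < length l1" for r a
      unfolding sg_def using submod_act[OF U x] submod_0[OF U] idl[OF l1 r] xW r
      by (intro tupI) (auto simp: act_zero act_mult[symmetric] mult.assoc[symmetric])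
    then show "x \<in> X" unfolding X_def using xW V'(2) by blast
  qed
  moreover have "U' \<subseteq> tup act e l0 X"
  proof
    fix u assume u: "u \<in> U'"
    then have uW: "u \<in> tup act e l0 W" using U' by blast
    show "u \<in> tup act e l0 X"
    proof (rule tupI)
      fix c assume c: "c < length l0"
      show "act (e (l0 ! c)) (u c) = u c" using tup_idem[OF uW c] .
      have ucW: "u c \<in> W" using tup_mem[OF uW c] .
      have "sg r (act (e (l1 ! r) * a) (u c)) \<in> V'" if r: "r < length l1" for r a
      proof -
        \<comment> \<open>The matrix with one nonzero entry, at (r,c). Both idempotents are needed
          to lie in Hom(P1, P0), and the right one is absorbed when N is applied to u, because it
          fixes \<open>u c\<close>.\<close>
        define N where "N = (\<lambda>r' c'. if r' = r \<and> c' = c then e (l1 ! r) * a * e (l0 ! c) else 0)"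
        have N: "N \<in> Mat e l1 l0" unfolding Mat_iff N_def using idl[OF l1 r] idl[OF l0 c] r c
          by (auto simp: mult.assoc) (simp add: mult.assoc[symmetric])
        have z: "act (N r' c') (u c') = (if c' = c then sg r (act (e (l1 ! r) * a) (u c)) r' else 0)"
          if "c' < length l0" for r' c'
          using tup_mem[OF uW that] ucW tup_idem[OF uW c]
          by (auto simp: N_def sg_def act_zero_left act_mult)
        have "mv act (length l0) N u = sg r (act (e (l1 ! r) * a) (u c))"
          unfolding mv_def using c z by (auto simp: fun_eq_iff)
        then show ?thesis using M[OF N u] by simp
      qed
      then show "u c \<in> X" unfolding X_def using ucW by blast
    next
      fix c assume "length l0 \<le> c" then show "u c = 0" using tup_out[OF uW] by blast
    qed
  qed
  moreover have "tup act e l1 X \<subseteq> V'"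
  proof
    fix x assume x: "x \<in> tup act e l1 X"
    have "(\<Sum>r<length l1. sg r (x r)) j = x j" for j
    proof -
      have "(\<Sum>r<m. sg r (x r)) j = (if j < m then x j else 0)" for m
        by (induction m) (auto simp: sg_def less_Suc_eq)
      then show ?thesis using tup_out[OF x, of j] by (simp add: not_less)
    qed
    then have eq: "x = (\<Sum>r<length l1. sg r (x r))" by auto
    have "sg r (x r) \<in> V'" if r: "r < length l1" for r
    proof -
      have "sg r (act (e (l1 ! r) * 1) (x r)) \<in> V'" using tup_mem[OF x r] r unfolding X_def by blast
      then show ?thesis using tup_idem[OF x r] by simp
    qed
    then show "x \<in> V'" by (subst eq) (intro T.subspace_sum[OF V'(1)], auto)
  qed
  ultimately show ?thesis by blast
qed

text \<open>A sequence of subspaces in the style of Wong: \<open>U\<^sub>i\<^sub>+\<^sub>1 = f\<^sub>i\<^sub>+\<^sub>1\<inverse>(V\<^sub>i)\<close> and \<open>V\<^sub>i\<^sub>+\<^sub>1\<close> is spanned by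
  all \<open>M u\<close> with \<open>M \<in> Hom(P1, P0)\<close>, \<open>u \<in> U\<^sub>i\<^sub>+\<^sub>1\<close>. Vanishing of \<open>E\<close> keeps \<open>V\<^sub>i\<close> inside the image of
  the later \<open>f\<^sub>j\<close>, and the dimensions grow as long as no \<open>f\<^sub>j\<close> has maximal rank.\<close>

lemma wong_sequence:
  assumes U: "submod act W U" and l0: "set l0 \<subseteq> {..<n}" and l1: "set l1 \<subseteq> {..<n}"
    and ineq: "\<And>U' V'. T.subspace U' \<Longrightarrow> tup act e l0 U \<subseteq> U' \<Longrightarrow> U' \<subseteq> tup act e l0 W \<Longrightarrow>
      T.subspace V' \<Longrightarrow> tup act e l1 U \<subseteq> V' \<Longrightarrow> V' \<subseteq> tup act e l1 W \<Longrightarrow>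
      (\<And>M u. M \<in> Mat e l1 l0 \<Longrightarrow> u \<in> U' \<Longrightarrow> mv act (length l0) M u \<in> V') \<Longrightarrow>
      T.dim U' + a \<le> T.dim V' + b"
    and fs: "set fs \<subseteq> Mat e l1 l0" "sorted_wrt (E_van e l0 l1 l0 l1) fs"
    and deficient: "\<And>f. f \<in> set fs \<Longrightarrow> b + T.dim (tup act e l1 U)
      < T.dim {x \<in> tup act e l0 W. mv act (length l0) f x \<in> tup act e l1 U} + a"
  shows "\<exists>V'. T.subspace V' \<and> tup act e l1 U \<subseteq> V' \<and> V' \<subseteq> tup act e l1 W
    \<and> (\<forall>S\<in>Mat e l1 l1. \<forall>v\<in>V'. mv act (length l1) S v \<in> V')
    \<and> T.dim (tup act e l1 U) + length fs \<le> T.dim V'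
    \<and> (\<forall>g\<in>Mat e l1 l0. (\<forall>f\<in>set fs. E_van e l0 l1 l0 l1 f g) \<longrightarrow>
        (\<forall>v\<in>V'. \<exists>x\<in>tup act e l0 W. v - mv act (length l0) g x \<in> tup act e l1 U))"
  using fs deficient
\<comment> \<open>The numbers \<open>a\<close> and \<open>b\<close> let one argument serve both
  classes. They are dim Hom(P1, W) and dim Hom(P0, W) for torsion, and dim Hom(P1, U) and dim
  Hom(P0, U) for torsion-freeness; \<open>deficient\<close> then says that f is not onto,
  respectively not injective, modulo U.\<close>
proof (induction fs rule: rev_induct)
  case Nil
  have "0 \<in> tup act e l0 W" using T.subspace_0[OF tup_subspace[OF submod_W]] .
  then have "\<exists>x\<in>tup act e l0 W. v - mv act (length l0) g x \<in> tup act e l1 U"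
    if "v \<in> tup act e l1 U" for v g using that by (intro bexI[of _ 0]) (simp_all add: mv_zero)
  then show ?case using tup_subspace[OF U, of l1] tup_mono[OF submod_sub[OF U], of act e l1] mv_in[OF _ _ U]
    by (intro exI[of _ "tup act e l1 U"] conjI ballI impI) (blast | simp)+
next
  case (snoc f fs)
  let ?U0 = "tup act e l0 U" and ?V0 = "tup act e l1 U"
  let ?UW = "tup act e l0 W" and ?VW = "tup act e l1 W"
  let ?mv = "mv act (length l0)" and ?R = "E_van e l0 l1 l0 l1"
  have f: "f \<in> Mat e l1 l0" and Rf: "\<forall>f'\<in>set fs. ?R f' f"
    using snoc.prems(1,2) by (auto simp: sorted_wrt_append)
  have pre: "set fs \<subseteq> Mat e l1 l0" "sorted_wrt ?R fs"
      "\<And>f. f \<in> set fs \<Longrightarrow> b + T.dim ?V0 < T.dim {x \<in> ?UW. ?mv f x \<in> ?V0} + a"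
    using snoc.prems by (simp_all add: sorted_wrt_append)
  obtain V where V: "T.subspace V" "?V0 \<subseteq> V" "V \<subseteq> ?VW"
      "\<And>S v. S \<in> Mat e l1 l1 \<Longrightarrow> v \<in> V \<Longrightarrow> mv act (length l1) S v \<in> V"
      "T.dim ?V0 + length fs \<le> T.dim V"
      "\<And>g v. g \<in> Mat e l1 l0 \<Longrightarrow> \<forall>f\<in>set fs. ?R f g \<Longrightarrow> v \<in> V \<Longrightarrow> \<exists>x\<in>?UW. v - ?mv g x \<in> ?V0"
    using snoc.IH[OF pre] by blast
  define U' where "U' = {x\<in>?UW. ?mv f x \<in> V}"
  define gen where "gen = ?V0 \<union> {?mv M u | M u. M \<in> Mat e l1 l0 \<and> u \<in> U'}"
  define V' where "V' = T.span gen"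
  have sUW: "T.subspace ?UW" and sVW: "T.subspace ?VW" using tup_subspace[OF submod_W] by blast+
  have sV0: "T.subspace ?V0" using tup_subspace[OF U] .
  have fUW: "fin_subspace (vsc s) ?UW" and fVW: "fin_subspace (vsc s) ?VW"
    using tup_fin[OF submod_W] l0 l1 by blast+
  have sU': "T.subspace U'" unfolding U'_def by (rule subspace_mv_preimage[OF V(1)])
  have U'W: "U' \<subseteq> ?UW" unfolding U'_def by blast
  have UU': "?U0 \<subseteq> U'"
    unfolding U'_def using tup_mono[OF submod_sub[OF U], of act e l0] mv_in[OF f _ U] V(2) by blast
  have genW: "gen \<subseteq> ?VW" unfolding gen_def
    using tup_mono[OF submod_sub[OF U], of act e l1] mv_in[OF _ _ submod_W] U'W by blast
  have sV': "T.subspace V'" unfolding V'_def by (rule T.subspace_span)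
  have V'W: "V' \<subseteq> ?VW" unfolding V'_def by (rule T.span_minimal[OF genW sVW])
  have genV': "gen \<subseteq> V'" unfolding V'_def by (rule T.span_superset)
  have V0V': "?V0 \<subseteq> V'" using genV' unfolding gen_def by blast
  have MV': "?mv M u \<in> V'" if "M \<in> Mat e l1 l0" "u \<in> U'" for M u
    using genV' that unfolding gen_def by blast
  \<comment> \<open>Composites S M stay in Hom(P1, P0), so V' is stable under End(P1). The next
    round needs this for terms S (f u).\<close>
  have stable: "mv act (length l1) S v \<in> V'" if S: "S \<in> Mat e l1 l1" and v: "v \<in> V'" for S v
  proof -
    have "T.subspace {v\<in>?VW. mv act (length l1) S v \<in> V'}" by (rule subspace_mv_preimage[OF sV'])
    moreover have "gen \<subseteq> {v\<in>?VW. mv act (length l1) S v \<in> V'}"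
    proof
      fix w assume w: "w \<in> gen"
      then consider "w \<in> ?V0" | M u where "w = ?mv M u" "M \<in> Mat e l1 l0" "u \<in> U'"
        unfolding gen_def by blast
      then have "mv act (length l1) S w \<in> V'"
      proof cases
        case 1
        then show ?thesis using mv_in[OF S _ U] V0V' by blast
      next
        case 2
        have "mv act (length l1) S w = ?mv (mmul (length l1) S M) u"
          unfolding 2(1) using mv_mmul[of u l0] 2(3) U'W by auto
        then show ?thesis using MV'[OF mmul_in_Mat[OF S 2(2)] 2(3)] by simp
      qed
      then show "w \<in> {v\<in>?VW. mv act (length l1) S v \<in> V'}" using w genW by blast
    qed
    ultimately have "V' \<subseteq> {v\<in>?VW. mv act (length l1) S v \<in> V'}"
      unfolding V'_def by (rule T.span_minimal[rotated])
    then show ?thesis using v by blast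
  qed
  \<comment> \<open>By induction V lies in the image of f modulo \<open>?V0\<close>, so f maps U'
    onto V modulo \<open>?V0\<close> and the count is an equality. Together with
    \<open>deficient\<close> and \<open>ineq\<close> it yields dim V' > dim V.\<close>
  have "T.dim U' + T.dim ?V0 = T.dim {x\<in>U'. ?mv f x \<in> ?V0} + T.dim V"
  proof (subst TT.relative_rank_nullity(2)[OF T.fin_subspace_mono[OF fUW sU' U'W] T.fin_subspace_mono[OF fVW V(1,3)] sV0 V(2)])
    show "?mv f (x + y) = ?mv f x + ?mv f y" if "x \<in> U'" "y \<in> U'" for x y
      using that U'W mv_add by blast
    show "?mv f (vsc s c x) = vsc s c (?mv f x)" if "x \<in> U'" for c x
      using that U'W mv_scale by blast
    show "?mv f ` U' \<subseteq> V" unfolding U'_def by blast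
    show "\<forall>y\<in>V. \<exists>x\<in>U'. y - ?mv f x \<in> ?V0"
    proof
      fix y assume y: "y \<in> V"
      obtain x where x: "x \<in> ?UW" "y - ?mv f x \<in> ?V0" using V(6)[OF f Rf y] by blast
      have "?mv f x = y - (y - ?mv f x)" by simp
      also have "\<dots> \<in> V" using T.subspace_diff[OF V(1) y] x(2) V(2) by blast
      finally show "\<exists>x\<in>U'. y - ?mv f x \<in> ?V0" using x unfolding U'_def by blast
    qed
  qed
  moreover have "{x\<in>U'. ?mv f x \<in> ?V0} = {x\<in>?UW. ?mv f x \<in> ?V0}" unfolding U'_def using V(2) by blast
  moreover have "b + T.dim ?V0 < T.dim {x\<in>?UW. ?mv f x \<in> ?V0} + a" using snoc.prems(3)[of f] by simp
  moreover have "T.dim U' + a \<le> T.dim V' + b" by (rule ineq[OF sU' UU' U'W sV' V0V' V'W MV'])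
  ultimately have dim: "T.dim ?V0 + length (fs @ [f]) \<le> T.dim V'" using V(5) by simp
  have "\<exists>x\<in>?UW. v - ?mv g x \<in> ?V0"
    if g: "g \<in> Mat e l1 l0" and Rg: "\<forall>f'\<in>set (fs @ [f]). ?R f' g" and v: "v \<in> V'" for g v
  proof -
    let ?I = "{v. \<exists>x\<in>?UW. v - ?mv g x \<in> ?V0}"
    have sI: "T.subspace ?I"
    proof (rule T.subspaceI)
      show "0 \<in> ?I" using T.subspace_0[OF sUW] T.subspace_0[OF sV0] by (auto intro!: bexI[of _ 0] simp: mv_zero)
    next
      fix v w assume "v \<in> ?I" "w \<in> ?I"
      then obtain x y where xy: "x \<in> ?UW" "v - ?mv g x \<in> ?V0" "y \<in> ?UW" "w - ?mv g y \<in> ?V0" by blast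
      have "v + w - ?mv g (x + y) = (v - ?mv g x) + (w - ?mv g y)"
        using mv_add[OF xy(1,3)] by simp
      also have "\<dots> \<in> ?V0" using T.subspace_add[OF sV0] xy by blast
      finally show "v + w \<in> ?I" using T.subspace_add[OF sUW xy(1,3)] by blast
    next
      fix c v assume "v \<in> ?I"
      then obtain x where x: "x \<in> ?UW" "v - ?mv g x \<in> ?V0" by blast
      have "vsc s c v - ?mv g (vsc s c x) = vsc s c (v - ?mv g x)"
        using mv_scale[OF x(1)] by (simp add: T.scale_right_diff_distrib)
      also have "\<dots> \<in> ?V0" using T.subspace_scale[OF sV0] x by blast
      finally show "vsc s c v \<in> ?I" using T.subspace_scale[OF sUW x(1)] by blast
    qed
    have imI: "?mv g x \<in> ?I" if "x \<in> ?UW" for x using that T.subspace_0[OF sV0] by (auto intro!: bexI[of _ x])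
    have V0I: "?V0 \<subseteq> ?I" using T.subspace_0[OF sUW] by (auto intro!: bexI[of _ 0] simp: mv_zero)
    have VI: "V \<subseteq> ?I" using V(6)[OF g] Rg by auto
    have "gen \<subseteq> ?I"
    proof
      fix w assume "w \<in> gen"
      then consider "w \<in> ?V0" | M u where "w = ?mv M u" "M \<in> Mat e l1 l0" "u \<in> U'"
        unfolding gen_def by blast
      then show "w \<in> ?I"
      proof cases
        case 1 then show ?thesis using V0I by blast
      next
        case 2
        have uW: "u \<in> ?UW" using 2(3) U'W by blast
        have "?R f g" using Rg by simp
        \<comment> \<open>M u = S (f u) + g (S' u). Here f u lies in V, which is stable under S and
          lies in the image of g modulo \<open>?V0\<close> by induction; the other term is an image
          under g.\<close>
        then obtain S S' where S: "S \<in> Mat e l1 l1" "S' \<in> Mat e l0 l0"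
          and MS: "M = mmul (length l1) S f + mmul (length l0) g S'"
          using 2(2) unfolding E_van_def by blast
        have "w = mv act (length l1) S (?mv f u) + ?mv g (?mv S' u)"
          unfolding 2(1) MS mv_plus[OF uW] mv_mmul[OF uW] ..
        moreover have "mv act (length l1) S (?mv f u) \<in> ?I" using V(4)[OF S(1)] VI 2(3) unfolding U'_def by blast
        moreover have "?mv g (?mv S' u) \<in> ?I" using imI mv_in[OF S(2) uW submod_W] by blast
        ultimately show ?thesis using T.subspace_add[OF sI] by blast
      qed
    qed
    then have "V' \<subseteq> ?I" unfolding V'_def by (rule T.span_minimal[OF _ sI])
    then show ?thesis using v by blast
  qed
  then show ?case using sV' V0V' V'W stable dim by blast
qed

text \<open>If no member is onto modulo U, each one adds at least a dimension to a subspace of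
  Hom(P1, W), and a chain longer than dim Hom(P1, W) leaves no room for that.\<close>

lemma inT_ex_surj:
  assumes U: "submod act W U" and T: "inT n e s act (\<lambda>i. real_of_int (\<eta> i)) W U"
    and fs: "set fs \<subseteq> Mat e (L1 n \<eta>) (L0 n \<eta>)"
      "sorted_wrt (E_van e (L0 n \<eta>) (L1 n \<eta>) (L0 n \<eta>) (L1 n \<eta>)) fs"
    and len: "length fs > T.dim (tup act e (L1 n \<eta>) W)"
  shows "\<exists>f\<in>set fs. surj_mod (L1 n \<eta>) (L0 n \<eta>) f U"
proof (rule ccontr)
  let ?l0 = "L0 n \<eta>" and ?l1 = "L1 n \<eta>"
  assume no: "\<not> ?thesis"
  have "\<exists>V'. T.subspace V' \<and> tup act e ?l1 U \<subseteq> V' \<and> V' \<subseteq> tup act e ?l1 W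
    \<and> (\<forall>S\<in>Mat e ?l1 ?l1. \<forall>v\<in>V'. mv act (length ?l1) S v \<in> V')
    \<and> T.dim (tup act e ?l1 U) + length fs \<le> T.dim V'
    \<and> (\<forall>g\<in>Mat e ?l1 ?l0. (\<forall>f\<in>set fs. E_van e ?l0 ?l1 ?l0 ?l1 f g) \<longrightarrow>
        (\<forall>v\<in>V'. \<exists>x\<in>tup act e ?l0 W. v - mv act (length ?l0) g x \<in> tup act e ?l1 U))"
  proof (rule wong_sequence[OF U set_L _ fs])
    fix U' V'
    assume U': "T.subspace U'" "tup act e ?l0 U \<subseteq> U'" "U' \<subseteq> tup act e ?l0 W"
      and V': "T.subspace V'" "tup act e ?l1 U \<subseteq> V'" "V' \<subseteq> tup act e ?l1 W"
      and M: "\<And>M u. M \<in> Mat e ?l1 ?l0 \<Longrightarrow> u \<in> U' \<Longrightarrow> mv act (length ?l0) M u \<in> V'"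
    \<comment> \<open>Semistability speaks of submodules, the sequence of arbitrary subspaces.
      Passing to X only enlarges U' and shrinks V', so the inequality for X gives the one for U' and
      V'.\<close>
    obtain X where X: "submod act W X" "U \<subseteq> X" "U' \<subseteq> tup act e ?l0 X" "tup act e ?l1 X \<subseteq> V'"
      using ex_saturated_submod[OF U set_L U'(3) V'(1,2) M] by blast
    have "0 \<le> tval n e s act (\<lambda>i. real_of_int (\<eta> i)) W - tval n e s act (\<lambda>i. real_of_int (\<eta> i)) X"
      using T X(1,2) unfolding inT_def by blast
    then have "T.dim (tup act e ?l1 W) + T.dim (tup act e ?l0 X) \<le> T.dim (tup act e ?l0 W) + T.dim (tup act e ?l1 X)"
      unfolding tval_tup[OF X(1)] tval_tup[OF submod_W] by linarith
    moreover have "T.dim U' \<le> T.dim (tup act e ?l0 X)"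
      using T.dim_mono_fin[OF tup_fin[OF X(1) set_L(1)] U'(1) X(3)] .
    moreover have "T.dim (tup act e ?l1 X) \<le> T.dim V'"
      using T.dim_mono_fin[OF T.fin_subspace_mono[OF tup_fin[OF submod_W set_L(2)] V'(1,3)] tup_subspace[OF X(1)] X(4)] .
    ultimately show "T.dim U' + T.dim (tup act e ?l1 W) \<le> T.dim V' + T.dim (tup act e ?l0 W)" by linarith
  next
    fix f assume f: "f \<in> set fs"
    have fM: "f \<in> Mat e ?l1 ?l0" using f fs(1) by blast
    have im: "mv act (length ?l0) f ` tup act e ?l0 W \<subseteq> tup act e ?l1 W" using mv_in[OF fM _ submod_W] by blast
    have "T.dim (tup act e ?l0 W) + T.dim (tup act e ?l1 U)
        \<le> T.dim {x \<in> tup act e ?l0 W. mv act (length ?l0) f x \<in> tup act e ?l1 U} + T.dim (tup act e ?l1 W)"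
      by (rule TT.relative_rank_nullity(1)[OF tup_fin[OF submod_W set_L(1)] tup_fin[OF submod_W set_L(2)] tup_subspace[OF U]
        tup_mono[OF submod_sub[OF U]] mv_add mv_scale im])
    moreover have "T.dim (tup act e ?l0 W) + T.dim (tup act e ?l1 U)
        \<noteq> T.dim {x \<in> tup act e ?l0 W. mv act (length ?l0) f x \<in> tup act e ?l1 U} + T.dim (tup act e ?l1 W)"
      by (subst TT.relative_rank_nullity(2)[OF tup_fin[OF submod_W set_L(1)] tup_fin[OF submod_W set_L(2)] tup_subspace[OF U]
        tup_mono[OF submod_sub[OF U]] mv_add mv_scale im]) (use no f in \<open>auto simp: surj_mod_def\<close>)
    ultimately show "T.dim (tup act e ?l0 W) + T.dim (tup act e ?l1 U)
        < T.dim {x \<in> tup act e ?l0 W. mv act (length ?l0) f x \<in> tup act e ?l1 U} + T.dim (tup act e ?l1 W)"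
      by linarith
  qed
  then obtain V' where V': "T.subspace V'" "V' \<subseteq> tup act e ?l1 W" "T.dim (tup act e ?l1 U) + length fs \<le> T.dim V'"
    by blast
  then show False using T.dim_mono_fin[OF tup_fin[OF submod_W set_L(2)] V'(1,2)] len by linarith
qed

text \<open>The same growth argument, now driven by the inequality for the submodules X/U instead of
  the factors W/X.\<close>

lemma inF_ex_inj:
  assumes U: "submod act W U" and F: "inF n e s act (\<lambda>i. real_of_int (\<eta> i)) W U"
    and fs: "set fs \<subseteq> Mat e (L1 n \<eta>) (L0 n \<eta>)"
      "sorted_wrt (E_van e (L0 n \<eta>) (L1 n \<eta>) (L0 n \<eta>) (L1 n \<eta>)) fs"
    and len: "length fs > T.dim (tup act e (L1 n \<eta>) W)"
  shows "\<exists>f\<in>set fs. inj_mod (L1 n \<eta>) (L0 n \<eta>) f U"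
proof (rule ccontr)
  let ?l0 = "L0 n \<eta>" and ?l1 = "L1 n \<eta>"
  assume no: "\<not> ?thesis"
  have "\<exists>V'. T.subspace V' \<and> tup act e ?l1 U \<subseteq> V' \<and> V' \<subseteq> tup act e ?l1 W
    \<and> (\<forall>S\<in>Mat e ?l1 ?l1. \<forall>v\<in>V'. mv act (length ?l1) S v \<in> V')
    \<and> T.dim (tup act e ?l1 U) + length fs \<le> T.dim V'
    \<and> (\<forall>g\<in>Mat e ?l1 ?l0. (\<forall>f\<in>set fs. E_van e ?l0 ?l1 ?l0 ?l1 f g) \<longrightarrow>
        (\<forall>v\<in>V'. \<exists>x\<in>tup act e ?l0 W. v - mv act (length ?l0) g x \<in> tup act e ?l1 U))"
  proof (rule wong_sequence[OF U set_L _ fs])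
    fix U' V'
    assume U': "T.subspace U'" "tup act e ?l0 U \<subseteq> U'" "U' \<subseteq> tup act e ?l0 W"
      and V': "T.subspace V'" "tup act e ?l1 U \<subseteq> V'" "V' \<subseteq> tup act e ?l1 W"
      and M: "\<And>M u. M \<in> Mat e ?l1 ?l0 \<Longrightarrow> u \<in> U' \<Longrightarrow> mv act (length ?l0) M u \<in> V'"
    obtain X where X: "submod act W X" "U \<subseteq> X" "U' \<subseteq> tup act e ?l0 X" "tup act e ?l1 X \<subseteq> V'"
      using ex_saturated_submod[OF U set_L U'(3) V'(1,2) M] by blast
    have "tval n e s act (\<lambda>i. real_of_int (\<eta> i)) X - tval n e s act (\<lambda>i. real_of_int (\<eta> i)) U \<le> 0"
      using F X(1,2) unfolding inF_def by blast
    then have "T.dim (tup act e ?l0 X) + T.dim (tup act e ?l1 U) \<le> T.dim (tup act e ?l1 X) + T.dim (tup act e ?l0 U)"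
      unfolding tval_tup[OF X(1)] tval_tup[OF U] by linarith
    moreover have "T.dim U' \<le> T.dim (tup act e ?l0 X)"
      using T.dim_mono_fin[OF tup_fin[OF X(1) set_L(1)] U'(1) X(3)] .
    moreover have "T.dim (tup act e ?l1 X) \<le> T.dim V'"
      using T.dim_mono_fin[OF T.fin_subspace_mono[OF tup_fin[OF submod_W set_L(2)] V'(1,3)] tup_subspace[OF X(1)] X(4)] .
    ultimately show "T.dim U' + T.dim (tup act e ?l1 U) \<le> T.dim V' + T.dim (tup act e ?l0 U)" by linarith
  next
    fix f assume f: "f \<in> set fs"
    let ?K = "{x \<in> tup act e ?l0 W. mv act (length ?l0) f x \<in> tup act e ?l1 U}"
    have fM: "f \<in> Mat e ?l1 ?l0" using f fs(1) by blast
    have sub: "tup act e ?l0 U \<subseteq> ?K"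
      using mv_in[OF fM _ U] tup_mono[OF submod_sub[OF U], of act e ?l0] by blast
    have ne: "tup act e ?l0 U \<noteq> ?K" using no f unfolding inj_mod_def by blast
    have sK: "T.subspace ?K" by (rule subspace_mv_preimage[OF tup_subspace[OF U]])
    have "fin_subspace (vsc s) ?K"
      using T.fin_subspace_mono[OF tup_fin[OF submod_W set_L(1)] sK] by blast
    then have "T.dim (tup act e ?l0 U) < T.dim ?K" using T.dim_less_fin[OF _ tup_subspace[OF U] sub ne] by blast
    then show "T.dim (tup act e ?l0 U) + T.dim (tup act e ?l1 U) < T.dim ?K + T.dim (tup act e ?l1 U)" by linarith
  qed
  then obtain V' where V': "T.subspace V'" "V' \<subseteq> tup act e ?l1 W" "T.dim (tup act e ?l1 U) + length fs \<le> T.dim V'"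
    by blast
  then show False using T.dim_mono_fin[OF tup_fin[OF submod_W set_L(2)] V'(1,2)] len by linarith
qed

end

subsection \<open>Homomorphisms between projectives as matrices\<close>

lemma sum_apply: "(\<Sum>i\<in>I. f i) x = (\<Sum>i\<in>I. f i x)"
  by (induction I rule: infinite_finite_induct) auto

definition unit_vec :: "(nat \<Rightarrow> 'a::zero) \<Rightarrow> nat list \<Rightarrow> nat \<Rightarrow> nat \<Rightarrow> 'a" where
  "unit_vec e k r = (\<lambda>j. if j = r then e (k ! r) else 0)"

text \<open>A homomorphism from a projective is determined by its values at the generators
  \<open>unit_vec\<close>. \<open>matof\<close> and \<open>homof\<close> are the two directions of
  the resulting bijection with tuples; the target is arbitrary, so they serve Hom(P1, P0) as well as
  Hom(P, A).\<close>

definition matof :: "(nat \<Rightarrow> 'a::zero) \<Rightarrow> nat list \<Rightarrow> ((nat \<Rightarrow> 'a) \<Rightarrow> 'm) \<Rightarrow> nat \<Rightarrow> 'm::zero" where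
  "matof e k f = (\<lambda>r. if r < length k then f (unit_vec e k r) else 0)"

definition homof :: "('a \<Rightarrow> 'm \<Rightarrow> 'm) \<Rightarrow> (nat \<Rightarrow> 'a::ring_1) \<Rightarrow> nat list \<Rightarrow> (nat \<Rightarrow> 'm) \<Rightarrow> (nat \<Rightarrow> 'a) \<Rightarrow> 'm::comm_monoid_add" where
  "homof act e k M = (\<lambda>x. if x \<in> projmod e k then \<Sum>r<length k. act (x r) (M r) else 0)"

lemma projmod_iff:
  "x \<in> projmod e k \<longleftrightarrow> (\<forall>r\<ge>length k. x r = 0) \<and> (\<forall>r<length k. x r * e (k ! r) = x r)"
  unfolding projmod_def by auto

lemma zero_projmod: "0 \<in> projmod e k"
  unfolding projmod_iff by simp

lemma add_projmod: "x \<in> projmod e k \<Longrightarrow> y \<in> projmod e k \<Longrightarrow> x + y \<in> projmod e k"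
  unfolding projmod_iff by (simp add: distrib_right)

lemma lm_projmod: "x \<in> projmod e k \<Longrightarrow> lm a x \<in> projmod e k"
  unfolding projmod_iff lm_def by (simp add: mult.assoc)

lemma hom_mod_in: "f \<in> hom_mod a X b Y \<Longrightarrow> x \<in> X \<Longrightarrow> f x \<in> Y"
  and hom_mod_out: "f \<in> hom_mod a X b Y \<Longrightarrow> x \<notin> X \<Longrightarrow> f x = 0"
  and hom_mod_add: "f \<in> hom_mod a X b Y \<Longrightarrow> x \<in> X \<Longrightarrow> y \<in> X \<Longrightarrow> f (x + y) = f x + f y"
  and hom_mod_act: "f \<in> hom_mod a X b Y \<Longrightarrow> x \<in> X \<Longrightarrow> f (a c x) = b c (f x)"
  unfolding hom_mod_def by auto

lemma hom_mod_zero: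
  fixes f :: "'x::monoid_add \<Rightarrow> 'y::ab_group_add"
  assumes "f \<in> hom_mod a X b Y" "0 \<in> X"
  shows "f 0 = 0"
  using hom_mod_add[OF assms(1) assms(2) assms(2)] by simp

text \<open>Since x_r e_i = x_r for i = k!r, the vector x is the combination of the generators whose
  coefficients are its own entries.\<close>

lemma hom_row:
  fixes f :: "(nat \<Rightarrow> 'a::ring_1) \<Rightarrow> 'm::ab_group_add"
  assumes f: "f \<in> hom_mod lm (projmod e k) act Y" and id: "\<And>r. r < length k \<Longrightarrow> e (k ! r) * e (k ! r) = e (k ! r)"
    and x: "x \<in> projmod e k"
  shows "f x = (\<Sum>r<length k. act (x r) (matof e k f r))"
proof -
  have u: "unit_vec e k r \<in> projmod e k" if "r < length k" for r
    unfolding projmod_iff unit_vec_def using that id by auto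
  have "m \<le> length k \<Longrightarrow> (\<Sum>r<m. lm (x r) (unit_vec e k r)) \<in> projmod e k
      \<and> f (\<Sum>r<m. lm (x r) (unit_vec e k r)) = (\<Sum>r<m. act (x r) (matof e k f r))" for m
  proof (induction m)
    case 0
    show ?case using hom_mod_zero[OF f zero_projmod] zero_projmod[of e k] by (simp add: zero_fun_def)
  next
    case (Suc m)
    have m: "m < length k" using Suc.prems by simp
    have v: "lm (x m) (unit_vec e k m) \<in> projmod e k" using lm_projmod[OF u[OF m]] .
    have IH: "(\<Sum>r<m. lm (x r) (unit_vec e k r)) \<in> projmod e k"
      "f (\<Sum>r<m. lm (x r) (unit_vec e k r)) = (\<Sum>r<m. act (x r) (matof e k f r))"
      using Suc.IH m by auto
    have "f (lm (x m) (unit_vec e k m)) = act (x m) (matof e k f m)"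
      using hom_mod_act[OF f u[OF m]] m by (simp add: matof_def)
    then show ?case
      unfolding sum.lessThan_Suc using add_projmod[OF IH(1) v] hom_mod_add[OF f IH(1) v] IH(2) by argo
  qed
  from this[of "length k"] have *: "f (\<Sum>r<length k. lm (x r) (unit_vec e k r)) = (\<Sum>r<length k. act (x r) (matof e k f r))"
    by simp
  have "(\<Sum>r<length k. lm (x r) (unit_vec e k r)) = x"
  proof
    fix j
    have "(\<Sum>r<length k. lm (x r) (unit_vec e k r)) j = (\<Sum>r<length k. if r = j then x j * e (k ! j) else 0)"
      unfolding sum_apply lm_def unit_vec_def by (intro sum.cong) auto
    then show "(\<Sum>r<length k. lm (x r) (unit_vec e k r)) j = x j" using x unfolding projmod_iff by (simp add: not_less)
  qed
  then show ?thesis using * by simp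
qed

context fmod
begin

lemma idem_nth: "set k \<subseteq> {..<n} \<Longrightarrow> r < length k \<Longrightarrow> e (k ! r) * e (k ! r) = e (k ! r)"
  using idem nth_mem by blast

lemma unit_vec_projmod: "set k \<subseteq> {..<n} \<Longrightarrow> r < length k \<Longrightarrow> unit_vec e k r \<in> projmod e k"
  unfolding projmod_iff unit_vec_def using idem_nth by auto

lemma lm_unit_vec: "set k \<subseteq> {..<n} \<Longrightarrow> r < length k \<Longrightarrow> lm (e (k ! r)) (unit_vec e k r) = unit_vec e k r"
  unfolding lm_def unit_vec_def using idem_nth by auto

lemma matof_tup:
  assumes f: "f \<in> hom_mod lm (projmod e k) act W" and k: "set k \<subseteq> {..<n}"
  shows "matof e k f \<in> tup act e k W"
proof (rule tupI)
  fix r assume r: "r < length k"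
  show "matof e k f r \<in> W" unfolding matof_def using hom_mod_in[OF f unit_vec_projmod[OF k r]] r by simp
  show "act (e (k ! r)) (matof e k f r) = matof e k f r"
    using hom_mod_act[OF f unit_vec_projmod[OF k r], of "e (k ! r)"] lm_unit_vec[OF k r] r
    unfolding matof_def by simp
qed (simp add: matof_def)

lemma homof_hom:
  assumes M: "M \<in> tup act e k W"
  shows "homof act e k M \<in> hom_mod lm (projmod e k) act W"
proof -
  have MW: "M r \<in> W" if "r < length k" for r using tup_mem[OF M that] .
  have "homof act e k M x \<in> W" if "x \<in> projmod e k" for x
    unfolding homof_def using MW act_in that by (auto intro!: subspace_sum[OF subspace_W])
  moreover have "homof act e k M (x + y) = homof act e k M x + homof act e k M y"
    if "x \<in> projmod e k" "y \<in> projmod e k" for x y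
    using that add_projmod[OF that] MW by (simp add: homof_def act_plus sum.distrib[symmetric])
  moreover have "homof act e k M (lm a x) = act a (homof act e k M x)" if "x \<in> projmod e k" for a x
  proof -
    have "act a (\<Sum>r<length k. act (x r) (M r)) = (\<Sum>r<length k. act a (act (x r) (M r)))"
      by (rule act_sum) (use MW act_in in auto)
    also have "\<dots> = (\<Sum>r<length k. act (lm a x r) (M r))"
      using MW by (auto simp: lm_def act_mult intro!: sum.cong)
    finally show ?thesis using that lm_projmod[OF that, of a] by (simp add: homof_def)
  qed
  ultimately show ?thesis unfolding hom_mod_def by (auto simp: homof_def)
qed

lemma matof_homof:
  assumes M: "M \<in> tup act e k W" and k: "set k \<subseteq> {..<n}"
  shows "matof e k (homof act e k M) = M"
proof
  fix r
  show "matof e k (homof act e k M) r = M r"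
  proof (cases "r < length k")
    case True
    have "act (unit_vec e k r j) (M j) = (if j = r then M r else 0)" if "j < length k" for j
      using tup_mem[OF M that] tup_idem[OF M True] by (auto simp: unit_vec_def act_zero_left)
    then show ?thesis using True unit_vec_projmod[OF k True] by (simp add: matof_def homof_def)
  next
    case False
    then show ?thesis using tup_out[OF M, of r] by (simp add: matof_def)
  qed
qed

lemma homof_matof:
  assumes f: "f \<in> hom_mod lm (projmod e k) act W" and k: "set k \<subseteq> {..<n}"
  shows "homof act e k (matof e k f) = f"
  using hom_row[OF f idem_nth[OF k]] hom_mod_out[OF f] by (auto simp: homof_def fun_eq_iff)

lemma matof_comp:
  assumes f: "f \<in> hom_mod lm (projmod e k) lm (projmod e l)" and g: "g \<in> hom_mod lm (projmod e l) act W"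
    and k: "set k \<subseteq> {..<n}" and l: "set l \<subseteq> {..<n}"
  shows "matof e k (g \<circ> f) = mv act (length l) (matof e k f) (matof e l g)"
proof
  fix r
  show "matof e k (g \<circ> f) r = mv act (length l) (matof e k f) (matof e l g) r"
  proof (cases "r < length k")
    case True
    then show ?thesis
      using hom_row[OF g idem_nth[OF l] hom_mod_in[OF f unit_vec_projmod[OF k True]]]
      by (simp add: matof_def mv_def)
  next
    case False
    then show ?thesis using tup_mem[OF matof_tup[OF g l]]
      by (auto simp: matof_def mv_def act_zero_left intro!: sum.neutral)
  qed
qed

lemma fmod_submod:
  assumes V: "submod act W V"
  shows "fmod sc n e s act V"
  using submod_fin[OF V] submod_act[OF V] submod_sub[OF V] act_add act_plus act_mult act_one act_sc
  by unfold_locales (auto simp: subset_iff)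

end

section \<open>Free modules, projectives and cokernels of presentations\<close>

context idem_algebra
begin

lemma fmod_regular: "fmod sc n e sc (*) UNIV"
proof -
  interpret vector_space sc by (rule sc_vector_space)
  have "fin_subspace sc UNIV"
    using alg unfolding fd_algebra_def fin_subspace_def by auto
  then show ?thesis
    by unfold_locales (auto simp: distrib_left distrib_right mult.assoc sc_mult(1)[symmetric])
qed

text \<open>A^q is the tuple space over A for the one-member family of idempotents consisting of 1,
  repeated q times.\<close>

lemma fin_subspace_Aq: "fin_subspace (vsc sc) (Aq q)"
proof -
  interpret I: idem_algebra sc "1" "\<lambda>_. 1" by unfold_locales (use inf alg in auto)
  interpret R: fmod sc "1" "\<lambda>_. 1" sc "(*)" UNIV by (rule I.fmod_regular)
  have "Aq q = tup (*) (\<lambda>_. 1) (replicate q 0) (UNIV :: 'a set)"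
    unfolding Aq_def tup_def by auto
  moreover have "set (replicate q 0) \<subseteq> {..<Suc 0}" by auto
  ultimately show ?thesis using R.tup_fin[OF R.submod_W, of "replicate q 0"] by simp
qed

lemma fmod_Aq: "fmod sc n e (vsc sc) lm (Aq q)"
proof -
  interpret vector_space "vsc sc" by (rule vector_space_vsc[OF sc_vector_space])
  show ?thesis
    by unfold_locales
      (rule fin_subspace_Aq, auto simp: Aq_def lm_def vsc_def fun_eq_iff distrib_left distrib_right mult.assoc sc_mult(1))
qed

lemma submod_projmod: "submod lm (Aq (length k)) (projmod e k)"
  unfolding submod_def
proof (intro conjI ballI allI)
  show "projmod e k \<subseteq> Aq (length k)" unfolding Aq_def projmod_def by blast
qed (blast intro: zero_projmod add_projmod lm_projmod)+

lemma fmod_projmod: "fmod sc n e (vsc sc) lm (projmod e k)"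
  using fmod.fmod_submod[OF fmod_Aq submod_projmod] .

lemma submod_hom_image:
  assumes f: "f \<in> hom_mod lm (projmod e k) lm (projmod e l)"
  shows "submod lm (projmod e l) (f ` projmod e k)"
  unfolding submod_def
proof (intro conjI ballI allI)
  show "f ` projmod e k \<subseteq> projmod e l" using hom_mod_in[OF f] by blast
  show "0 \<in> f ` projmod e k" using hom_mod_zero[OF f zero_projmod] zero_projmod by (metis imageI)
  show "x + y \<in> f ` projmod e k" if "x \<in> f ` projmod e k" "y \<in> f ` projmod e k" for x y
  proof -
    from that obtain v w where "v \<in> projmod e k" "w \<in> projmod e k" "x = f v" "y = f w" by blast
    then show ?thesis using hom_mod_add[OF f, of v w] add_projmod[of v e k w] by (metis imageI)
  qed
  show "lm a x \<in> f ` projmod e k" if "x \<in> f ` projmod e k" for a x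
  proof -
    from that obtain v where "v \<in> projmod e k" "x = f v" by blast
    then show ?thesis using hom_mod_act[OF f, of v a] lm_projmod[of v e k a] by (metis imageI)
  qed
qed

lemma matof_Mat:
  assumes "f \<in> hom_mod lm (projmod e k) lm (projmod e l)" "set k \<subseteq> {..<n}"
  shows "matof e k f \<in> Mat e k l"
  unfolding Mat_def using fmod.matof_tup[OF fmod_projmod assms] .

text \<open>Projectivity of the source: a homomorphism into the image of f lifts through f.
  Multiplying chosen preimages of the rows by the idempotents of l turns them into the rows of a
  matrix S.\<close>

lemma tup_hom_image:
  assumes f: "f \<in> hom_mod lm (projmod e k1) lm (projmod e k0)" and k1: "set k1 \<subseteq> {..<n}"
    and l: "set l \<subseteq> {..<n}"
  shows "tup lm e l (f ` projmod e k1) = (\<lambda>S. mmul (length k1) S (matof e k1 f)) ` Mat e l k1"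
proof (intro equalityI subsetI)
  interpret C: fmod sc n e "vsc sc" lm "projmod e k0" by (rule fmod_projmod)
  interpret C1: fmod sc n e "vsc sc" lm "projmod e k1" by (rule fmod_projmod)
  have F: "matof e k1 f \<in> Mat e k1 k0" by (rule matof_Mat[OF f k1])
  have row: "f x = mmul (length k1) (\<lambda>_. x) (matof e k1 f) r" if "x \<in> projmod e k1" for x r
    using hom_row[OF f C.idem_nth[OF k1] that] by (simp add: mv_def)
  fix x assume x: "x \<in> tup lm e l (f ` projmod e k1)"
  have "\<exists>y. \<forall>r<length l. y r \<in> projmod e k1 \<and> x r = f (y r)"
    using tup_mem[OF x] by (intro choice_iff[THEN iffD1]) (metis imageE)
  then obtain y where y: "\<And>r. r < length l \<Longrightarrow> y r \<in> projmod e k1" "\<And>r. r < length l \<Longrightarrow> x r = f (y r)" by blast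
  define S where "S r = (if r < length l then lm (e (l ! r)) (y r) else 0)" for r
  have S: "S \<in> Mat e l k1" unfolding Mat_def
  proof (rule tupI)
    fix r assume r: "r < length l"
    show "S r \<in> projmod e k1" unfolding S_def using y(1)[OF r] lm_projmod r by auto
    show "lm (e (l ! r)) (S r) = S r" using r C.idem_nth[OF l r]
      by (auto simp: S_def lm_def mult.assoc[symmetric])
  qed (simp add: S_def)
  have "x = mmul (length k1) S (matof e k1 f)"
  proof
    fix r
    show "x r = mmul (length k1) S (matof e k1 f) r"
    proof (cases "r < length l")
      case True
      have "x r = lm (e (l ! r)) (x r)" using tup_idem[OF x True] by simp
      also have "\<dots> = f (S r)" using hom_mod_act[OF f y(1)[OF True]] y(2)[OF True] True by (simp add: S_def)
      also have "\<dots> = mmul (length k1) S (matof e k1 f) r"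
        using row[of "S r" r] tup_mem[OF S[unfolded Mat_def] True] by (simp add: mv_def)
      finally show ?thesis .
    next
      case False
      then have "mmul (length k1) S (matof e k1 f) \<in> Mat e l k0" using mmul_in_Mat[OF S F] by blast
      then show ?thesis using tup_out[OF x, of r] False tup_out[of "mmul (length k1) S (matof e k1 f)" lm e l _ r]
        unfolding Mat_def by simp
    qed
  qed
  then show "x \<in> (\<lambda>S. mmul (length k1) S (matof e k1 f)) ` Mat e l k1" using S by blast
next
  interpret C: fmod sc n e "vsc sc" lm "projmod e k0" by (rule fmod_projmod)
  fix x assume "x \<in> (\<lambda>S. mmul (length k1) S (matof e k1 f)) ` Mat e l k1"
  then obtain S where S: "S \<in> Mat e l k1" and x: "x = mmul (length k1) S (matof e k1 f)" by blast
  have xM: "x \<in> tup lm e l (projmod e k0)"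
    using mmul_in_Mat[OF S matof_Mat[OF f k1]] unfolding x Mat_def .
  show "x \<in> tup lm e l (f ` projmod e k1)"
  proof (rule tupI)
    fix r assume r: "r < length l"
    have Sr: "S r \<in> projmod e k1" using tup_mem[OF S[unfolded Mat_def] r] .
    then have "x r = f (S r)" using hom_row[OF f C.idem_nth[OF k1]] by (simp add: x mv_def)
    then show "x r \<in> f ` projmod e k1" using Sr by blast
  qed (use tup_idem[OF xM] tup_out[OF xM] in blast)+
qed

text \<open>Tuples over the image of f are the products S F, so surjectivity of Hom(G, Cok f),
  written on representatives, is the null-homotopy of every h.\<close>

lemma surj_mod_coker_iff:
  assumes f: "f \<in> hom_mod lm (projmod e k1) lm (projmod e k0)" and k1: "set k1 \<subseteq> {..<n}"
    and l1: "set l1 \<subseteq> {..<n}"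
  shows "fmod.surj_mod e lm (projmod e k0) l1 l0 G (f ` projmod e k1)
    \<longleftrightarrow> E_van e k0 k1 l0 l1 (matof e k1 f) G"
proof -
  interpret C: fmod sc n e "vsc sc" lm "projmod e k0" by (rule fmod_projmod)
  have "C.surj_mod l1 l0 G (f ` projmod e k1) \<longleftrightarrow> (\<forall>y\<in>Mat e l1 k0. \<exists>x\<in>Mat e l0 k0.
      \<exists>S\<in>Mat e l1 k1. y - mmul (length l0) G x = mmul (length k1) S (matof e k1 f))"
    unfolding C.surj_mod_def tup_hom_image[OF f k1 l1] Mat_def[symmetric] by (simp add: image_iff)
  also have "\<dots> \<longleftrightarrow> E_van e k0 k1 l0 l1 (matof e k1 f) G"
    unfolding E_van_def diff_eq_eq by blast
  finally show ?thesis .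
qed

subsection \<open>Kernels of the Nakayama functor\<close>

abbreviation row_mod :: "nat list \<Rightarrow> (nat \<Rightarrow> 'a) \<Rightarrow> (nat \<Rightarrow> 'a) \<Rightarrow> 'a" where
  "row_mod k v \<equiv> homof (*) e k v"

lemma homA_iff: "m \<in> homA (projmod e k) \<longleftrightarrow> m \<in> hom_mod lm (projmod e k) (*) UNIV"
  unfolding homA_def by simp

lemma homA_matof: "m \<in> homA (projmod e k) \<Longrightarrow> set k \<subseteq> {..<n} \<Longrightarrow> matof e k m \<in> tup (*) e k UNIV"
  unfolding homA_iff by (rule fmod.matof_tup[OF fmod_regular])

lemma row_mod_homA: "v \<in> tup (*) e k UNIV \<Longrightarrow> row_mod k v \<in> homA (projmod e k)"
  unfolding homA_iff by (rule fmod.homof_hom[OF fmod_regular])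

lemma matof_row_mod: "v \<in> tup (*) e k UNIV \<Longrightarrow> set k \<subseteq> {..<n} \<Longrightarrow> matof e k (row_mod k v) = v"
  by (rule fmod.matof_homof[OF fmod_regular])

lemma row_mod_matof: "m \<in> homA (projmod e k) \<Longrightarrow> set k \<subseteq> {..<n} \<Longrightarrow> row_mod k (matof e k m) = m"
  unfolding homA_iff by (rule fmod.homof_matof[OF fmod_regular])

lemma row_mod_add: "row_mod k (v + w) = row_mod k v + row_mod k w"
  unfolding homof_def by (auto simp: fun_eq_iff distrib_left sum.distrib)

lemma sc_zero: "sc c 0 = 0"
  using sc_one(2)[of c 0] by simp

lemma sc_add: "sc c (x + y) = sc c x + sc c y"
  using sc_vector_space unfolding vector_space_def by blast

lemma sc_sum: "sc c (sum g I) = (\<Sum>i\<in>I. sc c (g i))"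
  by (induction I rule: infinite_finite_induct) (auto simp: sc_zero sc_add)

lemma row_mod_scale: "row_mod k (vsc sc c v) = (\<lambda>x. sc c (row_mod k v x))"
  unfolding homof_def vsc_def by (auto simp: fun_eq_iff sc_zero sc_sum sc_mult(2))

lemma homA_add: "m \<in> homA P \<Longrightarrow> m' \<in> homA P \<Longrightarrow> m + m' \<in> homA P"
  unfolding homA_def hom_mod_def by (auto simp: distrib_left)

lemma homA_mult: "m \<in> homA P \<Longrightarrow> (\<lambda>x. m x * a) \<in> homA P"
  unfolding homA_def hom_mod_def by (auto simp: distrib_right mult.assoc)

lemma homA_sc: "m \<in> homA P \<Longrightarrow> (\<lambda>x. sc c (m x)) \<in> homA P"
  using homA_mult[of m P "sc c 1"] by (subst sc_one(2))

lemma homA_comp: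
  assumes "m \<in> homA (projmod e k0)" "f \<in> hom_mod lm (projmod e k1) lm (projmod e k0)"
  shows "m \<circ> f \<in> homA (projmod e k1)"
  using assms hom_mod_zero[OF assms(1)[unfolded homA_def] zero_projmod]
  unfolding homA_def hom_mod_def by auto

lemma dualA_add: "\<psi> \<in> dualA sc M \<Longrightarrow> m \<in> M \<Longrightarrow> m' \<in> M \<Longrightarrow> \<psi> (m + m') = \<psi> m + \<psi> m'"
  and dualA_sc: "\<psi> \<in> dualA sc M \<Longrightarrow> m \<in> M \<Longrightarrow> \<psi> (\<lambda>x. sc c (m x)) = c * \<psi> m"
  and dualA_out: "\<psi> \<in> dualA sc M \<Longrightarrow> m \<notin> M \<Longrightarrow> \<psi> m = 0"
  unfolding dualA_def by auto

lemma zero_homA: "0 \<in> homA P"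
  unfolding homA_def hom_mod_def by auto

lemma dualA_zero: "\<psi> \<in> dualA sc (homA P) \<Longrightarrow> \<psi> 0 = 0"
proof -
  assume "\<psi> \<in> dualA sc (homA P)"
  then have "\<psi> (0 + 0) = \<psi> 0 + \<psi> 0" by (rule dualA_add[OF _ zero_homA zero_homA])
  then show ?thesis by (simp only: add_0_left add_cancel_right_left)
qed

lemma homA_sum: "(\<And>i. i \<in> I \<Longrightarrow> m i \<in> homA P) \<Longrightarrow> sum m I \<in> homA P"
  by (induction I rule: infinite_finite_induct) (simp_all add: zero_homA homA_add del: plus_fun_apply)

lemma dualA_sum:
  "\<psi> \<in> dualA sc (homA P) \<Longrightarrow> (\<And>i. i \<in> I \<Longrightarrow> m i \<in> homA P) \<Longrightarrow> \<psi> (sum m I) = (\<Sum>i\<in>I. \<psi> (m i))"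
proof (induction I rule: infinite_finite_induct)
  case (insert i I)
  have "\<psi> (m i + sum m I) = \<psi> (m i) + \<psi> (sum m I)"
    by (rule dualA_add[OF insert.prems(1)]) (use insert.prems in \<open>auto intro: homA_sum\<close>)
  moreover have "\<psi> (sum m I) = (\<Sum>i\<in>I. \<psi> (m i))" using insert.IH insert.prems by blast
  ultimately show ?case unfolding sum.insert[OF insert.hyps] by argo
qed (auto simp: dualA_zero)

lemma vector_space_dual: "vector_space (dual_scale :: 'k \<Rightarrow> ('b \<Rightarrow> 'k) \<Rightarrow> _)"
  by unfold_locales (auto simp: dual_scale_def fun_eq_iff algebra_simps)

text \<open>The coordinate functionals of a basis of the isomorphic tuple space span the dual of
  Hom(P, A). They are cut to 0 outside Hom(P, A), as \<open>dualA\<close> demands.\<close>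

lemma fin_subspace_dualA:
  assumes k: "set k \<subseteq> {..<n}"
  shows "fin_subspace dual_scale (dualA sc (homA (projmod e k)))"
proof -
  interpret D: vector_space "dual_scale :: 'k \<Rightarrow> (((nat \<Rightarrow> 'a) \<Rightarrow> 'a) \<Rightarrow> 'k) \<Rightarrow> _" by (rule vector_space_dual)
  interpret R: fmod sc n e sc "(*)" UNIV by (rule fmod_regular)
  interpret K: vector_space "(*) :: 'k \<Rightarrow> _" by unfold_locales (auto simp: algebra_simps)
  interpret P: vector_space_pair "vsc sc" "(*) :: 'k \<Rightarrow> _" by unfold_locales
  let ?M = "homA (projmod e k)"
  let ?T = "tup (*) e k (UNIV :: 'a set)"
  obtain B where B: "finite B" "R.T.independent B" "B \<subseteq> ?T" "R.T.span B = ?T"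
    by (rule R.T.fin_subspace_basis[OF R.tup_fin[OF R.submod_W k]])
  define \<delta> where "\<delta> b = (\<lambda>m. if m \<in> ?M then R.T.representation B (matof e k m) b else 0)" for b
  show ?thesis
  proof (rule D.fin_subspaceI)
    show "D.subspace (dualA sc ?M)"
      unfolding D.subspace_def dualA_def dual_scale_def by (simp add: distrib_left mult.left_commute)
    show "finite (\<delta> ` B)" using B(1) by simp
    show "dualA sc ?M \<subseteq> D.span (\<delta> ` B)"
    proof
      fix \<psi> assume \<psi>: "\<psi> \<in> dualA sc ?M"
      have "\<exists>g. Vector_Spaces.linear (vsc sc) (*) g \<and> (\<forall>v\<in>?T. g v = \<psi> (row_mod k v))"
      proof (rule P.linear_extension)
        show "R.T.subspace ?T" by (rule R.tup_subspace[OF R.submod_W])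
        show "\<psi> (row_mod k (x + y)) = \<psi> (row_mod k x) + \<psi> (row_mod k y)" if "x \<in> ?T" "y \<in> ?T" for x y
          unfolding row_mod_add using dualA_add[OF \<psi>] that row_mod_homA by blast
        show "\<psi> (row_mod k (vsc sc c x)) = c * \<psi> (row_mod k x)" if "x \<in> ?T" for c x
          unfolding row_mod_scale using dualA_sc[OF \<psi>] that row_mod_homA by blast
      qed
      then obtain g where g: "Vector_Spaces.linear (vsc sc) (*) g" "\<And>v. v \<in> ?T \<Longrightarrow> g v = \<psi> (row_mod k v)"
        by auto
      interpret g: Vector_Spaces.linear "vsc sc" "(*)" g by (rule g(1))
      have "\<psi> = (\<Sum>b\<in>B. dual_scale (\<psi> (row_mod k b)) (\<delta> b))"
      proof
        fix m
        show "\<psi> m = (\<Sum>b\<in>B. dual_scale (\<psi> (row_mod k b)) (\<delta> b)) m"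
        proof (cases "m \<in> ?M")
          case True
          let ?v = "matof e k m"
          have v: "?v \<in> ?T" using homA_matof[OF True k] .
          have "\<psi> m = g ?v" using g(2)[OF v] row_mod_matof[OF True k] by simp
          also have "?v = (\<Sum>b\<in>B. vsc sc (R.T.representation B ?v b) b)"
            using R.T.sum_representation_eq[OF B(2) _ B(1) order_refl, of ?v] v B(4) by simp
          also have "g \<dots> = (\<Sum>b\<in>B. R.T.representation B ?v b * g b)"
            unfolding g.sum g.scale ..
          also have "\<dots> = (\<Sum>b\<in>B. \<psi> (row_mod k b) * R.T.representation B ?v b)"
            using g(2) B(3) by (intro sum.cong) auto
          finally show ?thesis using True by (simp add: sum_apply dual_scale_def \<delta>_def)
        next
          case False
          then show ?thesis using dualA_out[OF \<psi>] by (simp add: sum_apply dual_scale_def \<delta>_def)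
        qed
      qed
      moreover have "(\<Sum>b\<in>B. dual_scale (\<psi> (row_mod k b)) (\<delta> b)) \<in> D.span (\<delta> ` B)"
        by (intro D.span_sum D.span_scale D.span_base) auto
      ultimately show "\<psi> \<in> D.span (\<delta> ` B)" by simp
    qed
  qed
qed

lemma fmod_dualA:
  assumes k: "set k \<subseteq> {..<n}"
  shows "fmod sc n e dual_scale (dual_act (homA (projmod e k))) (dualA sc (homA (projmod e k)))"
proof -
  interpret D: vector_space "dual_scale :: 'k \<Rightarrow> (((nat \<Rightarrow> 'a) \<Rightarrow> 'a) \<Rightarrow> 'k) \<Rightarrow> _" by (rule vector_space_dual)
  let ?M = "homA (projmod e k)"
  show ?thesis
  proof unfold_locales
    show "fin_subspace dual_scale (dualA sc ?M)" by (rule fin_subspace_dualA[OF k])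
    fix \<psi> a assume \<psi>: "\<psi> \<in> dualA sc ?M"
    have add: "\<psi> (\<lambda>x. (m + m') x * b) = \<psi> (\<lambda>x. m x * b) + \<psi> (\<lambda>x. m' x * b)" if "m \<in> ?M" "m' \<in> ?M" for m m' b
    proof -
      have "(\<lambda>x. (m + m') x * b) = (\<lambda>x. m x * b) + (\<lambda>x. m' x * b)" by (auto simp: fun_eq_iff distrib_right)
      then show ?thesis using dualA_add[OF \<psi>] homA_mult that by metis
    qed
    have sc: "\<psi> (\<lambda>x. sc c (m x) * b) = c * \<psi> (\<lambda>x. m x * b)" if "m \<in> ?M" for m b c
      unfolding sc_mult(1)[symmetric] using dualA_sc[OF \<psi> homA_mult[OF that]] .
    show "dual_act ?M a \<psi> \<in> dualA sc ?M"
      unfolding dualA_def dual_act_def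
    proof (intro CollectI conjI allI ballI impI)
      fix m m' assume m: "m \<in> ?M" "m' \<in> ?M"
      show "(if m + m' \<in> ?M then \<psi> (\<lambda>x. (m + m') x * a) else 0)
        = (if m \<in> ?M then \<psi> (\<lambda>x. m x * a) else 0) + (if m' \<in> ?M then \<psi> (\<lambda>x. m' x * a) else 0)"
        unfolding if_P[OF homA_add[OF m]] if_P[OF m(1)] if_P[OF m(2)] by (rule add[OF m])
    qed (simp_all add: sc homA_sc)
    show "dual_act ?M a (\<psi> + \<phi>) = dual_act ?M a \<psi> + dual_act ?M a \<phi>" for \<phi>
      unfolding dual_act_def by auto
    show "dual_act ?M (a + b) \<psi> = dual_act ?M a \<psi> + dual_act ?M b \<psi>" for b
    proof
      fix m
      have "\<psi> (\<lambda>x. m x * (a + b)) = \<psi> (\<lambda>x. m x * a) + \<psi> (\<lambda>x. m x * b)" if m: "m \<in> ?M"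
      proof -
        have "(\<lambda>x. m x * (a + b)) = (\<lambda>x. m x * a) + (\<lambda>x. m x * b)" by (auto simp: fun_eq_iff distrib_left)
        then show ?thesis using dualA_add[OF \<psi> homA_mult[OF m] homA_mult[OF m], of a b] by argo
      qed
      then show "dual_act ?M (a + b) \<psi> m = (dual_act ?M a \<psi> + dual_act ?M b \<psi>) m"
        by (simp add: dual_act_def)
    qed
    show "dual_act ?M (a * b) \<psi> = dual_act ?M a (dual_act ?M b \<psi>)" for b
      unfolding dual_act_def by (intro ext) (simp add: homA_mult mult.assoc)
    show "dual_act ?M 1 \<psi> = \<psi>"
      unfolding dual_act_def by (intro ext) (simp add: dualA_out[OF \<psi>])
    show "dual_act ?M (sc c a) \<psi> = dual_scale c (dual_act ?M a \<psi>)" for c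
      unfolding dual_act_def dual_scale_def sc_mult(2)[symmetric]
      by (intro ext) (simp add: dualA_sc[OF \<psi> homA_mult])
  qed
qed

text \<open>Functionals on Hom(P1, A) that kill every homomorphism factoring through f: the dual of
  Cok Hom_A(f, A).\<close>

definition Ker_nu :: "nat list \<Rightarrow> nat list \<Rightarrow> ((nat \<Rightarrow> 'a) \<Rightarrow> (nat \<Rightarrow> 'a)) \<Rightarrow> (((nat \<Rightarrow> 'a) \<Rightarrow> 'a) \<Rightarrow> 'k) set" where
  "Ker_nu k0 k1 f = {\<psi> \<in> dualA sc (homA (projmod e k1)). \<forall>m\<in>homA (projmod e k0). \<psi> (m \<circ> f) = 0}"

lemma Knuf_eq: "Knuf n e sc \<eta> f = Ker_nu (L0 n \<eta>) (L1 n \<eta>) f"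
  unfolding Knuf_def Ker_nu_def nu_map_def P0_eq P1_eq by (auto simp: fun_eq_iff)

lemma submod_Ker_nu:
  assumes f: "f \<in> hom_mod lm (projmod e k1) lm (projmod e k0)" and k: "set k1 \<subseteq> {..<n}"
  shows "submod (dual_act (homA (projmod e k1))) (dualA sc (homA (projmod e k1))) (Ker_nu k0 k1 f)"
proof -
  interpret D: fmod sc n e dual_scale "dual_act (homA (projmod e k1))" "dualA sc (homA (projmod e k1))"
    by (rule fmod_dualA[OF k])
  show ?thesis unfolding submod_def
  proof (intro conjI ballI allI)
    show "Ker_nu k0 k1 f \<subseteq> dualA sc (homA (projmod e k1))" unfolding Ker_nu_def by blast
    show "0 \<in> Ker_nu k0 k1 f" using D.zero_W unfolding Ker_nu_def by simp
    show "x + y \<in> Ker_nu k0 k1 f" if "x \<in> Ker_nu k0 k1 f" "y \<in> Ker_nu k0 k1 f" for x y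
      using that D.subspace_add[OF D.subspace_W] unfolding Ker_nu_def by simp
    fix a \<psi> assume \<psi>: "\<psi> \<in> Ker_nu k0 k1 f"
    have "dual_act (homA (projmod e k1)) a \<psi> (m \<circ> f) = 0" if m: "m \<in> homA (projmod e k0)" for m
    proof -
      have "(\<lambda>x. (m \<circ> f) x * a) = (\<lambda>x. m x * a) \<circ> f" by (auto simp: fun_eq_iff)
      then have "\<psi> (\<lambda>x. (m \<circ> f) x * a) = 0" using \<psi> homA_mult[OF m] unfolding Ker_nu_def by auto
      then show ?thesis unfolding dual_act_def by simp
    qed
    then show "dual_act (homA (projmod e k1)) a \<psi> \<in> Ker_nu k0 k1 f"
      using \<psi> D.act_in unfolding Ker_nu_def by blast
  qed
qed

lemma fmod_Ker_nu:
  assumes "f \<in> hom_mod lm (projmod e k1) lm (projmod e k0)" "set k1 \<subseteq> {..<n}"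
  shows "fmod sc n e dual_scale (dual_act (homA (projmod e k1))) (Ker_nu k0 k1 f)"
  using fmod.fmod_submod[OF fmod_dualA[OF assms(2)] submod_Ker_nu[OF assms]] .

section \<open>Duality between matrices and tuples over the kernel of \<nu>f\<close>

lemma mmul_add_left: "mmul q (S + S') N = mmul q S N + mmul q S' N"
  and mmul_add_right: "mmul q N (S + S') = mmul q N S + mmul q N S'"
  and mmul_scale_left: "mmul q (vsc (vsc sc) c S) N = vsc (vsc sc) c (mmul q S N)"
  and mmul_scale_right: "mmul q N (vsc (vsc sc) c S) = vsc (vsc sc) c (mmul q N S)"
proof -
  show "mmul q (S + S') N = mmul q S N + mmul q S' N" "mmul q N (S + S') = mmul q N S + mmul q N S'"
    by (intro ext, simp add: mmul_entry distrib_left distrib_right sum.distrib)+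
  show "mmul q (vsc (vsc sc) c S) N = vsc (vsc sc) c (mmul q S N)"
    by (intro ext, simp add: mmul_entry vsc_def sc_sum sc_mult(1))
  show "mmul q N (vsc (vsc sc) c S) = vsc (vsc sc) c (mmul q N S)"
    by (intro ext, simp add: mmul_entry vsc_def sc_sum sc_mult(2))
qed

lemma vector_space_Mat: "vector_space (vsc (vsc sc))"
  by (intro vector_space_vsc sc_vector_space)

lemma Mat_fin: "set k \<subseteq> {..<n} \<Longrightarrow> fin_subspace (vsc (vsc sc)) (Mat e k l)"
proof -
  interpret Q: fmod sc n e "vsc sc" lm "projmod e l" by (rule fmod_projmod)
  show "set k \<subseteq> {..<n} \<Longrightarrow> ?thesis" unfolding Mat_def by (rule Q.tup_fin[OF Q.submod_W])
qed

lemma Mat_subspace: "module.subspace (vsc (vsc sc)) (Mat e k l)"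
proof -
  interpret Q: fmod sc n e "vsc sc" lm "projmod e l" by (rule fmod_projmod)
  show ?thesis unfolding Mat_def by (rule Q.tup_subspace[OF Q.submod_W])
qed

lemma Mat_col: "h \<in> Mat e k l \<Longrightarrow> (\<lambda>r. h r c) \<in> tup (*) e k UNIV"
  by (rule tupI) (auto simp: MatD)

lemma col_Mat:
  assumes v: "v \<in> tup (*) e k UNIV" and c: "c < length l" and l: "set l \<subseteq> {..<n}"
  shows "(\<lambda>r c'. if c' = c then v r * e (l ! c) else 0) \<in> Mat e k l"
proof -
  have "e (l ! c) * e (l ! c) = e (l ! c)" using fmod.idem_nth[OF fmod_regular l c] .
  then show ?thesis unfolding Mat_iff using tup_idem[OF v] tup_out[OF v] c
    by (auto simp: mult.assoc) (auto simp: mult.assoc[symmetric])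
qed

lemma row_mod_comp:
  assumes f: "f \<in> hom_mod lm (projmod e k1) lm (projmod e k0)" and S: "S \<in> Mat e k0 l"
    and k: "set k1 \<subseteq> {..<n}" "set k0 \<subseteq> {..<n}"
  shows "row_mod k1 (\<lambda>r. mmul (length k0) (matof e k1 f) S r c) = row_mod k0 (\<lambda>r. S r c) \<circ> f"
proof -
  interpret R: fmod sc n e sc "(*)" UNIV by (rule fmod_regular)
  have 1: "row_mod k0 (\<lambda>r. S r c) \<in> homA (projmod e k0)" by (rule row_mod_homA[OF Mat_col[OF S]])
  have "matof e k1 (row_mod k0 (\<lambda>r. S r c) \<circ> f) = mv (*) (length k0) (matof e k1 f) (\<lambda>r. S r c)"
    using R.matof_comp[OF f 1[unfolded homA_iff] k] matof_row_mod[OF Mat_col[OF S] k(2)] by simp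
  also have "\<dots> = (\<lambda>r. mmul (length k0) (matof e k1 f) S r c)"
    unfolding mmul_entry unfolding mv_def by simp
  finally show ?thesis using row_mod_matof[OF homA_comp[OF 1 f] k(1)] by simp
qed

lemma row_mod_mmul:
  "row_mod k (\<lambda>r. mmul q S G r c) = (\<Sum>j<q. (\<lambda>x. row_mod k (\<lambda>r. S r j) x * G j c))"
proof
  fix x
  have "(\<Sum>r<length k. x r * (\<Sum>j<q. S r j * G j c)) = (\<Sum>j<q. (\<Sum>r<length k. x r * S r j) * G j c)"
    unfolding sum_distrib_left sum_distrib_right by (subst sum.swap) (simp add: mult.assoc)
  then show "row_mod k (\<lambda>r. mmul q S G r c) x = (\<Sum>j<q. (\<lambda>x. row_mod k (\<lambda>r. S r j) x * G j c)) x"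
    unfolding sum_apply mmul_entry by (auto simp: homof_def)
qed

text \<open>A tuple \<open>\<psi>\<close> in \<open>Hom(Q0, D Hom(P1, A))\<close> is the functional
  \<open>h \<mapsto> \<Sum>\<^sub>c \<psi>\<^sub>c (h\<^sub>c)\<close> on \<open>Hom(P1, Q0)\<close>.\<close>

lemma E_van_imp_inj_mod:
  assumes f: "f \<in> hom_mod lm (projmod e k1) lm (projmod e k0)"
    and k: "set k1 \<subseteq> {..<n}" "set k0 \<subseteq> {..<n}" and l: "set l0 \<subseteq> {..<n}"
    and E: "E_van e l0 l1 k0 k1 G (matof e k1 f)"
  shows "fmod.inj_mod e (dual_act (homA (projmod e k1))) (Ker_nu k0 k1 f) l1 l0 G {0}"
proof -
  let ?M = "homA (projmod e k1)" and ?K = "Ker_nu k0 k1 f"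
  interpret K: fmod sc n e dual_scale "dual_act ?M" ?K by (rule fmod_Ker_nu[OF f k(1)])
  have "\<psi> \<in> tup (dual_act ?M) e l0 {0}"
    if \<psi>: "\<psi> \<in> tup (dual_act ?M) e l0 ?K" and 0: "mv (dual_act ?M) (length l0) G \<psi> \<in> tup (dual_act ?M) e l1 {0}" for \<psi>
  proof -
    have \<psi>K: "\<psi> c \<in> ?K" if "c < length l0" for c using tup_mem[OF \<psi> that] .
    have \<psi>D: "\<psi> c \<in> dualA sc ?M" if "c < length l0" for c using \<psi>K[OF that] unfolding Ker_nu_def by blast
    have Z: "mv (dual_act ?M) (length l0) G \<psi> j m = 0" for j m
    proof (cases "j < length l1")
      case True
      then have "mv (dual_act ?M) (length l0) G \<psi> j = 0" using tup_mem[OF 0 True] by blast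
      then show ?thesis by simp
    next
      case False
      then show ?thesis using tup_out[OF 0, of j] by simp
    qed
    \<comment> \<open>On F S' the functional vanishes since each \<open>\<psi> c\<close> kills what
      factors through f; on S G it equals the tuple G \<psi> evaluated at the columns of S, which is
      0 by assumption.\<close>
    have van: "(\<Sum>c<length l0. \<psi> c (row_mod k1 (\<lambda>r. h r c))) = 0" if h: "h \<in> Mat e k1 l0" for h
    proof -
      obtain S S' where S: "S \<in> Mat e k1 l1" "S' \<in> Mat e k0 l0"
        and hS: "h = mmul (length l1) S G + mmul (length k0) (matof e k1 f) S'"
        using E h unfolding E_van_def by blast
      have SG: "row_mod k1 (\<lambda>r. S r j) \<in> ?M" for j by (rule row_mod_homA[OF Mat_col[OF S(1)]])
      have SG': "row_mod k1 (\<lambda>r. mmul (length l1) S G r c) \<in> ?M" for c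
        unfolding row_mod_mmul by (rule homA_sum) (rule homA_mult[OF SG])
      have FS: "row_mod k0 (\<lambda>r. S' r c) \<in> homA (projmod e k0)" for c by (rule row_mod_homA[OF Mat_col[OF S(2)]])
      have "\<psi> c (row_mod k1 (\<lambda>r. h r c)) = (\<Sum>j<length l1. dual_act ?M (G j c) (\<psi> c) (row_mod k1 (\<lambda>r. S r j)))"
        if c: "c < length l0" for c
      proof -
        have "(\<lambda>r. h r c) = (\<lambda>r. mmul (length l1) S G r c) + (\<lambda>r. mmul (length k0) (matof e k1 f) S' r c)"
          unfolding hS by (simp add: fun_eq_iff)
        then have "row_mod k1 (\<lambda>r. h r c) = row_mod k1 (\<lambda>r. mmul (length l1) S G r c) + (row_mod k0 (\<lambda>r. S' r c) \<circ> f)"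
          using row_mod_comp[OF f S(2) k] row_mod_add by metis
        then have "\<psi> c (row_mod k1 (\<lambda>r. h r c)) = \<psi> c (row_mod k1 (\<lambda>r. mmul (length l1) S G r c)) + \<psi> c (row_mod k0 (\<lambda>r. S' r c) \<circ> f)"
          using dualA_add[OF \<psi>D[OF c] SG' homA_comp[OF FS f]] by metis
        also have "\<psi> c (row_mod k0 (\<lambda>r. S' r c) \<circ> f) = 0" using \<psi>K[OF c] FS unfolding Ker_nu_def by blast
        also have "\<psi> c (row_mod k1 (\<lambda>r. mmul (length l1) S G r c)) = (\<Sum>j<length l1. \<psi> c (\<lambda>x. row_mod k1 (\<lambda>r. S r j) x * G j c))"
          unfolding row_mod_mmul by (rule dualA_sum[OF \<psi>D[OF c]]) (rule homA_mult[OF SG])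
        also have "\<dots> = (\<Sum>j<length l1. dual_act ?M (G j c) (\<psi> c) (row_mod k1 (\<lambda>r. S r j)))"
          unfolding dual_act_def using SG by simp
        finally show ?thesis by simp
      qed
      then have "(\<Sum>c<length l0. \<psi> c (row_mod k1 (\<lambda>r. h r c)))
        = (\<Sum>c<length l0. \<Sum>j<length l1. dual_act ?M (G j c) (\<psi> c) (row_mod k1 (\<lambda>r. S r j)))" by simp
      also have "\<dots> = (\<Sum>j<length l1. mv (dual_act ?M) (length l0) G \<psi> j (row_mod k1 (\<lambda>r. S r j)))"
        unfolding mv_def sum_apply by (rule sum.swap)
      finally show ?thesis using Z by simp
    qed
    show ?thesis
    proof (rule tupI)
      fix c assume c: "c < length l0"
      show "dual_act ?M (e (l0 ! c)) (\<psi> c) = \<psi> c" using tup_idem[OF \<psi> c] .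
      have "\<psi> c m = 0" for m
      proof (cases "m \<in> ?M")
        case True
        have v: "matof e k1 m \<in> tup (*) e k1 UNIV" by (rule homA_matof[OF True k(1)])
        \<comment> \<open>A matrix supported in column c isolates the single value of
          \<open>\<psi> c\<close> at m e_i with i = l0!c, and this is \<open>\<psi> c m\<close>
          because e_i fixes \<open>\<psi> c\<close>.\<close>
        define h where "h = (\<lambda>r c'. if c' = c then matof e k1 m r * e (l0 ! c) else 0)"
        have h: "h \<in> Mat e k1 l0" unfolding h_def by (rule col_Mat[OF v c l])
        have hc: "row_mod k1 (\<lambda>r. h r c) = (\<lambda>x. m x * e (l0 ! c))"
        proof
          fix x
          have "row_mod k1 (\<lambda>r. h r c) x = row_mod k1 (matof e k1 m) x * e (l0 ! c)"
            by (simp add: homof_def h_def sum_distrib_right mult.assoc)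
          then show "row_mod k1 (\<lambda>r. h r c) x = m x * e (l0 ! c)" using row_mod_matof[OF True k(1)] by simp
        qed
        have other: "\<psi> c' (row_mod k1 (\<lambda>r. h r c')) = 0" if "c' \<noteq> c" "c' < length l0" for c'
        proof -
          have "row_mod k1 (\<lambda>r. h r c') = 0" using that by (auto simp: homof_def h_def fun_eq_iff)
          then show ?thesis using dualA_zero[OF \<psi>D[OF that(2)]] by simp
        qed
        have "(\<Sum>c'<length l0. \<psi> c' (row_mod k1 (\<lambda>r. h r c'))) = \<psi> c (row_mod k1 (\<lambda>r. h r c))"
          using c other by (subst sum.remove[of _ c]) (auto intro!: sum.neutral)
        then have "\<psi> c (\<lambda>x. m x * e (l0 ! c)) = 0" using van[OF h] hc by simp
        then have "dual_act ?M (e (l0 ! c)) (\<psi> c) m = 0" by (simp add: dual_act_def)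
        then show ?thesis using tup_idem[OF \<psi> c] by simp
      next
        case False
        then show ?thesis using dualA_out[OF \<psi>D[OF c]] by blast
      qed
      then show "\<psi> c \<in> {0}" by (auto simp: fun_eq_iff)
    qed (rule tup_out[OF \<psi>])
  qed
  then show ?thesis unfolding K.inj_mod_def by blast
qed

text \<open>If some h0 is not null-homotopic, separate it by a linear functional \<Phi> from the
  null-homotopic matrices. Read column by column, \<Phi> is a tuple over K_\<nu>f killed by G, hence
  zero by injectivity; but then \<Phi> vanishes at h0, which is the sum of its columns.\<close>

lemma inj_mod_imp_E_van:
  assumes f: "f \<in> hom_mod lm (projmod e k1) lm (projmod e k0)" and G: "G \<in> Mat e l1 l0"
    and k: "set k1 \<subseteq> {..<n}" "set k0 \<subseteq> {..<n}" and l: "set l0 \<subseteq> {..<n}" "set l1 \<subseteq> {..<n}"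
    and inj: "fmod.inj_mod e (dual_act (homA (projmod e k1))) (Ker_nu k0 k1 f) l1 l0 G {0}"
  shows "E_van e l0 l1 k0 k1 G (matof e k1 f)"
proof (rule ccontr)
  let ?M = "homA (projmod e k1)" and ?K = "Ker_nu k0 k1 f" and ?F = "matof e k1 f"
  interpret K: fmod sc n e dual_scale "dual_act ?M" ?K by (rule fmod_Ker_nu[OF f k(1)])
  interpret D: fmod sc n e dual_scale "dual_act ?M" "dualA sc ?M" by (rule fmod_dualA[OF k(1)])
  interpret R: fmod sc n e sc "(*)" UNIV by (rule fmod_regular)
  interpret Q: fmod sc n e "vsc sc" lm "projmod e l0" by (rule fmod_projmod)
  assume "\<not> ?thesis"
  then obtain h0 where h0: "h0 \<in> Mat e k1 l0"
    and no: "\<And>S S'. S \<in> Mat e k1 l1 \<Longrightarrow> S' \<in> Mat e k0 l0 \<Longrightarrow> h0 \<noteq> mmul (length l1) S G + mmul (length k0) ?F S'"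
    unfolding E_van_def by blast
  let ?A = "(\<lambda>S. mmul (length l1) S G) ` Mat e k1 l1"
  let ?B = "(\<lambda>S'. mmul (length k0) ?F S') ` Mat e k0 l0"
  let ?T = "{x + y | x y. x \<in> ?A \<and> y \<in> ?B}"
  have sA: "Q.T.subspace ?A" by (rule Q.TT.subspace_image_on[OF Mat_subspace mmul_add_left mmul_scale_left])
  have sB: "Q.T.subspace ?B" by (rule Q.TT.subspace_image_on[OF Mat_subspace mmul_add_right mmul_scale_right])
  have sT: "Q.T.subspace ?T" by (rule Q.T.subspace_sums[OF sA sB])
  have "h0 \<notin> ?T" using no by blast
  then have "\<exists>\<Phi>. (\<forall>y z. \<Phi> (y + z) = \<Phi> y + \<Phi> z) \<and> (\<forall>c y. \<Phi> (vsc (vsc sc) c y) = c * \<Phi> y)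
    \<and> (\<forall>y\<in>?T. \<Phi> y = 0) \<and> \<Phi> h0 \<noteq> 0" by (rule Q.T.ex_separating_functional[OF sT])
  then obtain \<Phi> where "(\<forall>y z. \<Phi> (y + z) = \<Phi> y + \<Phi> z) \<and> (\<forall>c y. \<Phi> (vsc (vsc sc) c y) = c * \<Phi> y)
    \<and> (\<forall>y\<in>?T. \<Phi> y = 0) \<and> \<Phi> h0 \<noteq> 0" ..
  note \<Phi>' = this
  have \<Phi>: "\<Phi> (y + z) = \<Phi> y + \<Phi> z" "\<Phi> (vsc (vsc sc) c y) = c * \<Phi> y"
      "y \<in> ?T \<Longrightarrow> \<Phi> y = 0" "\<Phi> h0 \<noteq> 0" for y z c
    using \<Phi>' by blast+
  have \<Phi>0: "\<Phi> 0 = 0" using \<Phi>(1)[of 0 0] by (simp only: add_0_left add_cancel_right_left)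
  have \<Phi>_sum: "\<Phi> (sum g I) = (\<Sum>i\<in>I. \<Phi> (g i))" for g and I :: "nat set"
  proof (induction I rule: infinite_finite_induct)
    case (insert i I)
    show ?case unfolding sum.insert[OF insert.hyps] \<Phi>(1) insert.IH ..
  qed (simp_all only: sum.infinite sum.empty \<Phi>0 not_False_eq_True)
  have A0: "0 \<in> ?A" "0 \<in> ?B" using Q.T.subspace_0[OF sA] Q.T.subspace_0[OF sB] .
  have \<Phi>A: "\<Phi> (mmul (length l1) S G) = 0" if "S \<in> Mat e k1 l1" for S
  proof (rule \<Phi>(3))
    have "mmul (length l1) S G = mmul (length l1) S G + 0" by simp
    then show "mmul (length l1) S G \<in> ?T" using that A0(2) by blast
  qed
  have \<Phi>B: "\<Phi> (mmul (length k0) ?F S) = 0" if "S \<in> Mat e k0 l0" for S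
  proof (rule \<Phi>(3))
    have "mmul (length k0) ?F S = 0 + mmul (length k0) ?F S" by simp
    then show "mmul (length k0) ?F S \<in> ?T" using that A0(1) by blast
  qed
  \<comment> \<open>Column embedding, with v first projected by the idempotent of column c so that
    tuples land in the matrix space.\<close>
  define E where "E l c v = (\<lambda>r c'. if c' = c then v r * e (l ! c) else 0)" for l :: "nat list" and c :: nat and v :: "nat \<Rightarrow> 'a"
  have E_add: "E l c (v + w) = E l c v + E l c w" for l c v w
    unfolding E_def by (auto simp: fun_eq_iff distrib_right)
  have E_sc: "E l c (vsc sc a v) = vsc (vsc sc) a (E l c v)" for l c v a
    unfolding E_def by (auto simp: fun_eq_iff vsc_def sc_mult(1) sc_zero)
  have mat_add: "matof e k1 (m + m') = matof e k1 m + matof e k1 m'" for m m' :: "(nat \<Rightarrow> 'a) \<Rightarrow> 'a"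
    unfolding matof_def by (auto simp: fun_eq_iff)
  have mat_sc: "matof e k1 (\<lambda>x. sc c (m x)) = vsc sc c (matof e k1 m)" for m :: "(nat \<Rightarrow> 'a) \<Rightarrow> 'a" and c
    unfolding matof_def vsc_def by (auto simp: fun_eq_iff sc_zero)
  have mat_mult: "matof e k1 (\<lambda>x. m x * a) = (\<lambda>r. matof e k1 m r * a)" for m :: "(nat \<Rightarrow> 'a) \<Rightarrow> 'a" and a
    unfolding matof_def by (auto simp: fun_eq_iff)
  \<comment> \<open>Component c of the tuple is \<Phi> restricted to column c. Vanishing of \<Phi>
    on the products F S' will put it in K_\<nu>f, vanishing on the products S G will give G \<psi> =
    0.\<close>
  define \<psi> where "\<psi> c = (if c < length l0 then (\<lambda>m. if m \<in> ?M then \<Phi> (E l0 c (matof e k1 m)) else 0) else 0)" for c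
  have \<psi>D: "\<psi> c \<in> dualA sc ?M" for c
    unfolding dualA_def \<psi>_def using homA_add homA_sc
    by (auto simp: mat_add mat_sc E_add E_sc \<Phi>(1,2) simp del: plus_fun_apply)
  have \<psi>K: "\<psi> c \<in> ?K" for c unfolding Ker_nu_def
  proof (intro CollectI conjI ballI \<psi>D)
    fix m assume m: "m \<in> homA (projmod e k0)"
    show "\<psi> c (m \<circ> f) = 0"
    proof (cases "c < length l0")
      case True
      have "matof e k1 (m \<circ> f) = mv (*) (length k0) ?F (matof e k0 m)"
        using R.matof_comp[OF f m[unfolded homA_iff] k] .
      then have "E l0 c (matof e k1 (m \<circ> f)) = mmul (length k0) ?F (E l0 c (matof e k0 m))"
        unfolding fun_eq_iff mmul_entry by (auto simp: E_def mv_def sum_distrib_right mult.assoc)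
      moreover have "E l0 c (matof e k0 m) \<in> Mat e k0 l0"
        unfolding E_def by (rule col_Mat[OF homA_matof[OF m k(2)] True l(1)])
      ultimately show ?thesis using \<Phi>B True homA_comp[OF m f] by (simp add: \<psi>_def)
    qed (simp add: \<psi>_def)
  qed
  have \<psi>t: "\<psi> \<in> tup (dual_act ?M) e l0 ?K"
  proof (rule tupI[OF \<psi>K])
    fix c assume c: "c < length l0"
    have "E l0 c (\<lambda>r. v r * e (l0 ! c)) = E l0 c v" for v
      using R.idem_nth[OF l(1) c] by (auto simp: E_def fun_eq_iff mult.assoc)
    then show "dual_act ?M (e (l0 ! c)) (\<psi> c) = \<psi> c"
      using c by (intro ext) (simp add: homA_mult dual_act_def \<psi>_def mat_mult)
  qed (simp add: \<psi>_def)
  have "mv (dual_act ?M) (length l0) G \<psi> \<in> tup (dual_act ?M) e l1 {0}"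
  proof -
    have t: "mv (dual_act ?M) (length l0) G \<psi> \<in> tup (dual_act ?M) e l1 ?K"
      by (rule K.mv_in[OF G \<psi>t K.submod_W])
    have "mv (dual_act ?M) (length l0) G \<psi> j m = 0" if j: "j < length l1" for j m
    proof (cases "m \<in> ?M")
      case True
      let ?v = "matof e k1 m"
      have v: "?v \<in> tup (*) e k1 UNIV" by (rule homA_matof[OF True k(1)])
      have "mv (dual_act ?M) (length l0) G \<psi> j m = (\<Sum>c<length l0. \<Phi> (E l0 c (\<lambda>r. ?v r * G j c)))"
        unfolding mv_def sum_apply using True homA_mult by (intro sum.cong) (auto simp: dual_act_def \<psi>_def mat_mult)
      also have "\<dots> = \<Phi> (\<Sum>c<length l0. E l0 c (\<lambda>r. ?v r * G j c))" by (rule \<Phi>_sum[symmetric])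
      also have "(\<Sum>c<length l0. E l0 c (\<lambda>r. ?v r * G j c)) = mmul (length l1) (E l1 j ?v) G"
      proof (intro ext)
        fix r c'
        have "(\<Sum>c<length l0. E l0 c (\<lambda>r. ?v r * G j c)) r c' = (\<Sum>c<length l0. if c = c' then ?v r * (G j c' * e (l0 ! c')) else 0)"
          unfolding sum_apply E_def by (auto intro!: sum.cong simp: mult.assoc)
        also have "\<dots> = ?v r * G j c'" using MatD(2,4)[OF G] by (auto simp: not_less)
        also have "\<dots> = (\<Sum>i<length l1. if i = j then ?v r * (e (l1 ! j) * G j c') else 0)"
          using j MatD(1)[OF G j] by simp
        also have "\<dots> = mmul (length l1) (E l1 j ?v) G r c'"
          unfolding mmul_entry E_def by (rule sum.cong) (simp_all add: mult.assoc)
        finally show "(\<Sum>c<length l0. E l0 c (\<lambda>r. ?v r * G j c)) r c' = mmul (length l1) (E l1 j ?v) G r c'" .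
      qed
      also have "\<Phi> \<dots> = 0" by (rule \<Phi>A, unfold E_def, rule col_Mat[OF v j l(2)])
      finally show ?thesis .
    next
      case False
      have "mv (dual_act ?M) (length l0) G \<psi> j \<in> dualA sc ?M" using tup_mem[OF t j] unfolding Ker_nu_def by blast
      then show ?thesis using dualA_out False by blast
    qed
    then show ?thesis using tup_idem[OF t] tup_out[OF t] by (intro tupI) (auto simp: fun_eq_iff)
  qed
  then have \<psi>0: "\<psi> \<in> tup (dual_act ?M) e l0 {0}" using inj \<psi>t unfolding K.inj_mod_def by blast
  have "h0 = (\<Sum>c<length l0. E l0 c (\<lambda>r. h0 r c))"
  proof (intro ext)
    fix r c'
    have "(\<Sum>c<length l0. E l0 c (\<lambda>r. h0 r c)) r c' = (\<Sum>c<length l0. if c = c' then h0 r c' * e (l0 ! c') else 0)"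
      unfolding sum_apply E_def by (auto intro!: sum.cong)
    then show "h0 r c' = (\<Sum>c<length l0. E l0 c (\<lambda>r. h0 r c)) r c'"
      using MatD(2,4)[OF h0] by (auto simp: not_less)
  qed
  then have "\<Phi> h0 = (\<Sum>c<length l0. \<Phi> (E l0 c (\<lambda>r. h0 r c)))" using \<Phi>_sum by metis
  also have "\<dots> = 0"
  proof (rule sum.neutral, rule ballI)
    fix c assume "c \<in> {..<length l0}"
    then have c: "c < length l0" by simp
    have "\<psi> c (row_mod k1 (\<lambda>r. h0 r c)) = 0" using tup_mem[OF \<psi>0 c] by simp
    then show "\<Phi> (E l0 c (\<lambda>r. h0 r c)) = 0"
      using c row_mod_homA[OF Mat_col[OF h0]] matof_row_mod[OF Mat_col[OF h0] k(1)] by (simp add: \<psi>_def)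
  qed
  finally show False using \<Phi>(4) by blast
qed

end

subsection \<open>General presentations\<close>

text \<open>Over a finite field the product of all X - a, increased by 1, takes the value 1
  everywhere and so has no root.\<close>

lemma infinite_alg_closed:
  assumes "alg_closed_field TYPE('k::field)"
  shows "infinite (UNIV :: 'k set)"
proof
  assume fin: "finite (UNIV :: 'k set)"
  define p where "p = (\<Prod>a\<in>(UNIV :: 'k set). [:- a, 1:])"
  have "degree p = card (UNIV :: 'k set)" unfolding p_def by (subst degree_prod_eq_sum_degree) auto
  then have "degree p \<ge> 1" using fin by (simp add: Suc_le_eq card_gt_0_iff)
  moreover have "degree (p + 1) = degree p" using \<open>degree p \<ge> 1\<close> by (intro degree_add_eq_left) simp
  ultimately obtain x where "poly (p + 1) x = 0" using assms unfolding alg_closed_field_def by metis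
  moreover have "poly p x = 0" unfolding p_def poly_prod using fin by (auto simp: prod_zero_iff)
  ultimately show False by simp
qed

lemma polyfun_diff:
  assumes "polyfun H sm p" "polyfun H sm q"
  shows "polyfun H sm (\<lambda>f. p f - q f)"
proof -
  have "polyfun H sm (\<lambda>f. p f + (- 1) * q f)"
    by (rule polyfun.padd[OF assms(1) polyfun.pmult[OF polyfun.pconst assms(2)]])
  then show ?thesis by simp
qed

lemma polyfun_line:
  assumes p: "polyfun H sm p" and f: "f \<in> H" "g \<in> H" and sm: "\<And>c f. f \<in> H \<Longrightarrow> sm c f \<in> H"
  shows "\<exists>\<pi>. \<forall>t. p (sm (1 - t) f + sm t g) = poly \<pi> t"
  using p
proof induction
  case (pconst c)
  then show ?case by (intro exI[of _ "[:c:]"]) simp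
next
  case (plin l)
  have "l (sm (1 - t) f + sm t g) = poly [:l f, l g - l f:] t" for t
    using plin f sm by (simp add: algebra_simps)
  then show ?case by blast
next
  case (padd p q)
  then obtain \<pi> \<rho> where "\<And>t. p (sm (1 - t) f + sm t g) = poly \<pi> t" "\<And>t. q (sm (1 - t) f + sm t g) = poly \<rho> t"
    by blast
  then show ?case by (intro exI[of _ "\<pi> + \<rho>"]) simp
next
  case (pmult p q)
  then obtain \<pi> \<rho> where "\<And>t. p (sm (1 - t) f + sm t g) = poly \<pi> t" "\<And>t. q (sm (1 - t) f + sm t g) = poly \<rho> t"
    by blast
  then show ?case by (intro exI[of _ "\<pi> * \<rho>"]) simp
qed

lemma generalD: "general H sm P \<Longrightarrow> \<exists>f\<in>H. P f"
  unfolding general_def by blast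

lemma general_mono: "general H sm P \<Longrightarrow> (\<And>f. f \<in> H \<Longrightarrow> P f \<Longrightarrow> Q f) \<Longrightarrow> general H sm Q"
  unfolding general_def by blast

text \<open>Irreducibility of the affine space, tested on the line from a point f with p f \<noteq>
  0 to a point g with q g \<noteq> 0. Along it p and q become nonzero polynomials in t, and an
  infinite field contains a t that is a root of neither.\<close>

lemma general_conj:
  fixes sm :: "'k::field \<Rightarrow> 'h::ab_group_add \<Rightarrow> 'h"
  assumes inf: "infinite (UNIV :: 'k set)" and sm: "\<And>c f. f \<in> H \<Longrightarrow> sm c f \<in> H"
    and add: "\<And>f g. f \<in> H \<Longrightarrow> g \<in> H \<Longrightarrow> f + g \<in> H"
    and ends: "\<And>f. sm 0 f = 0" "\<And>f. sm 1 f = f"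
    and P: "general H sm P" and Q: "general H sm Q"
  shows "general H sm (\<lambda>f. P f \<and> Q f)"
proof -
  obtain p f where p: "polyfun H sm p" "f \<in> H" "p f \<noteq> 0" "\<And>f. f \<in> H \<Longrightarrow> p f \<noteq> 0 \<Longrightarrow> P f"
    using P unfolding general_def by blast
  obtain q g where q: "polyfun H sm q" "g \<in> H" "q g \<noteq> 0" "\<And>f. f \<in> H \<Longrightarrow> q f \<noteq> 0 \<Longrightarrow> Q f"
    using Q unfolding general_def by blast
  obtain \<pi> where \<pi>: "\<And>t. p (sm (1 - t) f + sm t g) = poly \<pi> t"
    using polyfun_line[OF p(1,2) q(2) sm] by blast
  obtain \<rho> where \<rho>: "\<And>t. q (sm (1 - t) f + sm t g) = poly \<rho> t"
    using polyfun_line[OF q(1) p(2) q(2) sm] by blast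
  have "poly \<pi> 0 \<noteq> 0" "poly \<rho> 1 \<noteq> 0"
    using p(3) q(3) \<pi>[of 0] \<rho>[of 1] by (auto simp: ends)
  then have "\<pi> * \<rho> \<noteq> 0" by auto
  then have "finite {t. poly (\<pi> * \<rho>) t = 0}" by (rule poly_roots_finite)
  then obtain t where "poly (\<pi> * \<rho>) t \<noteq> 0" using inf by (metis (mono_tags, lifting) UNIV_eq_I mem_Collect_eq)
  then have t: "p (sm (1 - t) f + sm t g) \<noteq> 0" "q (sm (1 - t) f + sm t g) \<noteq> 0" using \<pi> \<rho> by auto
  show ?thesis unfolding general_def
  proof (intro exI conjI)
    show "polyfun H sm (\<lambda>f. p f * q f)" by (rule polyfun.pmult[OF p(1) q(1)])
    show "\<exists>f\<in>H. p f * q f \<noteq> 0" using t add sm p(2) q(2) by (intro bexI[of _ "sm (1 - t) f + sm t g"]) auto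
    show "\<forall>f\<in>H. p f * q f \<noteq> 0 \<longrightarrow> P f \<and> Q f" using p(4) q(4) by auto
  qed
qed

text \<open>Nonsingularity is preserved by one elimination step with a nonzero pivot, so no determinant is needed.\<close>

lemma polyfun_nonsingular:
  fixes a :: "'i \<Rightarrow> 'j \<Rightarrow> 'h::plus \<Rightarrow> 'k::field"
  assumes "finite J" "\<And>i j. i \<in> I \<Longrightarrow> j \<in> J \<Longrightarrow> polyfun H sm (a i j)"
    and "\<And>c. (\<And>i. i \<in> I \<Longrightarrow> (\<Sum>j\<in>J. a i j f0 * c j) = 0) \<Longrightarrow> (\<And>j. j \<in> J \<Longrightarrow> c j = 0)"
  shows "\<exists>p. polyfun H sm p \<and> p f0 \<noteq> 0 \<and> (\<forall>f. p f \<noteq> 0 \<longrightarrow>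
    (\<forall>c. (\<forall>i\<in>I. (\<Sum>j\<in>J. a i j f * c j) = 0) \<longrightarrow> (\<forall>j\<in>J. c j = 0)))"
  using assms
proof (induction J arbitrary: a rule: finite_induct)
  case empty
  show ?case by (intro exI[of _ "\<lambda>_. 1"]) (auto intro: polyfun.pconst)
next
  case (insert k J)
  have "\<exists>r\<in>I. a r k f0 \<noteq> 0"
  proof (rule ccontr)
    assume no: "\<not> ?thesis"
    have "(\<Sum>j\<in>insert k J. a i j f0 * (if j = k then 1 else 0)) = 0" if "i \<in> I" for i
      using no that insert.hyps by (auto intro!: sum.neutral)
    from insert.prems(2)[of "\<lambda>j. if j = k then 1 else 0" k, OF this] show False by simp
  qed
  then obtain r where r: "r \<in> I" "a r k f0 \<noteq> 0" by blast
  \<comment> \<open>Elimination of column k by the pivot row r with denominators cleared, so that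
    the new coefficients are again polynomial functions.\<close>
  define b where "b i j = (\<lambda>f. a r k f * a i j f - a i k f * a r j f)" for i j
  have sum_b: "(\<Sum>j\<in>J. b i j f * c j) = a r k f * (\<Sum>j\<in>J. a i j f * c j) - a i k f * (\<Sum>j\<in>J. a r j f * c j)"
    for i f c unfolding b_def sum_distrib_left by (simp add: algebra_simps sum_subtractf)
  have "\<exists>p. polyfun H sm p \<and> p f0 \<noteq> 0 \<and> (\<forall>f. p f \<noteq> 0 \<longrightarrow>
    (\<forall>c. (\<forall>i\<in>I. (\<Sum>j\<in>J. b i j f * c j) = 0) \<longrightarrow> (\<forall>j\<in>J. c j = 0)))"
  proof (rule insert.IH)
    show "polyfun H sm (b i j)" if "i \<in> I" "j \<in> J" for i j unfolding b_def
      using that r(1) insert.prems(1) by (intro polyfun_diff polyfun.pmult) auto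
    fix c j assume c: "\<And>i. i \<in> I \<Longrightarrow> (\<Sum>j\<in>J. b i j f0 * c j) = 0" and j: "j \<in> J"
    define x where "x = (\<Sum>j\<in>J. a r j f0 * c j)"
    \<comment> \<open>A solution of the reduced system extends to the full one: the pivot row
      determines coordinate k.\<close>
    define d where "d j = (if j = k then - x / a r k f0 else c j)" for j
    have dsum: "(\<Sum>j\<in>J. a i j f0 * d j) = (\<Sum>j\<in>J. a i j f0 * c j)" for i
      using insert.hyps(2) by (intro sum.cong) (auto simp: d_def)
    have "(\<Sum>j\<in>insert k J. a i j f0 * d j) = 0" if "i \<in> I" for i
    proof -
      have "a r k f0 * (\<Sum>j\<in>J. a i j f0 * c j) = a i k f0 * x"
        using c[OF that] unfolding sum_b x_def by simp
      then show ?thesis using insert.hyps r(2) by (simp add: dsum) (simp add: d_def field_simps)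
    qed
    then have "d j = 0" by (rule insert.prems(2)) (use j in auto)
    moreover have "j \<noteq> k" using j insert.hyps(2) by blast
    ultimately show "c j = 0" by (simp add: d_def)
  qed
  then obtain p where p: "polyfun H sm p" "p f0 \<noteq> 0"
    "\<And>f c j. p f \<noteq> 0 \<Longrightarrow> (\<And>i. i \<in> I \<Longrightarrow> (\<Sum>j\<in>J. b i j f * c j) = 0) \<Longrightarrow> j \<in> J \<Longrightarrow> c j = 0"
    by blast
  have "c j = 0" if nz: "a r k f * p f \<noteq> 0" and c: "\<forall>i\<in>I. (\<Sum>j\<in>insert k J. a i j f * c j) = 0"
    and j: "j \<in> insert k J" for f c j
  proof -
    have s: "(\<Sum>j\<in>J. a i j f * c j) = - (a i k f * c k)" if "i \<in> I" for i
      using c that insert.hyps by (simp add: eq_neg_iff_add_eq_0 add.commute)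
    have "(\<Sum>j\<in>J. b i j f * c j) = 0" if "i \<in> I" for i
      unfolding sum_b using s[OF that] s[OF r(1)] by simp
    then have J0: "c j = 0" if "j \<in> J" for j using p(3)[of f c] nz that by auto
    then have "a r k f * c k = 0" using s[OF r(1)] by simp
    then show ?thesis using J0 j nz by auto
  qed
  moreover have "polyfun H sm (\<lambda>f. a r k f * p f)" using insert.prems(1)[of r k] r(1) p(1) by (intro polyfun.pmult) auto
  ultimately show ?case using r(2) p(2) by (intro exI[of _ "\<lambda>f. a r k f * p f"]) auto
qed

text \<open>Choose preimages x_b under L f0 of a basis of T. The matrix of the vectors L f (x_b) is
  the identity at f0, so it stays nonsingular for general f, and then these vectors form a basis of
  T.\<close>

lemma (in vector_space) general_surjective:
  assumes T: "fin_subspace scale T" and f0: "f0 \<in> H" "T \<subseteq> L f0 ` X"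
    and LT: "\<And>f x. f \<in> H \<Longrightarrow> x \<in> X \<Longrightarrow> L f x \<in> T"
    and sub: "\<And>f. f \<in> H \<Longrightarrow> subspace (L f ` X)"
    and poly: "\<And>\<phi> x. x \<in> X \<Longrightarrow> (\<And>y z. \<phi> (y + z) = \<phi> y + \<phi> z) \<Longrightarrow> (\<And>c y. \<phi> (scale c y) = c * \<phi> y)
      \<Longrightarrow> polyfun H sm (\<lambda>f. \<phi> (L f x))"
  shows "general H sm (\<lambda>f. T \<subseteq> L f ` X)"
proof -
  obtain B where B: "finite B" "independent B" "B \<subseteq> T" "span B = T" "card B = dim T"
    by (rule fin_subspace_basis[OF T])
  \<comment> \<open>The functionals in \<open>poly\<close> must be linear on the whole space, so
    coordinates are taken in a basis of the whole space.\<close>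
  let ?B = "extend_basis B"
  have EB: "independent ?B" "span ?B = UNIV" "B \<subseteq> ?B"
    using independent_extend_basis[OF B(2)] span_extend_basis[OF B(2)] extend_basis_superset[OF B(2)] by auto
  have "\<forall>b\<in>B. \<exists>x\<in>X. L f0 x = b" using B(3) f0(2) by blast
  then obtain x where x: "\<And>b. b \<in> B \<Longrightarrow> x b \<in> X" "\<And>b. b \<in> B \<Longrightarrow> L f0 (x b) = b" by metis
  define a where "a i j = (\<lambda>f. representation ?B (L f (x j)) i)" for i j
  have rep_sum: "representation ?B (\<Sum>b\<in>B. scale (c b) (v b)) i = (\<Sum>b\<in>B. representation ?B (v b) i * c b)" for c v i
    using EB(1,2) by (simp add: representation_sum representation_scale mult.commute)
  have "\<exists>p. polyfun H sm p \<and> p f0 \<noteq> 0 \<and> (\<forall>f. p f \<noteq> 0 \<longrightarrow>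
    (\<forall>c. (\<forall>i\<in>B. (\<Sum>j\<in>B. a i j f * c j) = 0) \<longrightarrow> (\<forall>j\<in>B. c j = 0)))"
  proof (rule polyfun_nonsingular[OF B(1)])
    show "polyfun H sm (a i j)" if "i \<in> B" "j \<in> B" for i j unfolding a_def
      by (rule poly[OF x(1)[OF that(2)]]) (use EB in \<open>simp_all add: representation_add representation_scale\<close>)
    fix c j assume c: "\<And>i. i \<in> B \<Longrightarrow> (\<Sum>j\<in>B. a i j f0 * c j) = 0" and j: "j \<in> B"
    have "a j b f0 * c b = (if b = j then c j else 0)" if "b \<in> B" for b
      unfolding a_def using x(2)[OF that] representation_basis[OF EB(1)] EB(3) that by auto
    then show "c j = 0" using c[OF j] j B(1) by simp
  qed
  then obtain p where p: "polyfun H sm p" "p f0 \<noteq> 0"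
    "\<And>f c j. p f \<noteq> 0 \<Longrightarrow> (\<And>i. i \<in> B \<Longrightarrow> (\<Sum>j\<in>B. a i j f * c j) = 0) \<Longrightarrow> j \<in> B \<Longrightarrow> c j = 0"
    by blast
  have "T \<subseteq> L f ` X" if f: "f \<in> H" and nz: "p f \<noteq> 0" for f
  proof -
    define v where "v b = L f (x b)" for b
    have zero: "c j = 0" if "(\<Sum>b\<in>B. scale (c b) (v b)) = 0" "j \<in> B" for c j
    proof (rule p(3)[OF nz _ that(2)])
      fix i
      have "(\<Sum>b\<in>B. representation ?B (v b) i * c b) = 0"
        unfolding rep_sum[symmetric] that(1) by (simp add: representation_zero)
      then show "(\<Sum>j\<in>B. a i j f * c j) = 0" unfolding a_def v_def .
    qed
    have inj: "inj_on v B"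
    proof (rule inj_onI, rule ccontr)
      fix b b' assume b: "b \<in> B" "b' \<in> B" "v b = v b'" "b \<noteq> b'"
      define c where "c j = (if j = b then 1 else 0) - (if j = b' then (1::'a) else 0)" for j
      have "(\<Sum>j\<in>B. scale (c j) (v j)) = (\<Sum>j\<in>B. (if j = b then v b else 0) - (if j = b' then v b' else 0))"
        by (intro sum.cong) (auto simp: b(4) c_def)
      also have "\<dots> = 0" using b B(1) by (simp add: sum_subtractf)
      finally have "c b = 0" by (rule zero[OF _ b(1)])
      then show False using b(4) by (simp add: c_def)
    qed
    have ind: "independent (v ` B)"
    proof (rule independent_if_scalars_zero)
      show "finite (v ` B)" using B(1) by simp
      fix u y assume s: "(\<Sum>y\<in>v ` B. scale (u y) y) = 0" and y: "y \<in> v ` B"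
      have "(\<Sum>b\<in>B. scale (u (v b)) (v b)) = 0" using s unfolding sum.reindex[OF inj] by simp
      then show "u y = 0" using zero[of "\<lambda>b. u (v b)"] y by blast
    qed
    have vT: "v ` B \<subseteq> T" unfolding v_def using LT[OF f] x(1) by blast
    have "span (v ` B) = T"
    proof (rule dim_eq_fin[OF T subspace_span])
      show "span (v ` B) \<subseteq> T" by (rule span_minimal[OF vT fin_subspace_subspace[OF T]])
      show "dim T \<le> dim (span (v ` B))"
        unfolding dim_span_eq_card_independent[OF ind] card_image[OF inj] B(5) ..
    qed
    moreover have "span (v ` B) \<subseteq> L f ` X"
      by (rule span_minimal[OF _ sub[OF f]]) (use x(1) in \<open>auto simp: v_def\<close>)
    ultimately show ?thesis by blast
  qed
  then show ?thesis unfolding general_def using p(1,2) f0(1) by blast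
qed

section \<open>Openness of E-vanishing and chains of presentations\<close>

context idem_algebra
begin

lemma E_van_subspace:
  "module.subspace (vsc (vsc sc)) ((\<lambda>(S, S'). mmul q S F + mmul q' G S') ` (Mat e l1 k1 \<times> Mat e l0 k0))"
proof -
  interpret V: vector_space "vsc (vsc sc)" by (rule vector_space_Mat)
  interpret VV: vector_space_pair "vsc (vsc sc)" "vsc (vsc sc)" by unfold_locales
  have "V.subspace ((\<lambda>S. mmul q S F) ` Mat e l1 k1)"
    by (rule VV.subspace_image_on[OF Mat_subspace mmul_add_left mmul_scale_left])
  moreover have "V.subspace ((\<lambda>S. mmul q' G S) ` Mat e l0 k0)"
    by (rule VV.subspace_image_on[OF Mat_subspace mmul_add_right mmul_scale_right])
  ultimately have "V.subspace {x + y | x y. x \<in> (\<lambda>S. mmul q S F) ` Mat e l1 k1 \<and> y \<in> (\<lambda>S. mmul q' G S) ` Mat e l0 k0}"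
    by (rule V.subspace_sums)
  moreover have "{x + y | x y. x \<in> (\<lambda>S. mmul q S F) ` Mat e l1 k1 \<and> y \<in> (\<lambda>S. mmul q' G S) ` Mat e l0 k0}
      = (\<lambda>(S, S'). mmul q S F + mmul q' G S') ` (Mat e l1 k1 \<times> Mat e l0 k0)" by auto
  ultimately show ?thesis by argo
qed

lemma E_van_iff_image:
  "E_van e k0 k1 l0 l1 F G \<longleftrightarrow>
    Mat e l1 k0 \<subseteq> (\<lambda>(S, S'). mmul (length k1) S F + mmul (length l0) G S') ` (Mat e l1 k1 \<times> Mat e l0 k0)"
  unfolding E_van_def by (auto simp: subset_iff image_iff)

lemma matof_add: "matof e k (f + g) = matof e k f + matof e k (g :: (nat \<Rightarrow> 'a) \<Rightarrow> (nat \<Rightarrow> 'a))"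
  unfolding matof_def by (intro ext) simp

lemma matof_scale: "matof e k (hom_scale sc c f) = vsc (vsc sc) c (matof e k f)"
  unfolding matof_def hom_scale_def vsc_def by (intro ext) (simp add: sc_zero)

text \<open>The map (S, S') \<mapsto> S F + G S' is affine in F, one term being linear in F and the
  other constant, so the openness of surjectivity applies. For \<open>general_E_van_right\<close>
  the two terms exchange roles.\<close>

lemma general_E_van_left:
  assumes l: "set l1 \<subseteq> {..<n}" and k: "set k1 \<subseteq> {..<n}" and G: "G \<in> Mat e l1 l0"
    and f0: "f0 \<in> hom_mod lm (projmod e k1) lm (projmod e k0)" "E_van e k0 k1 l0 l1 (matof e k1 f0) G"
  shows "general (hom_mod lm (projmod e k1) lm (projmod e k0)) (hom_scale sc)
    (\<lambda>f. E_van e k0 k1 l0 l1 (matof e k1 f) G)"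
proof -
  interpret V: vector_space "vsc (vsc sc)" by (rule vector_space_Mat)
  let ?L = "\<lambda>f. \<lambda>(S, S'). mmul (length k1) S (matof e k1 f) + mmul (length l0) G S'"
  show ?thesis unfolding E_van_iff_image
  proof (rule V.general_surjective[OF Mat_fin[OF l] f0(1)])
    show "Mat e l1 k0 \<subseteq> ?L f0 ` (Mat e l1 k1 \<times> Mat e l0 k0)" using f0(2) unfolding E_van_iff_image .
    show "?L f x \<in> Mat e l1 k0" if "f \<in> hom_mod lm (projmod e k1) lm (projmod e k0)" "x \<in> Mat e l1 k1 \<times> Mat e l0 k0" for f x
      using that mmul_in_Mat[OF _ matof_Mat[OF that(1) k], of _ l1] mmul_in_Mat[OF G, of _ k0] V.subspace_add[OF Mat_subspace]
      by auto
    show "V.subspace (?L f ` (Mat e l1 k1 \<times> Mat e l0 k0))" for f by (rule E_van_subspace)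
    fix \<phi> :: "(nat \<Rightarrow> nat \<Rightarrow> 'a) \<Rightarrow> 'k" and x :: "(nat \<Rightarrow> nat \<Rightarrow> 'a) \<times> (nat \<Rightarrow> nat \<Rightarrow> 'a)"
    assume \<phi>: "\<And>y z. \<phi> (y + z) = \<phi> y + \<phi> z" "\<And>c y. \<phi> (vsc (vsc sc) c y) = c * \<phi> y"
    obtain S S' where x: "x = (S, S')" by (cases x)
    show "polyfun (hom_mod lm (projmod e k1) lm (projmod e k0)) (hom_scale sc) (\<lambda>f. \<phi> (?L f x))"
      unfolding x prod.case \<phi>(1)
      by (intro polyfun.padd polyfun.pconst polyfun.plin ballI allI)
        (simp_all only: matof_add matof_scale mmul_add_right mmul_scale_right \<phi>)
  qed
qed

lemma general_E_van_right:
  assumes l: "set l1 \<subseteq> {..<n}" and F: "F \<in> Mat e k1 k0"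
    and g0: "g0 \<in> hom_mod lm (projmod e l1) lm (projmod e l0)" "E_van e k0 k1 l0 l1 F (matof e l1 g0)"
  shows "general (hom_mod lm (projmod e l1) lm (projmod e l0)) (hom_scale sc)
    (\<lambda>g. E_van e k0 k1 l0 l1 F (matof e l1 g))"
proof -
  interpret V: vector_space "vsc (vsc sc)" by (rule vector_space_Mat)
  let ?L = "\<lambda>g. \<lambda>(S, S'). mmul (length k1) S F + mmul (length l0) (matof e l1 g) S'"
  show ?thesis unfolding E_van_iff_image
  proof (rule V.general_surjective[OF Mat_fin[OF l] g0(1)])
    show "Mat e l1 k0 \<subseteq> ?L g0 ` (Mat e l1 k1 \<times> Mat e l0 k0)" using g0(2) unfolding E_van_iff_image .
    show "?L g x \<in> Mat e l1 k0" if "g \<in> hom_mod lm (projmod e l1) lm (projmod e l0)" "x \<in> Mat e l1 k1 \<times> Mat e l0 k0" for g x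
      using that mmul_in_Mat[OF _ F, of _ l1] mmul_in_Mat[OF matof_Mat[OF that(1) l], of _ k0] V.subspace_add[OF Mat_subspace]
      by auto
    show "V.subspace (?L g ` (Mat e l1 k1 \<times> Mat e l0 k0))" for g by (rule E_van_subspace)
    fix \<phi> :: "(nat \<Rightarrow> nat \<Rightarrow> 'a) \<Rightarrow> 'k" and x :: "(nat \<Rightarrow> nat \<Rightarrow> 'a) \<times> (nat \<Rightarrow> nat \<Rightarrow> 'a)"
    assume \<phi>: "\<And>y z. \<phi> (y + z) = \<phi> y + \<phi> z" "\<And>c y. \<phi> (vsc (vsc sc) c y) = c * \<phi> y"
    obtain S S' where x: "x = (S, S')" by (cases x)
    show "polyfun (hom_mod lm (projmod e l1) lm (projmod e l0)) (hom_scale sc) (\<lambda>g. \<phi> (?L g x))"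
      unfolding x prod.case \<phi>(1)
      by (intro polyfun.padd polyfun.pconst polyfun.plin ballI allI)
        (simp_all only: matof_add matof_scale mmul_add_left mmul_scale_left \<phi>)
  qed
qed

lemma HomEta_eq: "HomEta n e \<eta> = hom_mod lm (projmod e (L1 n \<eta>)) lm (projmod e (L0 n \<eta>))"
  unfolding HomEta_def P0_eq P1_eq ..

lemma HomEta_add:
  assumes "f \<in> HomEta n e \<eta>" "g \<in> HomEta n e \<eta>" shows "f + g \<in> HomEta n e \<eta>"
  using assms unfolding HomEta_eq hom_mod_def
  by (auto simp: add_projmod lm_def fun_eq_iff distrib_left add_ac)

lemma HomEta_scale:
  assumes "f \<in> HomEta n e \<eta>" shows "hom_scale sc c f \<in> HomEta n e \<eta>"
proof -
  \<comment> \<open>Scalars are central: as a left multiplication scaling preserves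
    \<open>projmod\<close>, as a right multiplication it commutes with the action.\<close>
  have v: "vsc sc c x = (\<lambda>r. x r * sc c 1)" for x :: "nat \<Rightarrow> 'a" unfolding vsc_def by (subst sc_one(2)) simp
  have p: "vsc sc c x = lm (sc c 1) x" for x :: "nat \<Rightarrow> 'a" unfolding vsc_def lm_def by (subst sc_one(1)) simp
  have "vsc sc c x \<in> projmod e k" if "x \<in> projmod e k" for x k unfolding p by (rule lm_projmod[OF that])
  moreover have "vsc sc c (lm a x) = lm a (vsc sc c x)" for a x unfolding v lm_def by (simp add: mult.assoc)
  moreover have "vsc sc c (x + y) = vsc sc c x + vsc sc c y" "vsc sc c 0 = 0" for x y :: "nat \<Rightarrow> 'a"
    unfolding v by (intro ext, simp add: distrib_right)+
  ultimately show ?thesis using assms unfolding HomEta_eq hom_mod_def hom_scale_def by simp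
qed

lemma general_HomEta_conj:
  assumes "general (HomEta n e \<eta>) (hom_scale sc) P" "general (HomEta n e \<eta>) (hom_scale sc) Q"
  shows "general (HomEta n e \<eta>) (hom_scale sc) (\<lambda>f. P f \<and> Q f)"
proof (rule general_conj[OF inf HomEta_scale HomEta_add _ _ assms])
  interpret V: vector_space "vsc sc" by (rule vector_space_vsc[OF sc_vector_space])
  show "hom_scale sc 0 f = 0" "hom_scale sc 1 f = f" for f
    unfolding hom_scale_def by (intro ext, simp)+
qed

lemma general_True: "general (HomEta n e \<eta>) (hom_scale sc) (\<lambda>_. True)"
proof -
  have "(\<lambda>_. 0) \<in> HomEta n e \<eta>"
    unfolding HomEta_eq hom_mod_def using zero_projmod by (auto simp: lm_def fun_eq_iff)
  then show ?thesis unfolding general_def by (intro exI[of _ "\<lambda>_. 1"]) (auto intro: polyfun.pconst)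
qed

lemma general_HomEta_ball:
  assumes "finite X" "\<And>x. x \<in> X \<Longrightarrow> general (HomEta n e \<eta>) (hom_scale sc) (P x)"
  shows "general (HomEta n e \<eta>) (hom_scale sc) (\<lambda>f. \<forall>x\<in>X. P x f)"
  using assms
proof (induction X rule: finite_induct)
  case empty
  then show ?case using general_True by simp
next
  case (insert x X)
  have "general (HomEta n e \<eta>) (hom_scale sc) (\<lambda>f. P x f \<and> (\<forall>x\<in>X. P x f))"
    using insert by (intro general_HomEta_conj) auto
  then show ?case by simp
qed

abbreviation mat :: "(nat \<Rightarrow> int) \<Rightarrow> ((nat \<Rightarrow> 'a) \<Rightarrow> (nat \<Rightarrow> 'a)) \<Rightarrow> nat \<Rightarrow> nat \<Rightarrow> 'a" where
  "mat \<eta> f \<equiv> matof e (L1 n \<eta>) f"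

text \<open>The order of arguments is that of \<open>E_van\<close>: this is Hom(P_g, P_f[1]) = 0,
  written E(g,f) = 0 in the overview.\<close>

definition E_zero :: "(nat \<Rightarrow> int) \<Rightarrow> (nat \<Rightarrow> int) \<Rightarrow> ((nat \<Rightarrow> 'a) \<Rightarrow> (nat \<Rightarrow> 'a)) \<Rightarrow> ((nat \<Rightarrow> 'a) \<Rightarrow> (nat \<Rightarrow> 'a)) \<Rightarrow> bool" where
  "E_zero \<eta> \<theta> f g \<longleftrightarrow> E_van e (L0 n \<eta>) (L1 n \<eta>) (L0 n \<theta>) (L1 n \<theta>) (mat \<eta> f) (mat \<theta> g)"

lemma mat_Mat: "f \<in> HomEta n e \<eta> \<Longrightarrow> mat \<eta> f \<in> Mat e (L1 n \<eta>) (L0 n \<eta>)"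
  unfolding HomEta_eq by (rule matof_Mat[OF _ set_L(2)])

lemma general_E_zero_left:
  assumes "f \<in> HomEta n e \<eta>" "g \<in> HomEta n e \<theta>" "E_zero \<eta> \<theta> f g"
  shows "general (HomEta n e \<eta>) (hom_scale sc) (\<lambda>f. E_zero \<eta> \<theta> f g)"
  using assms mat_Mat[OF assms(2)] unfolding E_zero_def HomEta_eq by (intro general_E_van_left[OF set_L(2) set_L(2)])

lemma general_E_zero_right:
  assumes "f \<in> HomEta n e \<eta>" "g \<in> HomEta n e \<theta>" "E_zero \<eta> \<theta> f g"
  shows "general (HomEta n e \<theta>) (hom_scale sc) (\<lambda>g. E_zero \<eta> \<theta> f g)"
  using assms mat_Mat[OF assms(1)] unfolding E_zero_def HomEta_eq by (intro general_E_van_right[OF set_L(2)])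

text \<open>Matrices compose in diagrammatic order, so h = g s + s' f becomes S G + F S', and the
  pair enters \<open>E_zero\<close> as g, f.\<close>

lemma E_tame_E_zero:
  assumes "E_tame n e" "\<forall>i\<ge>n. \<theta> i = 0"
  shows "\<exists>f\<in>HomEta n e \<theta>. \<exists>g\<in>HomEta n e \<theta>. E_zero \<theta> \<theta> g f"
proof -
  let ?P0 = "projmod e (L0 n \<theta>)" and ?P1 = "projmod e (L1 n \<theta>)"
  interpret C0: fmod sc n e "vsc sc" lm ?P0 by (rule fmod_projmod)
  from assms(1)[unfolded E_tame_def, rule_format, of \<theta>] assms(2)
  obtain f g where f: "f \<in> HomEta n e \<theta>" and g: "g \<in> HomEta n e \<theta>"
    and E: "\<forall>h\<in>HomEta n e \<theta>. \<exists>s\<in>hom_mod lm ?P1 lm ?P1. \<exists>s'\<in>hom_mod lm ?P0 lm ?P0. h = (g \<circ> s) + (s' \<circ> f)"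
    unfolding P0_eq P1_eq by auto
  have "E_zero \<theta> \<theta> g f" unfolding E_zero_def E_van_def
  proof
    fix M assume M: "M \<in> Mat e (L1 n \<theta>) (L0 n \<theta>)"
    let ?h = "homof lm e (L1 n \<theta>) M"
    have "?h \<in> HomEta n e \<theta>" unfolding HomEta_eq by (rule C0.homof_hom[OF M[unfolded Mat_def]])
    then obtain s s' where s: "s \<in> hom_mod lm ?P1 lm ?P1" "s' \<in> hom_mod lm ?P0 lm ?P0" "?h = (g \<circ> s) + (s' \<circ> f)"
      by (elim bspec[OF E, THEN bexE] bexE)
    have "M = matof e (L1 n \<theta>) ?h" using C0.matof_homof[OF M[unfolded Mat_def] set_L(2)] by simp
    also have "\<dots> = matof e (L1 n \<theta>) (g \<circ> s) + matof e (L1 n \<theta>) (s' \<circ> f)" unfolding s(3) by (rule matof_add)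
    also have "\<dots> = mmul (length (L1 n \<theta>)) (matof e (L1 n \<theta>) s) (mat \<theta> g) + mmul (length (L0 n \<theta>)) (mat \<theta> f) (matof e (L0 n \<theta>) s')"
      using C0.matof_comp[OF s(1) g[unfolded HomEta_eq] set_L(2) set_L(2)]
        C0.matof_comp[OF f[unfolded HomEta_eq] s(2) set_L(2) set_L(1)] by argo
    finally show "\<exists>S\<in>Mat e (L1 n \<theta>) (L1 n \<theta>). \<exists>S'\<in>Mat e (L0 n \<theta>) (L0 n \<theta>).
        M = mmul (length (L1 n \<theta>)) S (mat \<theta> g) + mmul (length (L0 n \<theta>)) (mat \<theta> f) S'"
      using matof_Mat[OF s(1) set_L(2)] matof_Mat[OF s(2) set_L(1)] by blast
  qed
  then show ?thesis using f g by blast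
qed

text \<open>Every member g carries the invariant \<open>?A g\<close>: general f satisfy
  \<open>E_zero\<close> for the pair g, f. Starting from the one pair given by E-tameness,
  \<open>?A\<close> holds for general g. Hence some g satisfies \<open>?A\<close> together with the
  finitely many general conditions imposed by the members already chosen, and it can be
  appended.\<close>

lemma E_tame_ex_chain:
  assumes "E_tame n e" "\<forall>i\<ge>n. \<theta> i = 0"
  shows "\<exists>fs. length fs = m \<and> set fs \<subseteq> HomEta n e \<theta> \<and> sorted_wrt (E_zero \<theta> \<theta>) fs"
proof -
  let ?H = "HomEta n e \<theta>"
  let ?A = "\<lambda>g. general ?H (hom_scale sc) (\<lambda>f. E_zero \<theta> \<theta> g f)"
  obtain f g where "f \<in> ?H" "g \<in> ?H" "E_zero \<theta> \<theta> g f" using E_tame_E_zero[OF assms] by blast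
  note fg = this
  have A: "general ?H (hom_scale sc) ?A"
  proof (rule general_mono[OF general_E_zero_left[OF fg(2,1,3)]])
    show "?A g'" if "g' \<in> ?H" "E_zero \<theta> \<theta> g' f" for g' by (rule general_E_zero_right[OF that(1) fg(1) that(2)])
  qed
  have "\<exists>fs. length fs = m \<and> set fs \<subseteq> ?H \<and> (\<forall>f\<in>set fs. ?A f) \<and> sorted_wrt (E_zero \<theta> \<theta>) fs"
  proof (induction m)
    case (Suc m)
    then obtain fs where fs: "length fs = m" "set fs \<subseteq> ?H" "\<forall>f\<in>set fs. ?A f" "sorted_wrt (E_zero \<theta> \<theta>) fs" by blast
    have "general ?H (hom_scale sc) (\<lambda>g. \<forall>f\<in>set fs. E_zero \<theta> \<theta> f g)"
      using fs(3) by (intro general_HomEta_ball) auto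
    from generalD[OF general_HomEta_conj[OF A this]]
    obtain g where "g \<in> ?H" "?A g" "\<forall>f\<in>set fs. E_zero \<theta> \<theta> f g" by auto
    then show ?case using fs by (intro exI[of _ "fs @ [g]"]) (auto simp: sorted_wrt_append)
  qed simp
  then show ?thesis by blast
qed

end

subsection \<open>Rational polyhedral cones\<close>

definition cone_of :: "(nat \<Rightarrow> int) set \<Rightarrow> (nat \<Rightarrow> real) set" where
  "cone_of G = {\<theta>. \<exists>c::(nat \<Rightarrow> int) \<Rightarrow> real. (\<forall>v\<in>G. 0 \<le> c v) \<and> \<theta> = (\<lambda>i. \<Sum>v\<in>G. c v * real_of_int (v i))}"

definition halfspaces :: "nat \<Rightarrow> (nat \<Rightarrow> int) set \<Rightarrow> (nat \<Rightarrow> real) set" where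
  "halfspaces n T = {\<theta>. (\<forall>i\<ge>n. \<theta> i = 0) \<and> (\<forall>d\<in>T. 0 \<le> (\<Sum>i<n. \<theta> i * real_of_int (d i)))}"

lemma rat_poly_cone_iff:
  "rat_poly_cone n C \<longleftrightarrow> (\<exists>G. finite G \<and> (\<forall>v\<in>G. \<forall>i\<ge>n. v i = 0) \<and> C = cone_of G)"
  unfolding rat_poly_cone_def cone_of_def ..

lemma cone_of_generator:
  assumes "finite G" "v \<in> G"
  shows "(\<lambda>i. real_of_int (v i)) \<in> cone_of G"
  unfolding cone_of_def
proof (intro CollectI exI[of _ "\<lambda>w. if w = v then 1 else 0"] conjI ballI ext)
  fix i
  have "(\<Sum>w\<in>G. (if w = v then 1 else 0) * real_of_int (w i)) = (\<Sum>w\<in>G. if w = v then real_of_int (v i) else 0)"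
    by (intro sum.cong) auto
  then show "real_of_int (v i) = (\<Sum>w\<in>G. (if w = v then 1 else 0) * real_of_int (w i))"
    using assms by simp
qed simp

lemma cone_of_zero: "(\<lambda>_. 0) \<in> cone_of G"
  unfolding cone_of_def by (intro CollectI exI[of _ "\<lambda>_. 0"]) simp

lemma cone_of_add:
  assumes "x \<in> cone_of G" "y \<in> cone_of G"
  shows "(\<lambda>i. x i + y i) \<in> cone_of G"
proof -
  obtain c d where "\<forall>v\<in>G. 0 \<le> c v" "x = (\<lambda>i. \<Sum>v\<in>G. c v * real_of_int (v i))"
    "\<forall>v\<in>G. 0 \<le> d v" "y = (\<lambda>i. \<Sum>v\<in>G. d v * real_of_int (v i))"
    using assms unfolding cone_of_def by blast
  then show ?thesis unfolding cone_of_def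
    by (intro CollectI exI[of _ "\<lambda>v. c v + d v"]) (simp add: distrib_right sum.distrib)
qed

lemma cone_of_scale:
  assumes "x \<in> cone_of G" "0 \<le> a"
  shows "(\<lambda>i. a * x i) \<in> cone_of G"
proof -
  obtain c where "\<forall>v\<in>G. 0 \<le> c v" "x = (\<lambda>i. \<Sum>v\<in>G. c v * real_of_int (v i))"
    using assms unfolding cone_of_def by blast
  then show ?thesis unfolding cone_of_def using assms(2)
    by (intro CollectI exI[of _ "\<lambda>v. a * c v"]) (simp add: sum_distrib_left mult.assoc)
qed

lemma cone_of_sum:
  assumes "\<And>j. j \<in> J \<Longrightarrow> x j \<in> cone_of G" "\<And>j. j \<in> J \<Longrightarrow> 0 \<le> a j"
  shows "(\<lambda>i. \<Sum>j\<in>J. a j * x j i) \<in> cone_of G"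
  using assms
proof (induction J rule: infinite_finite_induct)
  case (insert j J)
  have "(\<lambda>i. a j * x j i + (\<Sum>j\<in>J. a j * x j i)) \<in> cone_of G"
    by (rule cone_of_add[OF cone_of_scale]) (use insert in auto)
  then show ?case using insert.hyps by simp
qed (simp_all add: cone_of_zero)

lemma halfspaces_cone:
  assumes "\<And>v. v \<in> G \<Longrightarrow> (\<lambda>i. real_of_int (v i)) \<in> halfspaces n T"
  shows "cone_of G \<subseteq> halfspaces n T"
proof
  fix x assume "x \<in> cone_of G"
  then obtain c where c: "\<And>v. v \<in> G \<Longrightarrow> 0 \<le> c v" and x: "x = (\<lambda>i. \<Sum>v\<in>G. c v * real_of_int (v i))"
    unfolding cone_of_def by blast
  show "x \<in> halfspaces n T" unfolding halfspaces_def
  proof (intro CollectI conjI allI impI ballI)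
    fix i assume "n \<le> i"
    then show "x i = 0" using assms unfolding x halfspaces_def by (auto intro!: sum.neutral)
  next
    fix d assume d: "d \<in> T"
    have "(\<Sum>i<n. x i * real_of_int (d i)) = (\<Sum>v\<in>G. c v * (\<Sum>i<n. real_of_int (v i) * real_of_int (d i)))"
      unfolding x sum_distrib_right sum_distrib_left by (subst sum.swap) (simp add: mult.assoc)
    also have "\<dots> \<ge> 0"
      by (rule sum_nonneg, rule mult_nonneg_nonneg[OF c]) (use assms d in \<open>auto simp: halfspaces_def\<close>)
    finally show "0 \<le> (\<Sum>i<n. x i * real_of_int (d i))" .
  qed
qed

text \<open>The double description step: new generators are the old ones on the nonnegative side and the
  intersections of the hyperplane with the planes spanned by a positive and a negative generator.\<close>

lemma cone_of_halfspace:
  fixes d :: "nat \<Rightarrow> int"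
  assumes G: "finite G" "\<forall>v\<in>G. \<forall>i\<ge>n. v i = 0"
  shows "rat_poly_cone n {x\<in>cone_of G. 0 \<le> (\<Sum>i<n. x i * real_of_int (d i))}"
proof -
  define dz where "dz v = (\<Sum>i<n. v i * d i)" for v
  define P where "P = {g\<in>G. dz g > 0}"
  define N where "N = {g\<in>G. dz g < 0}"
  define Z where "Z = {g\<in>G. dz g = 0}"
  \<comment> \<open>The combination of g and h on which the inequality is an equality; its
    coefficients dz g and - dz h are positive for g in P and h in N.\<close>
  define mk where "mk = (\<lambda>(g, h). (\<lambda>i. dz g * h i - dz h * g i))"
  define G' where "G' = Z \<union> P \<union> mk ` (P \<times> N)"
  have fin: "finite P" "finite N" "finite Z" using G(1) unfolding P_def N_def Z_def by auto
  have finG': "finite G'" unfolding G'_def using fin by auto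
  have mk_real: "real_of_int (mk (g, h) i) = real_of_int (dz g) * real_of_int (h i) - real_of_int (dz h) * real_of_int (g i)"
    for g h i unfolding mk_def by simp
  have dz_real: "real_of_int (dz v) = (\<Sum>i<n. real_of_int (v i) * real_of_int (d i))" for v
    unfolding dz_def by simp
  have "cone_of G' = {x\<in>cone_of G. 0 \<le> (\<Sum>i<n. x i * real_of_int (d i))}"
  proof (intro equalityI subsetI)
    fix x assume "x \<in> cone_of G'"
    then obtain c where c: "\<And>v. v \<in> G' \<Longrightarrow> 0 \<le> c v" and x: "x = (\<lambda>i. \<Sum>v\<in>G'. c v * real_of_int (v i))"
      unfolding cone_of_def by blast
    have gen: "(\<lambda>i. real_of_int (v i)) \<in> cone_of G \<and> 0 \<le> dz v" if "v \<in> G'" for v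
    proof -
      from that consider "v \<in> Z \<union> P" | g h where "g \<in> P" "h \<in> N" "v = mk (g, h)" unfolding G'_def by blast
      then show ?thesis
      proof cases
        case 1
        then show ?thesis using cone_of_generator[OF G(1)] unfolding Z_def P_def by auto
      next
        case 2
        have gh: "g \<in> G" "h \<in> G" "dz g > 0" "dz h < 0" using 2 unfolding P_def N_def by auto
        have "(\<lambda>i. real_of_int (dz g) * real_of_int (h i) + real_of_int (- dz h) * real_of_int (g i)) \<in> cone_of G"
          using gh by (intro cone_of_add cone_of_scale cone_of_generator[OF G(1)]) auto
        moreover have "dz v = 0" unfolding 2(3) mk_def dz_def[of "case _ of _ \<Rightarrow> _"] prod.case
          by (simp add: left_diff_distrib sum_subtractf mult.assoc sum_distrib_left[symmetric] dz_def[symmetric])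
        ultimately show ?thesis unfolding 2(3) mk_real by simp
      qed
    qed
    have "x \<in> cone_of G" unfolding x by (rule cone_of_sum) (use gen c in auto)
    moreover have "(\<Sum>i<n. x i * real_of_int (d i)) = (\<Sum>v\<in>G'. c v * real_of_int (dz v))"
      unfolding x dz_real sum_distrib_right sum_distrib_left by (subst sum.swap) (simp add: mult.assoc)
    moreover have "\<dots> \<ge> 0" using gen c by (intro sum_nonneg mult_nonneg_nonneg) auto
    ultimately show "x \<in> {x\<in>cone_of G. 0 \<le> (\<Sum>i<n. x i * real_of_int (d i))}" by simp
  next
    fix x assume "x \<in> {x\<in>cone_of G. 0 \<le> (\<Sum>i<n. x i * real_of_int (d i))}"
    then obtain c where c: "\<And>v. v \<in> G \<Longrightarrow> 0 \<le> c v" and x: "x = (\<lambda>i. \<Sum>v\<in>G. c v * real_of_int (v i))"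
      and pos: "0 \<le> (\<Sum>i<n. x i * real_of_int (d i))"
      unfolding cone_of_def by blast
    have split: "(\<Sum>v\<in>G. F v) = (\<Sum>v\<in>Z. F v) + (\<Sum>v\<in>P. F v) + (\<Sum>v\<in>N. F v)" for F :: "_ \<Rightarrow> real"
    proof -
      have "G = Z \<union> (P \<union> N)" unfolding Z_def P_def N_def by auto
      moreover have "Z \<inter> (P \<union> N) = {}" "P \<inter> N = {}" unfolding Z_def P_def N_def by auto
      ultimately show ?thesis using fin sum.union_disjoint[of Z "P \<union> N" F] sum.union_disjoint[of P N F] by auto
    qed
    \<comment> \<open>\<open>p\<close> and \<open>m\<close> are the contributions of the positive
      and the negative generators to the inequality, which now reads m \<le> p.\<close>
    define p where "p = (\<Sum>g\<in>P. c g * real_of_int (dz g))"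
    define m where "m = (\<Sum>h\<in>N. c h * real_of_int (- dz h))"
    have cP: "0 \<le> c g" "g \<in> G" if "g \<in> P" for g using c that unfolding P_def by auto
    have cN: "0 \<le> c g" if "g \<in> N" for g using c that unfolding N_def by auto
    have cZ: "0 \<le> c g" if "g \<in> Z" for g using c that unfolding Z_def by auto
    have m0: "0 \<le> m" unfolding m_def by (rule sum_nonneg, rule mult_nonneg_nonneg[OF cN]) (simp_all add: N_def)
    have p0: "0 \<le> p" unfolding p_def by (rule sum_nonneg, rule mult_nonneg_nonneg[OF cP(1)]) (simp_all add: P_def)
    have "(\<Sum>i<n. x i * real_of_int (d i)) = (\<Sum>v\<in>G. c v * real_of_int (dz v))"
      unfolding x dz_real sum_distrib_right sum_distrib_left by (subst sum.swap) (simp only: mult.assoc)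
    also have "\<dots> = p - m"
      unfolding split[of "\<lambda>v. c v * real_of_int (dz v)"] p_def m_def by (simp add: Z_def sum_negf)
    finally have mp: "m \<le> p" using pos by simp
    have ZG': "v \<in> Z \<Longrightarrow> (\<lambda>i. real_of_int (v i)) \<in> cone_of G'" "v \<in> P \<Longrightarrow> (\<lambda>i. real_of_int (v i)) \<in> cone_of G'" for v
      by (rule cone_of_generator[OF finG'], simp add: G'_def)+
    have Zin: "(\<lambda>i. \<Sum>v\<in>Z. c v * real_of_int (v i)) \<in> cone_of G'" using ZG' cZ by (intro cone_of_sum) auto
    have "(\<lambda>i. (\<Sum>v\<in>P. c v * real_of_int (v i)) + (\<Sum>v\<in>N. c v * real_of_int (v i))) \<in> cone_of G'"
    proof (cases "p = 0")
      case True
      then have "m = 0" using mp m0 by simp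
      then have "\<forall>h\<in>N. c h * real_of_int (- dz h) = 0"
        unfolding m_def using cN by (subst (asm) sum_nonneg_eq_0_iff[OF fin(2)]) (auto simp: N_def mult_nonneg_nonpos)
      then have "\<forall>h\<in>N. c h = 0" unfolding N_def by auto
      then have "(\<lambda>i. (\<Sum>v\<in>P. c v * real_of_int (v i)) + (\<Sum>v\<in>N. c v * real_of_int (v i))) = (\<lambda>i. \<Sum>v\<in>P. c v * real_of_int (v i))"
        by simp
      moreover have "\<dots> \<in> cone_of G'" using ZG' cP by (intro cone_of_sum) auto
      ultimately show ?thesis by simp
    next
      case False
      then have pp: "p > 0" using p0 by simp
      \<comment> \<open>Each negative generator is spread over all positive ones in proportion to
        their share of p. Summing over P recovers every h with its coefficient and uses up the
        fraction m/p of every g; the rest 1 - m/p is supplied by the second sum.\<close>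
      have 1: "(\<lambda>i. \<Sum>q\<in>P \<times> N. (c (fst q) * c (snd q) / p) * real_of_int (mk q i)) \<in> cone_of G'"
      proof (rule cone_of_sum)
        show "(\<lambda>i. real_of_int (mk q i)) \<in> cone_of G'" if "q \<in> P \<times> N" for q
          by (rule cone_of_generator[OF finG']) (use that in \<open>simp add: G'_def\<close>)
        show "0 \<le> c (fst q) * c (snd q) / p" if "q \<in> P \<times> N" for q
          using that cP(1) cN pp by auto
      qed
      have 2: "(\<lambda>i. \<Sum>g\<in>P. (c g * (1 - m / p)) * real_of_int (g i)) \<in> cone_of G'"
        using ZG' cP(1) mp pp by (intro cone_of_sum mult_nonneg_nonneg) auto
      have "(\<Sum>q\<in>P \<times> N. (c (fst q) * c (snd q) / p) * real_of_int (mk q i)) + (\<Sum>g\<in>P. (c g * (1 - m / p)) * real_of_int (g i))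
        = (\<Sum>v\<in>P. c v * real_of_int (v i)) + (\<Sum>v\<in>N. c v * real_of_int (v i))" for i
      proof -
        have "(\<Sum>q\<in>P \<times> N. (c (fst q) * c (snd q) / p) * real_of_int (mk q i))
          = (\<Sum>g\<in>P. \<Sum>h\<in>N. (c g * c h / p) * real_of_int (mk (g, h) i))"
          by (subst sum.cartesian_product) (simp add: case_prod_beta)
        also have "\<dots> = (\<Sum>g\<in>P. \<Sum>h\<in>N. (c g * real_of_int (dz g)) * (c h * real_of_int (h i) / p)
            + (c g * real_of_int (g i) / p) * (c h * real_of_int (- dz h)))"
          unfolding mk_real by (intro sum.cong refl) (simp add: algebra_simps diff_divide_distrib)
        also have "\<dots> = (\<Sum>g\<in>P. c g * real_of_int (dz g)) * (\<Sum>h\<in>N. c h * real_of_int (h i) / p)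
            + (\<Sum>g\<in>P. c g * real_of_int (g i) / p) * m"
          unfolding m_def sum_product by (simp only: sum.distrib)
        also have "\<dots> = (\<Sum>h\<in>N. c h * real_of_int (h i)) + (\<Sum>g\<in>P. c g * real_of_int (g i)) * (m / p)"
          unfolding p_def[symmetric] sum_divide_distrib[symmetric] using pp by simp
        finally have "(\<Sum>q\<in>P \<times> N. (c (fst q) * c (snd q) / p) * real_of_int (mk q i)) = \<dots>" .
        moreover have "(\<Sum>g\<in>P. (c g * (1 - m / p)) * real_of_int (g i)) = (\<Sum>g\<in>P. c g * real_of_int (g i)) * (1 - m / p)"
          unfolding sum_distrib_right by (intro sum.cong) (auto simp: algebra_simps)
        ultimately show ?thesis by (simp add: algebra_simps)
      qed
      then show ?thesis using cone_of_add[OF 1 2] by simp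
    qed
    from cone_of_add[OF Zin this] show "x \<in> cone_of G'" unfolding x
      by (subst split) (simp only: add.assoc)
  qed
  moreover have "\<forall>v\<in>G'. \<forall>i\<ge>n. v i = 0"
  proof (intro ballI allI impI)
    fix v i assume "v \<in> G'" and i: "n \<le> i"
    then consider "v \<in> G" | g h where "g \<in> G" "h \<in> G" "v = mk (g, h)"
      unfolding G'_def Z_def P_def N_def by blast
    then show "v i = 0"
    proof cases
      case 1
      then show ?thesis using G(2) i by blast
    next
      case 2
      have "g i = 0" "h i = 0" using G(2) 2(1,2) i by blast+
      then show ?thesis unfolding 2(3) mk_def by simp
    qed
  qed
  ultimately show ?thesis unfolding rat_poly_cone_iff using finG' by metis
qed

lemma rat_poly_cone_halfspaces:
  assumes "finite T"
  shows "rat_poly_cone n (halfspaces n T)"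
  using assms
proof (induction T rule: finite_induct)
  case empty
  \<comment> \<open>The vectors \<plusminus>1 times a unit vector: without inequalities the cone is
    the whole coordinate space.\<close>
  define u :: "nat \<times> int \<Rightarrow> nat \<Rightarrow> int" where "u = (\<lambda>(i, a) j. if j = i then a else 0)"
  let ?G = "u ` ({..<n} \<times> {1, -1})"
  have fin: "finite ?G" by auto
  have "halfspaces n {} = cone_of ?G"
  proof (intro equalityI subsetI)
    fix x :: "nat \<Rightarrow> real" assume "x \<in> halfspaces n {}"
    then have x: "\<And>i. i \<ge> n \<Longrightarrow> x i = 0" unfolding halfspaces_def by auto
    \<comment> \<open>All of |x_j| goes to the vector whose sign agrees with x_j. At x_j = 0 both
      signs qualify, and both get 0.\<close>
    define c where "c = (\<lambda>(j, a :: int). if 0 \<le> real_of_int a * x j then \<bar>x j\<bar> else 0)"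
    have "(\<lambda>i. \<Sum>q\<in>{..<n} \<times> {1, -1}. c q * real_of_int (u q i)) \<in> cone_of ?G"
    proof (rule cone_of_sum)
      show "(\<lambda>i. real_of_int (u q i)) \<in> cone_of ?G" if "q \<in> {..<n} \<times> {1, -1}" for q
        by (rule cone_of_generator[OF fin]) (use that in blast)
    qed (auto simp: c_def)
    moreover have "(\<Sum>q\<in>{..<n} \<times> {1, -1}. c q * real_of_int (u q i)) = x i" for i
    proof -
      have "(\<Sum>q\<in>{..<n} \<times> {1, -1}. c q * real_of_int (u q i))
        = (\<Sum>j<n. \<Sum>a\<in>{1, -1}. c (j, a) * real_of_int (u (j, a) i))"
        unfolding sum.cartesian_product by (intro sum.cong refl) auto
      also have "\<dots> = (\<Sum>j<n. if j = i then x i else 0)"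
        by (intro sum.cong refl) (auto simp: u_def c_def)
      also have "\<dots> = x i" using x[of i] by (auto simp: not_less)
      finally show ?thesis .
    qed
    ultimately show "x \<in> cone_of ?G" by simp
  next
    fix x assume "x \<in> cone_of ?G"
    moreover have "cone_of ?G \<subseteq> halfspaces n {}"
      by (rule halfspaces_cone) (auto simp: halfspaces_def u_def)
    ultimately show "x \<in> halfspaces n {}" by blast
  qed
  then show ?case unfolding rat_poly_cone_iff using fin by (intro exI[of _ ?G]) (auto simp: u_def)
next
  case (insert d T)
  then obtain G where G: "finite G" "\<forall>v\<in>G. \<forall>i\<ge>n. v i = 0" "halfspaces n T = cone_of G"
    unfolding rat_poly_cone_iff by blast
  have "halfspaces n (insert d T) = {x\<in>cone_of G. 0 \<le> (\<Sum>i<n. x i * real_of_int (d i))}"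
    unfolding G(3)[symmetric] halfspaces_def by auto
  then show ?case using cone_of_halfspace[OF G(1,2)] by simp
qed

subsection \<open>The cones of presentations\<close>

lemma sorted_wrt_map_mem:
  "sorted_wrt R fs \<Longrightarrow> (\<And>f g. R f g \<Longrightarrow> R' (h f) (h g)) \<Longrightarrow> sorted_wrt R' (map h fs)"
  by (induction fs) auto

context fmod
begin

lemma act_image_subspace:
  assumes V: "submod act W V"
  shows "subspace (act a ` V)"
proof -
  interpret SS: vector_space_pair s s by unfold_locales
  show ?thesis
    by (rule SS.subspace_image_on[OF submod_subspace[OF V]]) (use submod_sub[OF V] act_add act_s in blast)+
qed

lemma dim_act_image_le:
  assumes V: "submod act W V"
  shows "dim (act a ` V) \<le> dim W"
  using submod_act[OF V] submod_sub[OF V] by (intro dim_mono_fin[OF W act_image_subspace[OF V]]) blast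

lemma dim_zero_set: "dim {0} = 0"
  by (rule trans[OF dim_span[of "{}", unfolded span_empty] dim_eq_card_independent[OF independent_empty, unfolded card.empty]])

lemma submod_zero: "submod act W {0}"
  unfolding submod_def using zero_W act_zero by auto

lemma inF_zero_iff:
  "inF n e s act \<theta> W {0} \<longleftrightarrow> (\<forall>V. submod act W V \<longrightarrow> tval n e s act \<theta> V \<le> 0)"
proof -
  have "tval n e s act \<theta> {0} = 0" unfolding tval_def by (simp add: act_zero dim_zero_set)
  then show ?thesis unfolding inF_def using submod_0 by auto
qed

text \<open>\<open>TF_equiv\<close> tests subquotients of A^q, while K_\<nu>f consists of
  functionals. A finite spanning list of W defines a surjection from A^q onto W with kernel U, and
  submodules of A^q above U correspond to submodules of W. One choice of q and U serves every
  \<theta>.\<close>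

lemma inF_transport:
  "\<exists>q U. submod lm (Aq q) U \<and> (\<forall>\<theta>. inF n e (vsc sc) lm \<theta> (Aq q) U \<longleftrightarrow> inF n e s act \<theta> W {0})"
proof -
  obtain B where B: "finite B" "B \<subseteq> W" "span B = W" using fin_subspace_basis[OF W] by metis
  obtain xs where xs: "set xs = B" using finite_list[OF B(1)] by blast
  define q where "q = length xs"
  interpret A: fmod sc n e "vsc sc" lm "Aq q" by (rule fmod_Aq)
  interpret AS: vector_space_pair "vsc sc" s by unfold_locales
  define \<pi> where "\<pi> x = (\<Sum>j<q. act (x j) (xs ! j))" for x
  have xW: "xs ! j \<in> W" if "j < q" for j using that B(2) xs unfolding q_def by (metis nth_mem subsetD)
  have \<pi>_W: "\<pi> x \<in> W" for x unfolding \<pi>_def using xW act_in by (intro subspace_sum[OF subspace_W]) auto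
  have \<pi>_add: "\<pi> (x + y) = \<pi> x + \<pi> y" for x y
    unfolding \<pi>_def using xW by (simp add: act_plus sum.distrib)
  have \<pi>_lm: "\<pi> (lm a x) = act a (\<pi> x)" for a x
  proof -
    have "act a (\<pi> x) = (\<Sum>j<q. act a (act (x j) (xs ! j)))"
      unfolding \<pi>_def by (rule act_sum) (use xW act_in in auto)
    also have "\<dots> = \<pi> (lm a x)" unfolding \<pi>_def lm_def using xW by (intro sum.cong) (auto simp: act_mult)
    finally show ?thesis by simp
  qed
  have \<pi>_vsc: "\<pi> (vsc sc c x) = s c (\<pi> x)" for c x
  proof -
    have "vsc sc c x = lm (sc c 1) x" unfolding vsc_def lm_def by (subst sc_one(1)) simp
    then show ?thesis using \<pi>_lm act_scale[OF \<pi>_W] by simp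
  qed
  have \<pi>_zero: "\<pi> 0 = 0" using \<pi>_lm[of 0 0] act_zero_left[OF \<pi>_W] by (simp add: lm_def zero_fun_def)
  have surj: "\<exists>x\<in>Aq q. \<pi> x = w" if "w \<in> W" for w
  proof -
    have "B = (!) xs ` {..<q}" unfolding xs[symmetric] q_def by (auto simp: set_conv_nth)
    then have "w \<in> span ((!) xs ` {..<q})" using that B(3) by blast
    then obtain c where c: "w = (\<Sum>j<q. s (c j) (xs ! j))"
      using span_image_sum[OF finite_lessThan] by blast
    have "\<pi> (\<lambda>j. if j < q then sc (c j) 1 else 0) = w"
      unfolding \<pi>_def c using xW by (intro sum.cong) (auto simp: act_sc act_one)
    moreover have "(\<lambda>j. if j < q then sc (c j) 1 else 0) \<in> Aq q" unfolding Aq_def by simp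
    ultimately show ?thesis by blast
  qed
  define U where "U = {x\<in>Aq q. \<pi> x = 0}"
  have pre: "submod lm (Aq q) {x\<in>Aq q. \<pi> x \<in> V}" if V: "submod act W V" for V
    unfolding submod_def using A.zero_W A.act_in A.subspace_add[OF A.subspace_W] submod_act[OF V] submod_add[OF V] submod_0[OF V]
    by (auto simp: \<pi>_zero \<pi>_lm \<pi>_add simp del: plus_fun_apply)
  have U: "submod lm (Aq q) U" using pre[OF submod_zero] unfolding U_def by simp
  have img: "submod act W (\<pi> ` V)" if V: "submod lm (Aq q) V" for V
    unfolding submod_def
  proof (intro conjI ballI allI)
    show "\<pi> ` V \<subseteq> W" using \<pi>_W by blast
    show "0 \<in> \<pi> ` V" using A.submod_0[OF V] \<pi>_zero by (metis imageI)
    show "x + y \<in> \<pi> ` V" if xy: "x \<in> \<pi> ` V" "y \<in> \<pi> ` V" for x y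
    proof -
      obtain v w where "v \<in> V" "w \<in> V" "x = \<pi> v" "y = \<pi> w" using xy by blast
      then show ?thesis using A.submod_add[OF V] \<pi>_add by (metis imageI)
    qed
    show "act a x \<in> \<pi> ` V" if x: "x \<in> \<pi> ` V" for a x
    proof -
      obtain v where "v \<in> V" "x = \<pi> v" using x by blast
      then show ?thesis using A.submod_act[OF V] \<pi>_lm by (metis imageI)
    qed
  qed
  \<comment> \<open>Rank-nullity for \<pi> on each e_i V, where the kernel is e_i U: \<pi>
    identifies the dimension vector of V/U with that of \<pi>(V).\<close>
  have tv: "tval n e (vsc sc) lm \<theta> V - tval n e (vsc sc) lm \<theta> U = tval n e s act \<theta> (\<pi> ` V)"
    if V: "submod lm (Aq q) V" "U \<subseteq> V" for V \<theta>
  proof -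
    have "A.dim (lm (e i) ` V) = A.dim (lm (e i) ` U) + dim (act (e i) ` \<pi> ` V)" if i: "i < n" for i
    proof -
      have fin: "fin_subspace (vsc sc) (lm (e i) ` V)"
        using A.fin_subspace_mono[OF A.W A.act_image_subspace[OF V(1)]] A.submod_act[OF V(1)] A.submod_sub[OF V(1)] by blast
      have "A.dim (lm (e i) ` V) = A.dim {x\<in>lm (e i) ` V. \<pi> x = 0} + dim (\<pi> ` lm (e i) ` V)"
        by (rule AS.rank_nullity[OF fin]) (rule \<pi>_add \<pi>_vsc)+
      moreover have "{x\<in>lm (e i) ` V. \<pi> x = 0} = lm (e i) ` U"
        unfolding A.act_image[OF V(1) i] A.act_image[OF U i] using V(2) A.submod_sub[OF V(1)] unfolding U_def by blast
      moreover have "\<pi> ` lm (e i) ` V = act (e i) ` \<pi> ` V" unfolding image_image \<pi>_lm ..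
      ultimately show ?thesis by simp
    qed
    then show ?thesis unfolding tval_def sum_subtractf[symmetric] by (intro sum.cong) (auto simp: algebra_simps)
  qed
  show ?thesis
  proof (intro exI conjI allI)
    show "submod lm (Aq q) U" by (rule U)
    fix \<theta>
    show "inF n e (vsc sc) lm \<theta> (Aq q) U \<longleftrightarrow> inF n e s act \<theta> W {0}"
      unfolding inF_zero_iff
    proof
      assume F: "inF n e (vsc sc) lm \<theta> (Aq q) U"
      show "\<forall>V. submod act W V \<longrightarrow> tval n e s act \<theta> V \<le> 0"
      proof (intro allI impI)
        fix V assume V: "submod act W V"
        let ?V = "{x\<in>Aq q. \<pi> x \<in> V}"
        have UV: "U \<subseteq> ?V" unfolding U_def using submod_0[OF V] by auto
        have "V \<subseteq> \<pi> ` ?V"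
        proof
          fix v assume v: "v \<in> V"
          then obtain x where "x \<in> Aq q" "\<pi> x = v" using surj submod_sub[OF V] by blast
          then show "v \<in> \<pi> ` ?V" using v by blast
        qed
        then have im: "\<pi> ` ?V = V" by blast
        show "tval n e s act \<theta> V \<le> 0"
          using F[unfolded inF_def, rule_format, OF conjI[OF pre[OF V] UV]] unfolding tv[OF pre[OF V] UV] im .
      qed
    next
      assume "\<forall>V. submod act W V \<longrightarrow> tval n e s act \<theta> V \<le> 0"
      then show "inF n e (vsc sc) lm \<theta> (Aq q) U" unfolding inF_def using tv img by simp
    qed
  qed
qed

end

section \<open>Membership in D_f, openness and TF equivalence\<close>

context idem_algebra
begin

lemma Df_iff:
  assumes f: "f \<in> HomEta n e \<eta>"
  shows "\<theta> \<in> Df n e sc \<eta> f \<longleftrightarrow> (\<forall>i\<ge>n. \<theta> i = 0)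
    \<and> inT n e (vsc sc) lm \<theta> (projmod e (L0 n \<eta>)) (f ` projmod e (L1 n \<eta>))
    \<and> inF n e dual_scale (dual_act (homA (projmod e (L1 n \<eta>)))) \<theta> (Ker_nu (L0 n \<eta>) (L1 n \<eta>) f) {0}"
  unfolding Df_def P0_eq P1_eq Knuf_eq by simp

text \<open>The first vanishing is surjectivity on C_f, the second gives injectivity on K_\<nu>f;
  both are for the same g in Hom(\<zeta>).\<close>

lemma E_zero_imp_Df:
  assumes f: "f \<in> HomEta n e \<eta>" and g: "g \<in> HomEta n e \<zeta>" and \<zeta>: "\<forall>i\<ge>n. \<zeta> i = 0"
    and E: "E_zero \<eta> \<zeta> f g" "E_zero \<zeta> \<eta> g f"
  shows "(\<lambda>i. real_of_int (\<zeta> i)) \<in> Df n e sc \<eta> f"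
proof -
  let ?k0 = "L0 n \<eta>" and ?k1 = "L1 n \<eta>" and ?M = "homA (projmod e (L1 n \<eta>))"
  have fh: "f \<in> hom_mod lm (projmod e ?k1) lm (projmod e ?k0)" using f unfolding HomEta_eq .
  interpret C: fmod sc n e "vsc sc" lm "projmod e ?k0" by (rule fmod_projmod)
  interpret K: fmod sc n e dual_scale "dual_act ?M" "Ker_nu ?k0 ?k1 f" by (rule fmod_Ker_nu[OF fh set_L(2)])
  have "C.surj_mod (L1 n \<zeta>) (L0 n \<zeta>) (mat \<zeta> g) (f ` projmod e ?k1)"
    using E(1) unfolding E_zero_def surj_mod_coker_iff[OF fh set_L(2) set_L(2)] .
  then have "inT n e (vsc sc) lm (\<lambda>i. real_of_int (\<zeta> i)) (projmod e ?k0) (f ` projmod e ?k1)"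
    by (rule C.surj_mod_inT[OF mat_Mat[OF g]])
  moreover have "K.inj_mod (L1 n \<zeta>) (L0 n \<zeta>) (mat \<zeta> g) {0}"
    using E(2) unfolding E_zero_def by (rule E_van_imp_inj_mod[OF fh set_L(2) set_L(1) set_L(1)])
  then have "inF n e dual_scale (dual_act ?M) (\<lambda>i. real_of_int (\<zeta> i)) (Ker_nu ?k0 ?k1 f) {0}"
    by (rule K.inj_mod_inF[OF K.submod_zero mat_Mat[OF g]])
  ultimately show ?thesis unfolding Df_iff[OF f] using \<zeta> by simp
qed

lemma chain_mat:
  assumes "E_tame n e" "\<forall>i\<ge>n. \<zeta> i = 0"
  obtains fs where "length fs = m" "set fs \<subseteq> HomEta n e \<zeta>"
    "set (map (mat \<zeta>) fs) \<subseteq> Mat e (L1 n \<zeta>) (L0 n \<zeta>)"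
    "sorted_wrt (E_van e (L0 n \<zeta>) (L1 n \<zeta>) (L0 n \<zeta>) (L1 n \<zeta>)) (map (mat \<zeta>) fs)"
proof -
  obtain fs where fs: "length fs = m" "set fs \<subseteq> HomEta n e \<zeta>" "sorted_wrt (E_zero \<zeta> \<zeta>) fs"
    using E_tame_ex_chain[OF assms] by blast
  moreover have "set (map (mat \<zeta>) fs) \<subseteq> Mat e (L1 n \<zeta>) (L0 n \<zeta>)" using fs(2) mat_Mat by auto
  moreover have "sorted_wrt (E_van e (L0 n \<zeta>) (L1 n \<zeta>) (L0 n \<zeta>) (L1 n \<zeta>)) (map (mat \<zeta>) fs)"
    using fs(3) by (rule sorted_wrt_map_mem) (simp add: E_zero_def)
  ultimately show thesis using that by blast
qed

text \<open>The chains for C_f and for K_\<nu>f yield two possibly different presentations in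
  Hom(\<zeta>). Each shows that its vanishing condition holds generally, so a general presentation
  satisfies both.\<close>

lemma inT_inF_imp_E_zero:
  assumes tame: "E_tame n e" and f: "f \<in> HomEta n e \<eta>" and \<zeta>: "\<forall>i\<ge>n. \<zeta> i = 0"
    and T: "inT n e (vsc sc) lm (\<lambda>i. real_of_int (\<zeta> i)) (projmod e (L0 n \<eta>)) (f ` projmod e (L1 n \<eta>))"
    and F: "inF n e dual_scale (dual_act (homA (projmod e (L1 n \<eta>)))) (\<lambda>i. real_of_int (\<zeta> i)) (Ker_nu (L0 n \<eta>) (L1 n \<eta>) f) {0}"
  shows "\<exists>g\<in>HomEta n e \<zeta>. E_zero \<eta> \<zeta> f g \<and> E_zero \<zeta> \<eta> g f"
proof -
  let ?k0 = "L0 n \<eta>" and ?k1 = "L1 n \<eta>" and ?M = "homA (projmod e (L1 n \<eta>))"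
  have fh: "f \<in> hom_mod lm (projmod e ?k1) lm (projmod e ?k0)" using f unfolding HomEta_eq .
  interpret C: fmod sc n e "vsc sc" lm "projmod e ?k0" by (rule fmod_projmod)
  interpret K: fmod sc n e dual_scale "dual_act ?M" "Ker_nu ?k0 ?k1 f" by (rule fmod_Ker_nu[OF fh set_L(2)])
  \<comment> \<open>The successor makes the chain strictly longer than the dimension available to
    the growing subspaces.\<close>
  obtain fs where fs: "length fs = Suc (C.T.dim (tup lm e (L1 n \<zeta>) (projmod e ?k0)))" "set fs \<subseteq> HomEta n e \<zeta>"
    "set (map (mat \<zeta>) fs) \<subseteq> Mat e (L1 n \<zeta>) (L0 n \<zeta>)"
    "sorted_wrt (E_van e (L0 n \<zeta>) (L1 n \<zeta>) (L0 n \<zeta>) (L1 n \<zeta>)) (map (mat \<zeta>) fs)"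
    by (rule chain_mat[OF tame \<zeta>])
  have "\<exists>G\<in>set (map (mat \<zeta>) fs). C.surj_mod (L1 n \<zeta>) (L0 n \<zeta>) G (f ` projmod e ?k1)"
    by (rule C.inT_ex_surj[OF submod_hom_image[OF fh] T fs(3,4)]) (simp add: fs(1))
  then obtain g where g: "g \<in> HomEta n e \<zeta>" "C.surj_mod (L1 n \<zeta>) (L0 n \<zeta>) (mat \<zeta> g) (f ` projmod e ?k1)"
    using fs(2) by auto
  have Eg: "E_zero \<eta> \<zeta> f g"
    using g(2) unfolding E_zero_def surj_mod_coker_iff[OF fh set_L(2) set_L(2)] .
  obtain hs where hs: "length hs = Suc (K.T.dim (tup (dual_act ?M) e (L1 n \<zeta>) (Ker_nu ?k0 ?k1 f)))" "set hs \<subseteq> HomEta n e \<zeta>"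
    "set (map (mat \<zeta>) hs) \<subseteq> Mat e (L1 n \<zeta>) (L0 n \<zeta>)"
    "sorted_wrt (E_van e (L0 n \<zeta>) (L1 n \<zeta>) (L0 n \<zeta>) (L1 n \<zeta>)) (map (mat \<zeta>) hs)"
    by (rule chain_mat[OF tame \<zeta>])
  have "\<exists>G\<in>set (map (mat \<zeta>) hs). K.inj_mod (L1 n \<zeta>) (L0 n \<zeta>) G {0}"
    by (rule K.inF_ex_inj[OF K.submod_zero F hs(3,4)]) (simp add: hs(1))
  then obtain h where h: "h \<in> HomEta n e \<zeta>" "K.inj_mod (L1 n \<zeta>) (L0 n \<zeta>) (mat \<zeta> h) {0}"
    using hs(2) by auto
  have Eh: "E_zero \<zeta> \<eta> h f"
    unfolding E_zero_def by (rule inj_mod_imp_E_van[OF fh mat_Mat[OF h(1)] set_L(2,1,1,2) h(2)])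
  have "general (HomEta n e \<zeta>) (hom_scale sc) (\<lambda>g. E_zero \<eta> \<zeta> f g \<and> E_zero \<zeta> \<eta> g f)"
    by (rule general_HomEta_conj[OF general_E_zero_right[OF f g(1) Eg] general_E_zero_left[OF h(1) f Eh]])
  then show ?thesis by (rule generalD)
qed

text \<open>The right-hand side is unchanged when (\<eta>, f) and (\<zeta>, g) are exchanged; this
  is the reciprocity used for TF equivalence.\<close>

lemma Df_mem_iff:
  assumes "E_tame n e" "f \<in> HomEta n e \<eta>" "\<forall>i\<ge>n. \<zeta> i = 0"
  shows "(\<lambda>i. real_of_int (\<zeta> i)) \<in> Df n e sc \<eta> f \<longleftrightarrow> (\<exists>g\<in>HomEta n e \<zeta>. E_zero \<eta> \<zeta> f g \<and> E_zero \<zeta> \<eta> g f)"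
  using E_zero_imp_Df[OF assms(2) _ assms(3)] inT_inF_imp_E_zero[OF assms] unfolding Df_iff[OF assms(2)] by blast

lemma general_Df_mem:
  assumes tame: "E_tame n e" and f: "f \<in> HomEta n e \<eta>" and \<zeta>: "\<forall>i\<ge>n. \<zeta> i = 0"
    and mem: "(\<lambda>i. real_of_int (\<zeta> i)) \<in> Df n e sc \<eta> f"
  shows "general (HomEta n e \<eta>) (hom_scale sc) (\<lambda>f. (\<lambda>i. real_of_int (\<zeta> i)) \<in> Df n e sc \<eta> f)"
proof -
  obtain g where g: "g \<in> HomEta n e \<zeta>" "E_zero \<eta> \<zeta> f g" "E_zero \<zeta> \<eta> g f"
    using mem unfolding Df_mem_iff[OF tame f \<zeta>] by blast
  show ?thesis
    by (rule general_mono[OF general_HomEta_conj[OF general_E_zero_left[OF f g(1,2)] general_E_zero_right[OF g(1) f g(3)]]])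
      (use E_zero_imp_Df[OF _ g(1) \<zeta>] in blast)
qed

text \<open>The inequalities depend on dimension vectors only, and these are bounded by the
  dimensions of P_0 and of the dual of Hom(P1, A), which do not involve f. One finite box of
  integral normals therefore serves every f, so there are finitely many cones D_f.\<close>

lemma Df_halfspaces:
  "\<exists>B. finite B \<and> (\<forall>f\<in>HomEta n e \<eta>. \<exists>T\<subseteq>B. Df n e sc \<eta> f = halfspaces n T)"
proof -
  let ?k0 = "L0 n \<eta>" and ?k1 = "L1 n \<eta>" and ?M = "homA (projmod e (L1 n \<eta>))"
  interpret C: fmod sc n e "vsc sc" lm "projmod e ?k0" by (rule fmod_projmod)
  interpret D: fmod sc n e dual_scale "dual_act ?M" "dualA sc ?M" by (rule fmod_dualA[OF set_L(2)])
  define N where "N = int (C.dim (projmod e ?k0)) + int (D.dim (dualA sc ?M))"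
  define B where "B = {v. \<forall>i. (i \<in> {..<n} \<longrightarrow> v i \<in> {- N..N}) \<and> (i \<notin> {..<n} \<longrightarrow> v i = 0)}"
  have finB: "finite B" unfolding B_def by (rule finite_set_of_finite_funs) auto
  have "\<exists>T\<subseteq>B. Df n e sc \<eta> f = halfspaces n T" if f: "f \<in> HomEta n e \<eta>" for f
  proof -
    have fh: "f \<in> hom_mod lm (projmod e ?k1) lm (projmod e ?k0)" using f unfolding HomEta_eq .
    let ?U = "f ` projmod e ?k1" and ?K = "Ker_nu ?k0 ?k1 f"
    interpret K: fmod sc n e dual_scale "dual_act ?M" ?K by (rule fmod_Ker_nu[OF fh set_L(2)])
    have KD: "submod (dual_act ?M) (dualA sc ?M) ?K" by (rule submod_Ker_nu[OF fh set_L(2)])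
    \<comment> \<open>The dimension vector of the factor P_0/V; \<open>t2\<close> is minus the
      dimension vector of a submodule of K_\<nu>f, so both conditions take the form \<ge> 0.\<close>
    define t1 where "t1 V = (\<lambda>i. if i < n then int (C.dim (lm (e i) ` projmod e ?k0)) - int (C.dim (lm (e i) ` V)) else 0)" for V
    define t2 where "t2 V = (\<lambda>i. if i < n then - int (D.dim (dual_act ?M (e i) ` V)) else 0)" for V
    define T where "T = t1 ` {V. submod lm (projmod e ?k0) V \<and> ?U \<subseteq> V} \<union> t2 ` {V. submod (dual_act ?M) ?K V}"
    have KV: "submod (dual_act ?M) (dualA sc ?M) V" if "submod (dual_act ?M) ?K V" for V
      using that D.submod_sub[OF KD] unfolding submod_def by auto
    have "t1 V \<in> B" if V: "submod lm (projmod e ?k0) V" for V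
    proof -
      have "t1 V i \<in> {- N..N}" if "i < n" for i
        using C.dim_act_image_le[OF V, of "e i"] C.dim_act_image_le[OF C.submod_W, of "e i"] that
        unfolding t1_def N_def by simp
      then show ?thesis unfolding B_def t1_def by auto
    qed
    moreover have "t2 V \<in> B" if V: "submod (dual_act ?M) ?K V" for V
    proof -
      have "t2 V i \<in> {- N..N}" if "i < n" for i
        using D.dim_act_image_le[OF KV[OF V], of "e i"] that unfolding t2_def N_def by simp
      then show ?thesis unfolding B_def t2_def by auto
    qed
    ultimately have "T \<subseteq> B" unfolding T_def by auto
    moreover have "\<theta> \<in> Df n e sc \<eta> f \<longleftrightarrow> \<theta> \<in> halfspaces n T" for \<theta>
    proof -
      have "tval n e (vsc sc) lm \<theta> (projmod e ?k0) - tval n e (vsc sc) lm \<theta> V = (\<Sum>i<n. \<theta> i * real_of_int (t1 V i))" for V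
        unfolding tval_def t1_def sum_subtractf[symmetric] by (intro sum.cong) (auto simp: right_diff_distrib)
      then have T: "inT n e (vsc sc) lm \<theta> (projmod e ?k0) ?U \<longleftrightarrow>
          (\<forall>V. submod lm (projmod e ?k0) V \<and> ?U \<subseteq> V \<longrightarrow> 0 \<le> (\<Sum>i<n. \<theta> i * real_of_int (t1 V i)))"
        unfolding inT_def by simp
      have "tval n e dual_scale (dual_act ?M) \<theta> V = - (\<Sum>i<n. \<theta> i * real_of_int (t2 V i))" for V
        unfolding tval_def t2_def sum_negf[symmetric] by (intro sum.cong) auto
      then have F: "inF n e dual_scale (dual_act ?M) \<theta> ?K {0} \<longleftrightarrow>
          (\<forall>V. submod (dual_act ?M) ?K V \<longrightarrow> 0 \<le> (\<Sum>i<n. \<theta> i * real_of_int (t2 V i)))"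
        unfolding K.inF_zero_iff by simp
      show ?thesis unfolding Df_iff[OF f] T F halfspaces_def T_def by blast
    qed
    ultimately show ?thesis by blast
  qed
  then show ?thesis using finB by blast
qed

lemma Df_cone_mono:
  assumes f: "f \<in> HomEta n e \<eta>" and G: "\<And>v. v \<in> G \<Longrightarrow> (\<lambda>i. real_of_int (v i)) \<in> Df n e sc \<eta> f"
  shows "cone_of G \<subseteq> Df n e sc \<eta> f"
proof -
  obtain T where "Df n e sc \<eta> f = halfspaces n T" using Df_halfspaces[of \<eta>] f by blast
  then show ?thesis using halfspaces_cone[of G n T] G by simp
qed

lemma Df_rat_poly_cone:
  assumes f: "f \<in> HomEta n e \<eta>"
  shows "rat_poly_cone n (Df n e sc \<eta> f)"
proof -
  obtain B T where "finite B" "T \<subseteq> B" "Df n e sc \<eta> f = halfspaces n T" using Df_halfspaces[of \<eta>] f by blast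
  then show ?thesis using rat_poly_cone_halfspaces[OF finite_subset] by metis
qed

lemma general_Df_eq:
  assumes tame: "E_tame n e"
  shows "general (HomEta n e \<eta>) (hom_scale sc) (\<lambda>f. Df n e sc \<eta> f = Deta n e sc \<eta>)"
proof -
  let ?H = "HomEta n e \<eta>"
  let ?C = "Df n e sc \<eta> ` ?H"
  from Df_halfspaces[of \<eta>] obtain B
    where B: "finite B \<and> (\<forall>f\<in>?H. \<exists>T\<subseteq>B. Df n e sc \<eta> f = halfspaces n T)" ..
  have "?C \<subseteq> halfspaces n ` Pow B"
  proof
    fix C assume "C \<in> ?C"
    then obtain f where "f \<in> ?H" "C = Df n e sc \<eta> f" by auto
    then obtain T where "T \<subseteq> B" "C = halfspaces n T" using B by auto
    then show "C \<in> halfspaces n ` Pow B" by blast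
  qed
  then have finC: "finite ?C" by (rule finite_subset) (use B in simp)
  \<comment> \<open>Generators are chosen per cone and not per f: Hom(\<eta>) may be infinite, but
    the finitely many cones give a finite set \<open>?Z\<close>.\<close>
  have "\<forall>C\<in>?C. \<exists>G. finite G \<and> (\<forall>v\<in>G. \<forall>i\<ge>n. v i = 0) \<and> C = cone_of G"
    unfolding rat_poly_cone_iff[symmetric] using Df_rat_poly_cone by auto
  from bchoice[OF this] obtain G
    where "\<forall>C\<in>?C. finite (G C) \<and> (\<forall>v\<in>G C. \<forall>i\<ge>n. v i = 0) \<and> C = cone_of (G C)" ..
  then have G: "finite (G C)" "v \<in> G C \<Longrightarrow> \<forall>i\<ge>n. v i = 0" "cone_of (G C) = C"
    if "C \<in> ?C" for C v using that by auto
  let ?Z = "\<Union>C\<in>?C. G C"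
  have "general ?H (hom_scale sc) (\<lambda>f. \<forall>v\<in>?Z. (\<lambda>i. real_of_int (v i)) \<in> Df n e sc \<eta> f)"
  proof (rule general_HomEta_ball)
    show "finite ?Z" by (rule finite_UN_I[OF finC G(1)])
    fix v assume "v \<in> ?Z"
    then obtain f where f: "f \<in> ?H" "v \<in> G (Df n e sc \<eta> f)" by blast
    have C: "Df n e sc \<eta> f \<in> ?C" using f(1) by blast
    have "(\<lambda>i. real_of_int (v i)) \<in> Df n e sc \<eta> f"
      using cone_of_generator[OF G(1)[OF C] f(2)] unfolding G(3)[OF C] .
    then show "general ?H (hom_scale sc) (\<lambda>f. (\<lambda>i. real_of_int (v i)) \<in> Df n e sc \<eta> f)"
      by (rule general_Df_mem[OF tame f(1) G(2)[OF C f(2)]])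
  qed
  then show ?thesis
  proof (rule general_mono)
    fix f assume f: "f \<in> ?H" and Z: "\<forall>v\<in>?Z. (\<lambda>i. real_of_int (v i)) \<in> Df n e sc \<eta> f"
    have "Df n e sc \<eta> g \<subseteq> Df n e sc \<eta> f" if g: "g \<in> ?H" for g
    proof -
      have C: "Df n e sc \<eta> g \<in> ?C" using g by blast
      have "cone_of (G (Df n e sc \<eta> g)) \<subseteq> Df n e sc \<eta> f" by (rule Df_cone_mono[OF f]) (use Z C in blast)
      then show ?thesis unfolding G(3)[OF C] .
    qed
    then show "Df n e sc \<eta> f = Deta n e sc \<eta>" unfolding Deta_def using f by blast
  qed
qed

lemma Deta_rat_poly_cone:
  assumes tame: "E_tame n e"
  obtains f where "f \<in> HomEta n e \<eta>" "Df n e sc \<eta> f = Deta n e sc \<eta>" "rat_poly_cone n (Deta n e sc \<eta>)"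
proof -
  obtain f where f: "f \<in> HomEta n e \<eta>" "Df n e sc \<eta> f = Deta n e sc \<eta>"
    using generalD[OF general_Df_eq[OF tame, of \<eta>]] by auto
  show thesis by (rule that[OF f Df_rat_poly_cone[OF f(1), unfolded f(2)]])
qed

text \<open>For integral \<zeta> reciprocity is used twice. It turns membership in the cone of
  \<eta> into \<eta> \<in> D_h with h in Hom(\<zeta>), a condition on the two modules C_h and
  K_\<nu>h in which TF equivalence lets \<theta> replace \<eta>; then it is read backwards for
  \<theta>.\<close>

lemma Deta_mono_TF_equiv:
  assumes tame: "E_tame n e" and \<eta>: "\<forall>i\<ge>n. \<eta> i = 0" and \<theta>: "\<forall>i\<ge>n. \<theta> i = 0"
    and TF: "TF_equiv n e sc (\<lambda>i. real_of_int (\<theta> i)) (\<lambda>i. real_of_int (\<eta> i))"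
  shows "Deta n e sc \<eta> \<subseteq> Deta n e sc \<theta>"
proof -
  have integral: "(\<lambda>i. real_of_int (\<zeta> i)) \<in> Deta n e sc \<theta>"
    if mem: "(\<lambda>i. real_of_int (\<zeta> i)) \<in> Deta n e sc \<eta>" and \<zeta>: "\<forall>i\<ge>n. \<zeta> i = 0" for \<zeta>
  proof -
    obtain f h where f: "f \<in> HomEta n e \<eta>" and h: "h \<in> HomEta n e \<zeta>" and E: "E_zero \<eta> \<zeta> f h" "E_zero \<zeta> \<eta> h f"
      using mem Df_mem_iff[OF tame _ \<zeta>] unfolding Deta_def by blast
    let ?k0 = "L0 n \<zeta>" and ?k1 = "L1 n \<zeta>" and ?M = "homA (projmod e (L1 n \<zeta>))"
    have hh: "h \<in> hom_mod lm (projmod e ?k1) lm (projmod e ?k0)" using h unfolding HomEta_eq .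
    interpret K: fmod sc n e dual_scale "dual_act ?M" "Ker_nu ?k0 ?k1 h" by (rule fmod_Ker_nu[OF hh set_L(2)])
    \<comment> \<open>The same two vanishings with f and h exchanged.\<close>
    have "(\<lambda>i. real_of_int (\<eta> i)) \<in> Df n e sc \<zeta> h" by (rule E_zero_imp_Df[OF h f \<eta> E(2,1)])
    then have T: "inT n e (vsc sc) lm (\<lambda>i. real_of_int (\<eta> i)) (projmod e ?k0) (h ` projmod e ?k1)"
      and F: "inF n e dual_scale (dual_act ?M) (\<lambda>i. real_of_int (\<eta> i)) (Ker_nu ?k0 ?k1 h) {0}"
      unfolding Df_iff[OF h] by auto
    have "inT n e (vsc sc) lm (\<lambda>i. real_of_int (\<theta> i)) (projmod e ?k0) (h ` projmod e ?k1)"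
      using TF T submod_projmod[of ?k0] submod_hom_image[OF hh] unfolding TF_equiv_def by blast
    moreover obtain q U where U: "submod lm (Aq q) U"
      "\<And>\<theta>. inF n e (vsc sc) lm \<theta> (Aq q) U \<longleftrightarrow> inF n e dual_scale (dual_act ?M) \<theta> (Ker_nu ?k0 ?k1 h) {0}"
      using K.inF_transport by blast
    have "submod lm (Aq q) (Aq q :: (nat \<Rightarrow> 'a) set)" by (rule fmod.submod_W[OF fmod_Aq])
    then have "inF n e dual_scale (dual_act ?M) (\<lambda>i. real_of_int (\<theta> i)) (Ker_nu ?k0 ?k1 h) {0}"
      using TF F U(1) unfolding TF_equiv_def U(2)[symmetric] by blast
    ultimately obtain g where g: "g \<in> HomEta n e \<theta>" "E_zero \<zeta> \<theta> h g" "E_zero \<theta> \<zeta> g h"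
      using inT_inF_imp_E_zero[OF tame h \<theta>] by blast
    then show ?thesis unfolding Deta_def using E_zero_imp_Df[OF g(1) h \<zeta> g(3,2)] by blast
  qed
  \<comment> \<open>So far only integral points are covered. To pass to the cone they generate the
    target must be convex, which the union D_\<theta> is because it equals a single D_f.\<close>
  obtain f where f: "f \<in> HomEta n e \<theta>" "Df n e sc \<theta> f = Deta n e sc \<theta>"
    by (rule Deta_rat_poly_cone[OF tame])
  obtain G where G: "finite G" "\<forall>v\<in>G. \<forall>i\<ge>n. v i = 0" "Deta n e sc \<eta> = cone_of G"
    by (rule Deta_rat_poly_cone[OF tame, of \<eta>, unfolded rat_poly_cone_iff]) blast
  have "(\<lambda>i. real_of_int (v i)) \<in> Df n e sc \<theta> f" if "v \<in> G" for v
    unfolding f(2) using integral cone_of_generator[OF G(1) that] G(2,3) that by blast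
  then have "cone_of G \<subseteq> Df n e sc \<theta> f" by (rule Df_cone_mono[OF f(1)])
  then show ?thesis unfolding G(3) f(2) .
qed

end

theorem theorem6p14:
  fixes sc :: "'k::field \<Rightarrow> 'a::ring_1 \<Rightarrow> 'a" and n :: nat and e :: "nat \<Rightarrow> 'a"
    and \<eta> :: "nat \<Rightarrow> int"
  assumes "alg_closed_field TYPE('k)"
    and "fd_algebra sc"
    and "complete_prim_idems n e"
    and "E_tame n e"
    and "\<forall>i\<ge>n. \<eta> i = 0"
  shows "(general (HomEta n e \<eta>) (hom_scale sc) (\<lambda>f. Df n e sc \<eta> f = Deta n e sc \<eta>)
          \<and> rat_poly_cone n (Deta n e sc \<eta>))
       \<and> (\<forall>\<theta>::nat \<Rightarrow> int. (\<forall>i\<ge>n. \<theta> i = 0)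
            \<longrightarrow> TF_equiv n e sc (\<lambda>i. real_of_int (\<theta> i)) (\<lambda>i. real_of_int (\<eta> i))
            \<longrightarrow> Deta n e sc \<theta> = Deta n e sc \<eta>)"
proof -
  have "e i * e i = e i" if "i < n" for i
    using assms(3) that unfolding complete_prim_idems_def prim_idem_def by blast
  then interpret idem_algebra sc n e
    using infinite_alg_closed[OF assms(1)] assms(2) by unfold_locales
  have sym: "TF_equiv n e sc \<alpha> \<beta> \<Longrightarrow> TF_equiv n e sc \<beta> \<alpha>" for \<alpha> \<beta> unfolding TF_equiv_def by blast
  have "rat_poly_cone n (Deta n e sc \<eta>)" by (rule Deta_rat_poly_cone[OF assms(4)])
  moreover have "Deta n e sc \<theta> = Deta n e sc \<eta>"
    if "\<forall>i\<ge>n. \<theta> i = 0" "TF_equiv n e sc (\<lambda>i. real_of_int (\<theta> i)) (\<lambda>i. real_of_int (\<eta> i))" for \<theta>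
    by (rule equalityI[OF Deta_mono_TF_equiv[OF assms(4) that(1) assms(5) sym[OF that(2)]]
          Deta_mono_TF_equiv[OF assms(4,5) that]])
  ultimately show ?thesis using general_Df_eq[OF assms(4)] by blast
qed

end
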